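(* Let $G$ be a separable locally compact topological group. Then $G$ is quasi non-archimedean if and only if $G$ is totally disconnected.
   Context: Topological groups are assumed Hausdorff. Separable means having a countable dense subset. A topological group $G$ is quasi non-archimedean if for every neighborhood of the identity $U$ in $G$ and every $n\in\mathbb{N}$, there exists a neighborhood of the identity $V$ such that for every $g_1,\dots,g_n\in V$, the group generated by $g_1,\dots,g_n$ is contained in $U$. A topological group is totally disconnected if its connected components are singletons. *)

theory Defs
  imports "HOL-Analysis.Analysis" "HOL-Algebra.Generated_Groups"
begin

(* Topological groups are Hausdorff by convention. *)
locale topological_group = group G for G (structure) +
  fixes T :: "'a topology"
  assumes topspace_eq_carrier: "topspace T = carrier G"
    and Hausdorff: "Hausdorff_space T"
    and continuous_mult: "continuous_map (prod_topology T T) T (\<lambda>(x, y). x \<otimes> y)"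
    and continuous_inv: "continuous_map T T (\<lambda>x. inv x)"

(* Neighbourhoods need not be open. *)
definition neighbourhood_in :: "'a topology \<Rightarrow> 'a \<Rightarrow> 'a set \<Rightarrow> bool" where
  "neighbourhood_in T x N \<longleftrightarrow> N \<subseteq> topspace T \<and> (\<exists>W. openin T W \<and> x \<in> W \<and> W \<subseteq> N)"

definition quasi_non_archimedean :: "('a, 'b) monoid_scheme \<Rightarrow> 'a topology \<Rightarrow> bool" where
  "quasi_non_archimedean G T \<longleftrightarrow>
     (\<forall>U. neighbourhood_in T \<one>\<^bsub>G\<^esub> U \<longrightarrow>
       (\<forall>n::nat. \<exists>V. neighbourhood_in T \<one>\<^bsub>G\<^esub> V \<and>
          (\<forall>g :: nat \<Rightarrow> 'a. (\<forall>i\<in>{1..n}. g i \<in> V) \<longrightarrow> generate G (g ` {1..n}) \<subseteq> U)))"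

definition totally_disconnected_space :: "'a topology \<Rightarrow> bool" where
  "totally_disconnected_space T \<longleftrightarrow> (\<forall>C \<in> connected_components_of T. \<exists>x. C = {x})"

end

theory Submission
  imports Defs
begin

text \<open>If \<open>G\<close> is totally disconnected, van Dantzig's theorem provides arbitrarily small open subgroups,
  and these witness that \<open>G\<close> is quasi non-archimedean.

  Conversely, the case \<open>n = 1\<close> suffices: every identity neighbourhood \<open>U\<close> contains all powers of all
  elements close to the identity. Suppose \<open>U\<close> contains no open subgroup. The set \<open>Q\<close> of elements
  whose powers all stay in a tiny \<open>V\<close> is a neighbourhood of the identity, so its powers \<open>Q\<^sup>n\<close>
  eventually leave \<open>U\<close>; but by Gleason's trapping lemma they remain in a fixed compact set for a time
  that is long compared with the exit time. In the limit \<open>V \<rightarrow> 1\<close> they sweep out a nontrivial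
  subgroup \<open>H\<close> inside a compact set, in which every element is a product of arbitrarily small elements
  of \<open>H\<close>. As in the Peter-Weyl theorem, \<open>H\<close> acts norm-continuously on the eigenspaces of a
  compact convolution operator, and a small element, all of whose powers are small, must act trivially;
  hence \<open>H\<close> acts trivially, which is absurd. So there are small open subgroups, and \<open>G\<close> is
  totally disconnected.\<close>

text \<open>One estimate is used twice: a bounded sequence whose increments all lie within
  \<open>d\<close> of the first one has first increment at most \<open>d\<close>
  (\<open>bounded_sequence_increment_le\<close>). Along the powers of an element whose powers all
  stay small it converts control of second differences into control of first differences, in the
  trapping lemma and again on the eigenfunctions. The limit group \<open>H\<close> is known only to
  be a subgroup contained in a compact set, so there is no Haar measure on \<open>H\<close> to
  average with. The Haar functional of \<open>G\<close> is used instead, together with an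
  \<open>H\<close>-invariant weight of compact support: the weight makes convolution a compact
  self-adjoint operator although \<open>G\<close> itself may be non-compact, and its invariance
  makes the operator commute with left translation by \<open>H\<close>. Neighbourhoods of the
  identity are not indexed by a sequence, so limits are taken along an ultrafilter on the set of all
  neighbourhoods; this one device builds both the Haar functional and \<open>H\<close>.\<close>

section \<open>Ultrafilters and limits of bounded families\<close>

definition ultrafilter :: "'i filter \<Rightarrow> bool" where
  "ultrafilter F \<longleftrightarrow> F \<noteq> bot \<and> (\<forall>P. eventually P F \<or> eventually (\<lambda>x. \<not> P x) F)"

text \<open>Zorn's lemma for the proper filters below \<open>F\<close>. A smaller filter is a finer
  one, so the order is reversed and \<open>m\<close> is a minimal proper filter.\<close>

lemma ultrafilter_below:
  fixes F :: "'i filter"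
  assumes "F \<noteq> bot"
  obtains U where "U \<le> F" "ultrafilter U"
proof -
  define A where "A = {F'. F' \<le> F \<and> F' \<noteq> bot}"
  have "\<exists>m\<in>A. \<forall>a\<in>A. a \<le> m \<longrightarrow> a = m"
  proof (rule predicate_Zorn)
    show "partial_order_on A (relation_of (\<lambda>a b. b \<le> a) A)"
      by (rule partial_order_on_relation_ofI) auto
  next
    fix C assume C: "C \<in> Chains (relation_of (\<lambda>a b. b \<le> a) A)"
    then have CA: "C \<subseteq> A"
      by (rule Chains_relation_of)
    have tot: "a \<le> b \<or> b \<le> a" if "a \<in> C" "b \<in> C" for a b
      using C that unfolding Chains_def relation_of_def by auto
    show "\<exists>u\<in>A. \<forall>a\<in>C. u \<le> a"
    proof (cases "C = {}")
      case True
      then show ?thesis using assms A_def by auto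
    next
      case False
      \<comment> \<open>A chain is a filter base, so an event of its infimum already occurs in one
        member.\<close>
      have "\<not> eventually (\<lambda>_. False) (Inf C)"
      proof
        assume "eventually (\<lambda>_. False) (Inf C)"
        then have "\<exists>b\<in>C. eventually (\<lambda>_. False) b"
          by (subst (asm) eventually_Inf_base[OF False]) (use tot in \<open>metis inf_absorb1 inf_absorb2 order_refl\<close>)
        then show False
          using CA unfolding A_def by (auto simp: trivial_limit_def)
      qed
      moreover have "Inf C \<le> F"
        using False CA unfolding A_def by (metis (no_types, lifting) Inf_lower2 all_not_in_conv mem_Collect_eq subsetD)
      ultimately have "Inf C \<in> A"
        unfolding A_def by (auto simp: trivial_limit_def)
      then show ?thesis by (auto intro: Inf_lower)
    qed
  qed
  then obtain m where m: "m \<le> F" "m \<noteq> bot" and mx: "\<And>a. a \<le> F \<Longrightarrow> a \<noteq> bot \<Longrightarrow> a \<le> m \<Longrightarrow> a = m"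
    unfolding A_def by auto
  \<comment> \<open>Either \<open>m\<close> is incompatible with the complement of \<open>P\<close>
    and then contains \<open>P\<close>, or meeting \<open>m\<close> with the complement gives a
    proper filter, which by minimality is \<open>m\<close> itself.\<close>
  have "eventually P m \<or> eventually (\<lambda>x. \<not> P x) m" for P
  proof (cases "inf m (principal {x. \<not> P x}) = bot")
    case True
    then have "eventually (\<lambda>_. False) (inf m (principal {x. \<not> P x}))" by simp
    then show ?thesis unfolding eventually_inf_principal by simp
  next
    case False
    then have "inf m (principal {x. \<not> P x}) = m"
      using m by (intro mx) (auto intro: le_infI1)
    then have "m \<le> principal {x. \<not> P x}" by (metis inf.orderI)
    then show ?thesis by (simp add: le_principal)
  qed
  then show thesis using that m unfolding ultrafilter_def by blast
qed

lemma ultrafilter_not_eventually: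
  "ultrafilter F \<Longrightarrow> \<not> eventually P F \<Longrightarrow> eventually (\<lambda>x. \<not> P x) F"
  unfolding ultrafilter_def by blast

lemma ultrafilter_not_bot: "ultrafilter F \<Longrightarrow> F \<noteq> bot"
  unfolding ultrafilter_def by blast

text \<open>A point of \<open>K\<close> that is not a limit has a neighbourhood which the family is
  not eventually in; for an ultrafilter this means that it is eventually outside. Finitely many such
  neighbourhoods cover \<open>K\<close>, so the family would eventually be outside
  \<open>K\<close>.\<close>

lemma ultrafilter_compact_limit:
  assumes F: "ultrafilter F" and K: "compactin X K" and f: "eventually (\<lambda>i. f i \<in> K) F"
  obtains l where "l \<in> K" "limitin X f l F"
proof (rule ccontr)
  assume "\<not> thesis"
  then have "\<forall>l\<in>K. \<exists>U. openin X U \<and> l \<in> U \<and> \<not> eventually (\<lambda>i. f i \<in> U) F"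
    using that compactin_subset_topspace[OF K] unfolding limitin_def by blast
  then obtain U where U: "\<And>l. l \<in> K \<Longrightarrow> openin X (U l) \<and> l \<in> U l \<and> \<not> eventually (\<lambda>i. f i \<in> U l) F"
    by metis
  have "\<exists>\<F>. finite \<F> \<and> \<F> \<subseteq> U ` K \<and> K \<subseteq> \<Union>\<F>"
    by (rule compactinD[OF K]) (use U in auto)
  then obtain D where D: "finite D" "D \<subseteq> K" "K \<subseteq> (\<Union>l\<in>D. U l)"
    by (metis finite_subset_image)
  have "eventually (\<lambda>i. \<forall>l\<in>D. f i \<notin> U l) F"
    using D U ultrafilter_not_eventually[OF F] by (subst eventually_ball_finite_distrib) auto
  with f have "eventually (\<lambda>i. False) F"
    by eventually_elim (use D in auto)
  then show False
    using ultrafilter_not_bot[OF F] by (simp add: trivial_limit_def)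
qed

lemma ultrafilter_real_limit:
  fixes f :: "'i \<Rightarrow> real"
  assumes F: "ultrafilter F" and f: "eventually (\<lambda>i. a \<le> f i \<and> f i \<le> b) F"
  obtains l where "a \<le> l" "l \<le> b" "(f \<longlongrightarrow> l) F"
proof -
  have "compactin euclidean {a..b}" by (simp add: compactin_euclidean_iff)
  moreover have "eventually (\<lambda>i. f i \<in> {a..b}) F" using f by simp
  ultimately obtain l where "l \<in> {a..b}" "limitin euclidean f l F"
    using ultrafilter_compact_limit[OF F] by blast
  then show thesis using that by auto
qed

text \<open>If all increments stay within \<open>d\<close> of the first, the sequence drifts by at
  least \<open>\<bar>a 1 - a 0\<bar> - d\<close> per step, which boundedness forbids when this speed
  is positive. Any bound \<open>M\<close>, however large, gives the same conclusion.\<close>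

lemma bounded_sequence_increment_le:
  fixes a :: "nat \<Rightarrow> real"
  assumes bd: "\<And>i. \<bar>a i\<bar> \<le> M" and inc: "\<And>i. \<bar>(a (Suc i) - a i) - (a 1 - a 0)\<bar> \<le> d"
  shows "\<bar>a 1 - a 0\<bar> \<le> d"
proof (rule ccontr)
  assume "\<not> \<bar>a 1 - a 0\<bar> \<le> d"
  then have r: "0 < \<bar>a 1 - a 0\<bar> - d" (is "0 < ?r") by simp
  \<comment> \<open>After \<open>N\<close> steps the drift exceeds \<open>2 * M\<close>, the largest
    possible distance between two terms.\<close>
  obtain N :: nat where N: "2 * M < real N * ?r"
    using reals_Archimedean3[OF r] by blast
  have tel: "(\<Sum>i<N. a (Suc i) - a i) = a N - a 0"
    by (rule sum_lessThan_telescope)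
  have "(\<Sum>i<N. (a (Suc i) - a i) - (a 1 - a 0)) = (a N - a 0) - real N * (a 1 - a 0)"
    using tel by (subst sum_subtractf) simp
  then have "\<bar>(a N - a 0) - real N * (a 1 - a 0)\<bar> = \<bar>\<Sum>i<N. (a (Suc i) - a i) - (a 1 - a 0)\<bar>"
    by (rule arg_cong[OF sym])
  also have "\<dots> \<le> (\<Sum>i<N. \<bar>(a (Suc i) - a i) - (a 1 - a 0)\<bar>)" by (rule sum_abs)
  also have "\<dots> \<le> (\<Sum>i<N. d)" by (intro sum_mono inc)
  finally have "\<bar>(a N - a 0) - real N * (a 1 - a 0)\<bar> \<le> real N * d" by simp
  moreover have "\<bar>a N - a 0\<bar> \<le> 2 * M" using bd[of N] bd[of 0] by simp
  moreover have "\<bar>real N * (a 1 - a 0)\<bar> = real N * \<bar>a 1 - a 0\<bar>" by (simp add: abs_mult)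
  ultimately have "real N * \<bar>a 1 - a 0\<bar> \<le> 2 * M + real N * d" by linarith
  then show False using N by (simp add: algebra_simps)
qed

section \<open>Locally compact groups\<close>

locale lc_group = topological_group +
  assumes locally_compact: "locally_compact_space T"
begin

abbreviation nb :: "'a set \<Rightarrow> bool" where
  "nb \<equiv> neighbourhood_in T \<one>"

lemma nb_one: "nb U \<Longrightarrow> \<one> \<in> U"
  unfolding neighbourhood_in_def by auto

lemma nb_carrier: "nb U \<Longrightarrow> U \<subseteq> carrier G"
  unfolding neighbourhood_in_def topspace_eq_carrier by auto

lemma nb_in_carrier: "nb U \<Longrightarrow> x \<in> U \<Longrightarrow> x \<in> carrier G"
  using nb_carrier by auto

lemma nb_topspace: "nb (carrier G)"
  unfolding neighbourhood_in_def by (metis one_closed openin_topspace subset_refl topspace_eq_carrier)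

lemma nb_open: "openin T W \<Longrightarrow> \<one> \<in> W \<Longrightarrow> nb W"
  unfolding neighbourhood_in_def using openin_subset by auto

lemma nb_mono: "nb U \<Longrightarrow> U \<subseteq> V \<Longrightarrow> V \<subseteq> carrier G \<Longrightarrow> nb V"
  unfolding neighbourhood_in_def topspace_eq_carrier by blast

lemma nb_Int: "nb U \<Longrightarrow> nb V \<Longrightarrow> nb (U \<inter> V)"
  unfolding neighbourhood_in_def by (meson IntI Int_mono le_infI1 openin_Int)

lemma continuous_ltrans: "a \<in> carrier G \<Longrightarrow> continuous_map T T (\<lambda>x. a \<otimes> x)"
proof -
  assume "a \<in> carrier G"
  then have "continuous_map T (prod_topology T T) (\<lambda>x. (a, x))"
    by (simp add: continuous_map_pairedI topspace_eq_carrier)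
  from continuous_map_compose[OF this continuous_mult] show ?thesis
    by (simp add: o_def)
qed

lemma continuous_mult2:
  assumes "continuous_map X T f" "continuous_map X T g"
  shows "continuous_map X T (\<lambda>x. f x \<otimes> g x)"
proof -
  have "continuous_map X (prod_topology T T) (\<lambda>x. (f x, g x))"
    using assms by (simp add: continuous_map_pairedI)
  from continuous_map_compose[OF this continuous_mult] show ?thesis
    by (simp add: o_def)
qed

lemma continuous_inv2: "continuous_map X T f \<Longrightarrow> continuous_map X T (\<lambda>x. inv (f x))"
  using continuous_map_compose[OF _ continuous_inv] by (simp add: o_def)

lemma nb_preimage:
  assumes "continuous_map T T f" "f \<one> = \<one>" "nb U"
  shows "nb {x \<in> carrier G. f x \<in> U}"
proof -
  obtain W where W: "openin T W" "\<one> \<in> W" "W \<subseteq> U" using assms unfolding neighbourhood_in_def by auto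
  have "openin T {x \<in> topspace T. f x \<in> W}" by (rule openin_continuous_map_preimage) (use assms W in auto)
  then have "nb {x \<in> topspace T. f x \<in> W}" by (rule nb_open) (use assms W in \<open>auto simp: topspace_eq_carrier\<close>)
  then show ?thesis by (rule nb_mono) (use W in \<open>auto simp: topspace_eq_carrier\<close>)
qed

lemma nb_inv: "nb U \<Longrightarrow> nb {x \<in> carrier G. inv x \<in> U}"
  by (rule nb_preimage) (auto simp: continuous_inv)

lemma nb_mult_sym:
  assumes "nb U"
  obtains V where "nb V" "V \<subseteq> U" "\<And>x. x \<in> V \<Longrightarrow> inv x \<in> V" "\<And>x y. x \<in> V \<Longrightarrow> y \<in> V \<Longrightarrow> x \<otimes> y \<in> U"
proof -
  obtain W where W: "openin T W" "\<one> \<in> W" "W \<subseteq> U" using assms unfolding neighbourhood_in_def by auto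
  define P where "P = {z \<in> topspace (prod_topology T T). (case z of (x, y) \<Rightarrow> x \<otimes> y) \<in> W}"
  have "openin (prod_topology T T) P" unfolding P_def
    by (rule openin_continuous_map_preimage[OF continuous_mult W(1)])
  then have "\<forall>x y. (x, y) \<in> P \<longrightarrow> (\<exists>A B. openin T A \<and> openin T B \<and> x \<in> A \<and> y \<in> B \<and> A \<times> B \<subseteq> P)"
    by (simp only: openin_prod_topology_alt)
  moreover have "(\<one>, \<one>) \<in> P" using W by (auto simp: P_def topspace_eq_carrier)
  ultimately obtain A B where AB: "openin T A" "openin T B" "\<one> \<in> A" "\<one> \<in> B" "A \<times> B \<subseteq> P"
    by metis
  define V0 where "V0 = A \<inter> B"
  have V0: "nb V0" "\<And>x y. x \<in> V0 \<Longrightarrow> y \<in> V0 \<Longrightarrow> x \<otimes> y \<in> U"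
    using AB W(3) unfolding V0_def P_def by (auto intro!: nb_open)
  define V where "V = (V0 \<inter> U) \<inter> {x \<in> carrier G. inv x \<in> V0 \<inter> U}"
  show thesis
  proof (rule that)
    show "nb V" unfolding V_def
      using nb_Int[OF nb_Int[OF V0(1) assms] nb_inv[OF nb_Int[OF V0(1) assms]]] .
  qed (use V0 nb_carrier in \<open>auto simp: V_def\<close>)
qed

lemma nb_compact:
  assumes "nb U"
  obtains C where "nb C" "compactin T C" "C \<subseteq> U"
proof -
  obtain W where W: "openin T W" "\<one> \<in> W" "W \<subseteq> U" using assms unfolding neighbourhood_in_def by auto
  have "neighbourhood_base_of (compactin T) T"
    using locally_compact Hausdorff locally_compact_space_neighbourhood_base by blast
  then obtain V C where "openin T V" "compactin T C" "\<one> \<in> V" "V \<subseteq> C" "C \<subseteq> W"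
    using W unfolding neighbourhood_base_of by meson
  then show thesis
    using W that unfolding neighbourhood_in_def
    by (metis compactin_subset_topspace subset_trans)
qed

lemma compact_carrier: "compactin T K \<Longrightarrow> K \<subseteq> carrier G"
  using compactin_subset_topspace topspace_eq_carrier by blast

lemma compact_set_mult:
  assumes "compactin T K" "compactin T L"
  shows "compactin T (K <#> L)"
proof -
  have "compactin (prod_topology T T) (K \<times> L)"
    using assms by (simp add: compactin_Times)
  then have "compactin T ((\<lambda>(x, y). x \<otimes> y) ` (K \<times> L))"
    using continuous_mult image_compactin by blast
  moreover have "(\<lambda>(x, y). x \<otimes> y) ` (K \<times> L) = K <#> L"
    by (auto simp: set_mult_def)
  ultimately show ?thesis by simp
qed

lemma set_multI: "x \<in> A \<Longrightarrow> y \<in> B \<Longrightarrow> x \<otimes> y \<in> A <#> B"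
  unfolding set_mult_def by auto

lemma set_multE: "z \<in> A <#> B \<Longrightarrow> (\<And>x y. x \<in> A \<Longrightarrow> y \<in> B \<Longrightarrow> z = x \<otimes> y \<Longrightarrow> P) \<Longrightarrow> P"
  unfolding set_mult_def by auto

lemma compact_inv_image: "compactin T K \<Longrightarrow> compactin T ((\<lambda>x. inv x) ` K)"
  using continuous_inv image_compactin by blast

lemma compact_ltrans_image: "a \<in> carrier G \<Longrightarrow> compactin T K \<Longrightarrow> compactin T ((\<lambda>x. a \<otimes> x) ` K)"
  using continuous_ltrans image_compactin by blast

lemma cancel_inv1 [simp]: "x \<in> carrier G \<Longrightarrow> y \<in> carrier G \<Longrightarrow> inv x \<otimes> (x \<otimes> y) = y"
  by (simp add: m_assoc[symmetric])

lemma cancel_inv2 [simp]: "x \<in> carrier G \<Longrightarrow> y \<in> carrier G \<Longrightarrow> x \<otimes> (inv x \<otimes> y) = y"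
  by (simp add: m_assoc[symmetric])

lemma nb_translate:
  assumes "nb U" "a \<in> carrier G"
  obtains W where "openin T W" "a \<in> W" "\<And>x. x \<in> W \<Longrightarrow> inv a \<otimes> x \<in> U"
proof -
  obtain W where W: "openin T W" "\<one> \<in> W" "W \<subseteq> U" using assms unfolding neighbourhood_in_def by auto
  have "openin T {x \<in> topspace T. inv a \<otimes> x \<in> W}"
    by (rule openin_continuous_map_preimage) (use W assms in \<open>auto intro!: continuous_ltrans\<close>)
  then show thesis by (rule that) (use W assms in \<open>auto simp: topspace_eq_carrier\<close>)
qed

lemma compact_cover_translates:
  assumes K: "compactin T K" and U: "nb U"
  obtains F where "finite F" "F \<subseteq> K" "\<And>x. x \<in> K \<Longrightarrow> \<exists>a\<in>F. inv a \<otimes> x \<in> U"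
proof -
  have "\<forall>a\<in>K. \<exists>W. openin T W \<and> a \<in> W \<and> (\<forall>x\<in>W. inv a \<otimes> x \<in> U)"
    using nb_translate[OF U] compact_carrier[OF K] by (metis subsetD)
  then obtain W where W: "\<And>a. a \<in> K \<Longrightarrow> openin T (W a) \<and> a \<in> W a \<and> (\<forall>x\<in>W a. inv a \<otimes> x \<in> U)"
    by metis
  have "\<exists>\<F>. finite \<F> \<and> \<F> \<subseteq> W ` K \<and> K \<subseteq> \<Union>\<F>"
    by (rule compactinD[OF K]) (use W in auto)
  then obtain D where D: "finite D" "D \<subseteq> K" "K \<subseteq> (\<Union>l\<in>D. W l)"
    by (metis finite_subset_image)
  show thesis
    by (rule that[of D]) (use D W in blast)+
qed

text \<open>The source of uniform estimates over a compact set: for conjugation, for uniform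
  continuity and, in van Dantzig's theorem, for right translation.\<close>

lemma nb_tube:
  assumes K: "compactin T K" and c: "continuous_map (prod_topology T T) X F"
    and W: "openin X W" and F: "\<And>x. x \<in> K \<Longrightarrow> F (x, \<one>) \<in> W"
  obtains V where "nb V" "\<And>x v. x \<in> K \<Longrightarrow> v \<in> V \<Longrightarrow> F (x, v) \<in> W"
proof -
  define P where "P = {z \<in> topspace (prod_topology T T). F z \<in> W}"
  have P: "openin (prod_topology T T) P" unfolding P_def
    by (rule openin_continuous_map_preimage[OF c W])
  have "\<exists>U V. openin T U \<and> openin T V \<and> K \<subseteq> U \<and> \<one> \<in> V \<and> U \<times> V \<subseteq> P"
    by (rule tube_lemma_left[OF P K]) (use F compact_carrier[OF K] in \<open>auto simp: P_def topspace_eq_carrier\<close>)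
  then obtain U V where "openin T U" "openin T V" "K \<subseteq> U" "\<one> \<in> V" "U \<times> V \<subseteq> P" by blast
  then show thesis by (intro that[of V]) (auto simp: P_def intro: nb_open)
qed

text \<open>Translating \<open>x\<close> by \<open>h\<close> in a convolution kernel turns
  \<open>inv y \<otimes> x\<close> into \<open>(inv y \<otimes> h \<otimes> y) \<otimes> (inv y
  \<otimes> x)\<close>. The conjugate of a small \<open>h\<close> is uniformly small for
  \<open>y\<close> in a compact set, which is why supports are kept compact throughout.\<close>

lemma nb_conj_compact:
  assumes K: "compactin T K" and U: "nb U"
  obtains V where "nb V" "\<And>x v. x \<in> K \<Longrightarrow> v \<in> V \<Longrightarrow> inv x \<otimes> v \<otimes> x \<in> U"
proof -
  obtain W where W: "openin T W" "\<one> \<in> W" "W \<subseteq> U" using assms unfolding neighbourhood_in_def by auto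
  have c: "continuous_map (prod_topology T T) T (\<lambda>z. inv (fst z) \<otimes> snd z \<otimes> fst z)"
    by (intro continuous_mult2 continuous_inv2 continuous_map_fst continuous_map_snd)
  obtain V where "nb V" "\<And>x v. x \<in> K \<Longrightarrow> v \<in> V \<Longrightarrow> inv x \<otimes> v \<otimes> x \<in> W"
    using nb_tube[OF K c W(1)] W(2) compact_carrier[OF K] by (auto simp: subset_iff)
  then show thesis using that W by blast
qed


section \<open>Continuous functions of compact support\<close>

abbreviation cont :: "('a \<Rightarrow> real) \<Rightarrow> bool" where
  "cont \<equiv> continuous_map T euclideanreal"

text \<open>Values off \<open>carrier G\<close> are unconstrained: a function stands for its
  restriction to the carrier, and \<open>Cc_cong\<close> and \<open>I_cong\<close> express that
  nothing else matters.\<close>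

definition Cc :: "('a \<Rightarrow> real) set" where
  "Cc = {f. cont f \<and> (\<exists>K. compactin T K \<and> (\<forall>x\<in>carrier G - K. f x = 0))}"

lemma Cc_cont: "f \<in> Cc \<Longrightarrow> cont f"
  unfolding Cc_def by auto

lemma CcI: "cont f \<Longrightarrow> compactin T K \<Longrightarrow> (\<And>x. x \<in> carrier G \<Longrightarrow> x \<notin> K \<Longrightarrow> f x = 0) \<Longrightarrow> f \<in> Cc"
  unfolding Cc_def by auto

lemma Cc_support:
  assumes "f \<in> Cc"
  obtains K where "compactin T K" "\<And>x. x \<in> carrier G \<Longrightarrow> x \<notin> K \<Longrightarrow> f x = 0"
  using assms unfolding Cc_def by auto

lemma cont_cong: "cont f \<Longrightarrow> (\<And>x. x \<in> carrier G \<Longrightarrow> f x = g x) \<Longrightarrow> cont g"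
  using continuous_map_eq[of T euclideanreal f g] by (auto simp: topspace_eq_carrier)

lemma Cc_cong: "f \<in> Cc \<Longrightarrow> (\<And>x. x \<in> carrier G \<Longrightarrow> f x = g x) \<Longrightarrow> g \<in> Cc"
  unfolding Cc_def using cont_cong by fastforce

lemma Cc_mult: "cont f \<Longrightarrow> g \<in> Cc \<Longrightarrow> (\<lambda>x. f x * g x) \<in> Cc"
  unfolding Cc_def by (fastforce intro: continuous_map_real_mult)

lemma Cc_mult': "f \<in> Cc \<Longrightarrow> cont g \<Longrightarrow> (\<lambda>x. f x * g x) \<in> Cc"
  unfolding Cc_def by (fastforce intro: continuous_map_real_mult)

lemma Cc_scale: "g \<in> Cc \<Longrightarrow> (\<lambda>x. c * g x) \<in> Cc"
  by (rule Cc_mult) auto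

lemma Cc_zero: "(\<lambda>x. 0) \<in> Cc"
  by (rule CcI[where K="{}"]) auto

lemma Cc_add:
  assumes "f \<in> Cc" "g \<in> Cc"
  shows "(\<lambda>x. f x + g x) \<in> Cc"
proof -
  obtain K where K: "compactin T K" "\<And>x. x \<in> carrier G \<Longrightarrow> x \<notin> K \<Longrightarrow> f x = 0" using Cc_support[OF assms(1)] by blast
  obtain L where L: "compactin T L" "\<And>x. x \<in> carrier G \<Longrightarrow> x \<notin> L \<Longrightarrow> g x = 0" using Cc_support[OF assms(2)] by blast
  show ?thesis
  proof (rule CcI)
    show "cont (\<lambda>x. f x + g x)"
      by (rule continuous_map_add[OF Cc_cont[OF assms(1)] Cc_cont[OF assms(2)]])
    show "compactin T (K \<union> L)" by (rule compactin_Un[OF K(1) L(1)])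
  qed (use K L in auto)
qed

lemma Cc_diff: "f \<in> Cc \<Longrightarrow> g \<in> Cc \<Longrightarrow> (\<lambda>x. f x - g x) \<in> Cc"
  using Cc_add[of f "\<lambda>x. (-1) * g x"] Cc_scale[of g "-1"] by simp

lemma Cc_sum: "finite A \<Longrightarrow> (\<And>a. a \<in> A \<Longrightarrow> f a \<in> Cc) \<Longrightarrow> (\<lambda>x. \<Sum>a\<in>A. f a x) \<in> Cc"
  by (induction A rule: finite_induct) (auto simp: Cc_zero Cc_add)

lemma Cc_max0: "f \<in> Cc \<Longrightarrow> (\<lambda>x. max (f x) 0) \<in> Cc"
  unfolding Cc_def by (fastforce intro: continuous_map_real_max)

lemma Cc_abs: "f \<in> Cc \<Longrightarrow> (\<lambda>x. \<bar>f x\<bar>) \<in> Cc"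
  unfolding Cc_def by (fastforce intro: continuous_map_real_abs)

lemma cont_ltrans: "a \<in> carrier G \<Longrightarrow> cont f \<Longrightarrow> cont (\<lambda>x. f (a \<otimes> x))"
  using continuous_map_compose[OF continuous_ltrans] by (fastforce simp: o_def)

lemma Cc_ltrans:
  assumes a: "a \<in> carrier G" and "f \<in> Cc"
  shows "(\<lambda>x. f (a \<otimes> x)) \<in> Cc"
proof -
  obtain K where K: "compactin T K" "\<And>x. x \<in> carrier G \<Longrightarrow> x \<notin> K \<Longrightarrow> f x = 0" using Cc_support[OF assms(2)] by blast
  show ?thesis
  proof (rule CcI)
    show "cont (\<lambda>x. f (a \<otimes> x))" using assms cont_ltrans Cc_cont by auto
    show "compactin T ((\<lambda>x. inv a \<otimes> x) ` K)" using a K by (intro compact_ltrans_image) auto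
    fix x assume x: "x \<in> carrier G" "x \<notin> (\<lambda>x. inv a \<otimes> x) ` K"
    then have "a \<otimes> x \<notin> K" using a by (metis cancel_inv1 imageI)
    then show "f (a \<otimes> x) = 0" using K x a by auto
  qed
qed

lemma cont_inv: "cont f \<Longrightarrow> cont (\<lambda>x. f (inv x))"
  using continuous_map_compose[OF continuous_inv] by (fastforce simp: o_def)

lemma Cc_inv:
  assumes "f \<in> Cc"
  shows "(\<lambda>x. f (inv x)) \<in> Cc"
proof -
  obtain K where K: "compactin T K" "\<And>x. x \<in> carrier G \<Longrightarrow> x \<notin> K \<Longrightarrow> f x = 0" using Cc_support[OF assms] by blast
  show ?thesis
  proof (rule CcI)
    show "cont (\<lambda>x. f (inv x))" using assms cont_inv Cc_cont by auto
    show "compactin T ((\<lambda>x. inv x) ` K)" using K by (intro compact_inv_image) auto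
    fix x assume x: "x \<in> carrier G" "x \<notin> (\<lambda>x. inv x) ` K"
    then have "inv x \<notin> K" by (metis inv_inv imageI)
    then show "f (inv x) = 0" using K x by auto
  qed
qed

lemma Cc_bounded:
  assumes "f \<in> Cc"
  obtains M where "0 < M" "\<And>x. x \<in> carrier G \<Longrightarrow> \<bar>f x\<bar> \<le> M"
proof -
  obtain K where K: "compactin T K" "\<And>x. x \<in> carrier G \<Longrightarrow> x \<notin> K \<Longrightarrow> f x = 0" using Cc_support[OF assms] by blast
  have "compactin euclideanreal (f ` K)"
    using K Cc_cont[OF assms] image_compactin by blast
  then have "bounded (f ` K)" by (simp add: compactin_euclidean_iff compact_imp_bounded)
  then obtain B where B: "\<And>x. x \<in> K \<Longrightarrow> \<bar>f x\<bar> \<le> B" unfolding bounded_iff by auto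
  have "\<bar>f x\<bar> \<le> max B 1" if "x \<in> carrier G" for x
    using B[of x] K(2)[OF that] by (cases "x \<in> K") auto
  then show thesis by (intro that[of "max B 1"]) auto
qed

definition right_uc :: "('a \<Rightarrow> real) \<Rightarrow> bool" where
  "right_uc f \<longleftrightarrow> (\<forall>e>0. \<exists>V. nb V \<and> (\<forall>x\<in>carrier G. \<forall>v\<in>V. \<bar>f (x \<otimes> v) - f x\<bar> < e))"

lemma right_ucD:
  assumes "right_uc f" "0 < e"
  obtains V where "nb V" "\<And>x v. x \<in> carrier G \<Longrightarrow> v \<in> V \<Longrightarrow> \<bar>f (x \<otimes> v) - f x\<bar> < e"
  using assms unfolding right_uc_def by blast

lemma right_uc_cont:
  assumes "right_uc f"
  shows "cont f"
  unfolding continuous_map_def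
proof (intro conjI allI impI)
  show "f \<in> topspace T \<rightarrow> topspace euclideanreal" by simp
  fix U :: "real set" assume U: "openin euclideanreal U"
  show "openin T {x \<in> topspace T. f x \<in> U}"
  proof (subst openin_subopen, intro ballI)
    fix x assume "x \<in> {x \<in> topspace T. f x \<in> U}"
    then have x: "x \<in> carrier G" "f x \<in> U" by (auto simp: topspace_eq_carrier)
    then obtain e where e: "0 < e" "ball (f x) e \<subseteq> U" using U by (auto simp: open_contains_ball)
    obtain V where V: "nb V" "\<And>x v. x \<in> carrier G \<Longrightarrow> v \<in> V \<Longrightarrow> \<bar>f (x \<otimes> v) - f x\<bar> < e"
      using right_ucD[OF assms e(1)] by blast
    obtain W where W: "openin T W" "x \<in> W" "\<And>y. y \<in> W \<Longrightarrow> inv x \<otimes> y \<in> V"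
      using nb_translate[OF V(1) x(1)] by blast
    have "W \<subseteq> {x \<in> topspace T. f x \<in> U}"
    proof
      fix y assume y: "y \<in> W"
      then have yc: "y \<in> carrier G" using W openin_subset topspace_eq_carrier by blast
      have "\<bar>f (x \<otimes> (inv x \<otimes> y)) - f x\<bar> < e" using V(2)[OF x(1) W(3)[OF y]] .
      then have "f y \<in> ball (f x) e" using x yc by (simp add: dist_real_def abs_minus_commute)
      then show "y \<in> {x \<in> topspace T. f x \<in> U}" using e yc topspace_eq_carrier by auto
    qed
    then show "\<exists>S. openin T S \<and> x \<in> S \<and> S \<subseteq> {x \<in> topspace T. f x \<in> U}" using W by blast
  qed
qed

lemma Cc_right_uc:
  assumes "f \<in> Cc"
  shows "right_uc f"
  unfolding right_uc_def
proof (intro allI impI)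
  fix e :: real assume e: "0 < e"
  obtain K where K: "compactin T K" "\<And>x. x \<in> carrier G \<Longrightarrow> x \<notin> K \<Longrightarrow> f x = 0" using Cc_support[OF assms] by blast
  have c: "continuous_map (prod_topology T T) euclideanreal (\<lambda>z. f (fst z \<otimes> snd z) - f (fst z))"
    using continuous_map_compose[OF _ Cc_cont[OF assms], unfolded o_def]
    by (intro continuous_map_diff) (auto intro!: continuous_mult2 continuous_map_fst continuous_map_snd)
  obtain V where V: "nb V" "\<And>x v. x \<in> K \<Longrightarrow> v \<in> V \<Longrightarrow> f (x \<otimes> v) - f x \<in> {-e<..<e}"
    using nb_tube[OF K(1) c, of "{-e<..<e}"] e compact_carrier[OF K(1)] by (auto simp: subset_iff)
  \<comment> \<open>A symmetric \<open>W\<close> handles the case where only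
    \<open>x \<otimes> v\<close> lies in \<open>K\<close>: the estimate is then applied at
    \<open>x \<otimes> v\<close> with the factor \<open>inv v\<close>.\<close>
  obtain W where W: "nb W" "W \<subseteq> V" "\<And>x. x \<in> W \<Longrightarrow> inv x \<in> W"
    using nb_mult_sym[OF V(1)] by metis
  have "\<bar>f (x \<otimes> v) - f x\<bar> < e" if x: "x \<in> carrier G" and v: "v \<in> W" for x v
  proof -
    have vc: "v \<in> carrier G" using v W nb_in_carrier by blast
    consider "x \<in> K" | "x \<otimes> v \<in> K" | "x \<notin> K" "x \<otimes> v \<notin> K" by blast
    then show ?thesis
    proof cases
      case 1
      then show ?thesis using V(2)[of x v] W v by (auto simp: abs_less_iff)
    next
      case 2
      have "x \<otimes> v \<otimes> inv v = x" using x vc by (simp add: m_assoc)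
      moreover have "inv v \<in> V" using W v by auto
      ultimately show ?thesis using V(2)[OF 2, of "inv v"] by auto
    next
      case 3
      then show ?thesis using K(2) x vc e by auto
    qed
  qed
  then show "\<exists>V. nb V \<and> (\<forall>x\<in>carrier G. \<forall>v\<in>V. \<bar>f (x \<otimes> v) - f x\<bar> < e)"
    using W by blast
qed

lemma Cc_left_uc:
  assumes "f \<in> Cc" "0 < e"
  obtains V where "nb V" "\<And>x v. x \<in> carrier G \<Longrightarrow> v \<in> V \<Longrightarrow> \<bar>f (v \<otimes> x) - f x\<bar> < e"
proof -
  obtain V where V: "nb V" "\<And>x v. x \<in> carrier G \<Longrightarrow> v \<in> V \<Longrightarrow> \<bar>f (inv (x \<otimes> v)) - f (inv x)\<bar> < e"
    using right_ucD[OF Cc_right_uc[OF Cc_inv[OF assms(1)]] assms(2)] by blast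
  show thesis
  proof (rule that)
    show "nb {x \<in> carrier G. inv x \<in> V}" using V nb_inv by auto
    fix x v assume "x \<in> carrier G" "v \<in> {x \<in> carrier G. inv x \<in> V}"
    then show "\<bar>f (v \<otimes> x) - f x\<bar> < e"
      using V(2)[of "inv x" "inv v"] by (simp add: inv_mult_group)
  qed
qed

lemma bump_exists:
  assumes U: "nb U"
  obtains b where "b \<in> Cc" "\<And>x. 0 \<le> b x" "\<And>x. b x \<le> 1" "b \<one> = 1" "\<And>x. x \<notin> U \<Longrightarrow> b x = 0"
proof -
  obtain C where C: "nb C" "compactin T C" "C \<subseteq> U" by (rule nb_compact[OF U])
  obtain W where W: "openin T W" "\<one> \<in> W" "W \<subseteq> C" using C(1) unfolding neighbourhood_in_def by auto
  have "completely_regular_space T"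
    using locally_compact_regular_imp_completely_regular_space locally_compact Hausdorff by blast
  then obtain f where f: "continuous_map T (top_of_set {0..1::real}) f" "f \<one> = 0" "f ` (topspace T - W) \<subseteq> {1}"
    unfolding completely_regular_space_def using W
    by (metis Diff_iff W(1) closedin_diff closedin_topspace one_closed topspace_eq_carrier)
  have f': "cont f" "\<And>x. x \<in> carrier G \<Longrightarrow> 0 \<le> f x \<and> f x \<le> 1"
    using f(1) by (auto simp: continuous_map_in_subtopology topspace_eq_carrier)
  \<comment> \<open>The separating function \<open>f\<close> is 0 at the identity and 1 off
    \<open>W\<close>, hence \<open>1 - f\<close>; the value 0 off the carrier makes the bounds hold
    for every \<open>x\<close> of the type.\<close>
  define b where "b = (\<lambda>x. if x \<in> carrier G then 1 - f x else 0)"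
  show thesis
  proof (rule that)
    have cb: "cont b"
      by (rule cont_cong[of "\<lambda>x. 1 - f x"]) (auto simp: b_def intro!: continuous_map_diff f')
    show "b \<in> Cc"
      by (rule CcI[OF cb C(2)]) (use f W in \<open>auto simp: b_def topspace_eq_carrier\<close>)
    show "0 \<le> b x" "b x \<le> 1" for x using f' by (auto simp: b_def)
    show "b \<one> = 1" using f by (simp add: b_def)
    show "b x = 0" if "x \<notin> U" for x using that f W C by (auto simp: b_def topspace_eq_carrier)
  qed
qed

lemma cont_superlevel_nb:
  assumes "cont b" "c < b \<one>"
  shows "nb {x \<in> carrier G. c < b x}"
proof -
  have "openin T {x \<in> topspace T. b x \<in> {c<..}}"
    by (rule openin_continuous_map_preimage[OF assms(1)]) auto
  then show ?thesis using assms by (intro nb_open) (auto simp: topspace_eq_carrier)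
qed

text \<open>By compactness finitely many translates of the set where \<open>b\<close> exceeds half
  its value at the identity cover \<open>K\<close>. The result feeds cutoff functions, dominating
  combinations and the partition of unity in the Fubini argument.\<close>

lemma Cc_cover:
  assumes b: "b \<in> Cc" "\<And>x. x \<in> carrier G \<Longrightarrow> 0 \<le> b x" "0 < b \<one>" and K: "compactin T K"
  obtains F d where "finite F" "F \<subseteq> K" "0 < d" "\<And>x. x \<in> K \<Longrightarrow> d \<le> (\<Sum>a\<in>F. b (inv a \<otimes> x))"
proof -
  define U where "U = {x \<in> carrier G. b \<one> / 2 < b x}"
  have "nb U" unfolding U_def by (rule cont_superlevel_nb) (use assms Cc_cont in auto)
  then obtain F where F: "finite F" "F \<subseteq> K" "\<And>x. x \<in> K \<Longrightarrow> \<exists>a\<in>F. inv a \<otimes> x \<in> U"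
    using compact_cover_translates[OF K] by metis
  have "b \<one> / 2 \<le> (\<Sum>a\<in>F. b (inv a \<otimes> x))" if x: "x \<in> K" for x
  proof -
    obtain a where a: "a \<in> F" "inv a \<otimes> x \<in> U" using F(3)[OF x] by auto
    have "b (inv a \<otimes> x) \<le> (\<Sum>a\<in>F. b (inv a \<otimes> x))"
      using F a x compact_carrier[OF K]
      by (intro member_le_sum) (auto intro!: b(2) m_closed inv_closed)
    then show ?thesis using a unfolding U_def by auto
  qed
  then show thesis using that F b(3) by (metis half_gt_zero)
qed

lemma cutoff_exists:
  assumes K: "compactin T K"
  obtains f where "f \<in> Cc" "\<And>x. x \<in> carrier G \<Longrightarrow> 0 \<le> f x" "\<And>x. x \<in> K \<Longrightarrow> 1 \<le> f x"
proof -
  obtain b where b: "b \<in> Cc" "\<And>x. 0 \<le> b x" "b \<one> = 1"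
    using bump_exists[OF nb_topspace] by metis
  obtain F d where F: "finite F" "F \<subseteq> K" "0 < d" "\<And>x. x \<in> K \<Longrightarrow> d \<le> (\<Sum>a\<in>F. b (inv a \<otimes> x))"
    using Cc_cover[OF b(1) _ _ K] b by (metis zero_less_one)
  show thesis
  proof (rule that[of "\<lambda>x. (1 / d) * (\<Sum>a\<in>F. b (inv a \<otimes> x))"])
    show "(\<lambda>x. (1 / d) * (\<Sum>a\<in>F. b (inv a \<otimes> x))) \<in> Cc"
      by (intro Cc_scale Cc_sum Cc_ltrans inv_closed b F) (use F compact_carrier[OF K] in auto)
  qed (use F b in \<open>auto simp: divide_simps intro!: sum_nonneg\<close>)
qed

end

section \<open>The Haar functional\<close>

text \<open>The left Haar integral, kept as a functional on \<open>Cc\<close> instead of a measure.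
  \<open>I_pos\<close> asks for positivity at the identity only; together with left invariance this
  is the full support of Haar measure.\<close>

locale haar_group = lc_group +
  fixes I :: "('a \<Rightarrow> real) \<Rightarrow> real"
  assumes I_add: "\<And>f g. f \<in> Cc \<Longrightarrow> g \<in> Cc \<Longrightarrow> I (\<lambda>x. f x + g x) = I f + I g"
    and I_scale: "\<And>c f. f \<in> Cc \<Longrightarrow> I (\<lambda>x. c * f x) = c * I f"
    and I_mono: "\<And>f g. f \<in> Cc \<Longrightarrow> g \<in> Cc \<Longrightarrow> (\<And>x. x \<in> carrier G \<Longrightarrow> f x \<le> g x) \<Longrightarrow> I f \<le> I g"
    and I_ltrans: "\<And>f a. f \<in> Cc \<Longrightarrow> a \<in> carrier G \<Longrightarrow> I (\<lambda>x. f (a \<otimes> x)) = I f"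
    and I_pos: "\<And>f. f \<in> Cc \<Longrightarrow> (\<And>x. x \<in> carrier G \<Longrightarrow> 0 \<le> f x) \<Longrightarrow> 0 < f \<one> \<Longrightarrow> 0 < I f"
begin

lemma I_zero: "I (\<lambda>x. 0) = 0"
  using I_scale[OF Cc_zero, of 0] by simp

lemma I_cong: "f \<in> Cc \<Longrightarrow> (\<And>x. x \<in> carrier G \<Longrightarrow> f x = g x) \<Longrightarrow> I f = I g"
  by (rule antisym; rule I_mono) (auto intro: Cc_cong)

lemma I_diff:
  assumes "f \<in> Cc" "g \<in> Cc"
  shows "I (\<lambda>x. f x - g x) = I f - I g"
  using I_add[OF assms(1) Cc_scale[OF assms(2), of "-1"]] I_scale[OF assms(2), of "-1"] by simp

lemma I_nonneg: "f \<in> Cc \<Longrightarrow> (\<And>x. x \<in> carrier G \<Longrightarrow> 0 \<le> f x) \<Longrightarrow> 0 \<le> I f"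
  using I_mono[OF Cc_zero] I_zero by fastforce

lemma I_sum:
  "finite A \<Longrightarrow> (\<And>a. a \<in> A \<Longrightarrow> f a \<in> Cc) \<Longrightarrow> I (\<lambda>x. \<Sum>a\<in>A. f a x) = (\<Sum>a\<in>A. I (f a))"
  by (induction A rule: finite_induct) (auto simp: I_zero I_add Cc_sum)

lemma I_abs_le:
  assumes "f \<in> Cc" "g \<in> Cc" "\<And>x. x \<in> carrier G \<Longrightarrow> \<bar>f x\<bar> \<le> g x"
  shows "\<bar>I f\<bar> \<le> I g"
proof -
  have "I f \<le> I g" using assms by (intro I_mono) fastforce+
  moreover have "I (\<lambda>x. (-1) * f x) \<le> I g" using assms by (intro I_mono Cc_scale) fastforce+
  ultimately show ?thesis using I_scale[OF assms(1), of "-1"] by simp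
qed

end

section \<open>Existence of the Haar functional by covering numbers\<close>

context lc_group begin

definition test :: "('a \<Rightarrow> real) \<Rightarrow> bool" where
  "test \<phi> \<longleftrightarrow> \<phi> \<in> Cc \<and> (\<forall>x\<in>carrier G. 0 \<le> \<phi> x) \<and> 0 < \<phi> \<one>"

text \<open>Lists of coefficients and base points turn sums into concatenation, and rescaling and
  translation into \<open>map\<close>; repeated base points do no harm.\<close>

definition combo :: "(real \<times> 'a) list \<Rightarrow> ('a \<Rightarrow> real) \<Rightarrow> 'a \<Rightarrow> real" where
  "combo cs \<phi> x = (\<Sum>(c, a)\<leftarrow>cs. c * \<phi> (inv a \<otimes> x))"

definition weight :: "(real \<times> 'a) list \<Rightarrow> real" where
  "weight cs = (\<Sum>(c, a)\<leftarrow>cs. c)"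

definition admissible :: "(real \<times> 'a) list \<Rightarrow> bool" where
  "admissible cs \<longleftrightarrow> (\<forall>(c, a)\<in>set cs. 0 \<le> c \<and> a \<in> carrier G)"

definition dominates :: "(real \<times> 'a) list \<Rightarrow> ('a \<Rightarrow> real) \<Rightarrow> ('a \<Rightarrow> real) \<Rightarrow> bool" where
  "dominates cs \<phi> f \<longleftrightarrow> admissible cs \<and> (\<forall>x\<in>carrier G. f x \<le> combo cs \<phi> x)"

text \<open>Haar's covering number, usually written \<open>(f : \<phi>)\<close>.\<close>

definition covering :: "('a \<Rightarrow> real) \<Rightarrow> ('a \<Rightarrow> real) \<Rightarrow> real" where
  "covering f \<phi> = Inf (weight ` {cs. dominates cs \<phi> f})"

lemma admissible_simps [simp]:
  "admissible []"
  "admissible ((c, a) # cs) \<longleftrightarrow> 0 \<le> c \<and> a \<in> carrier G \<and> admissible cs"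
  "admissible (cs @ ds) \<longleftrightarrow> admissible cs \<and> admissible ds"
  unfolding admissible_def by auto

lemma combo_simps [simp]:
  "combo [] \<phi> x = 0"
  "combo ((c, a) # cs) \<phi> x = c * \<phi> (inv a \<otimes> x) + combo cs \<phi> x"
  "combo (cs @ ds) \<phi> x = combo cs \<phi> x + combo ds \<phi> x"
  unfolding combo_def by auto

lemma weight_simps [simp]:
  "weight [] = 0" "weight ((c, a) # cs) = c + weight cs"
  "weight (cs @ ds) = weight cs + weight ds"
  unfolding weight_def by auto

lemma weight_nonneg: "admissible cs \<Longrightarrow> 0 \<le> weight cs"
  by (induction cs) auto

lemma combo_scale:
  "combo (map (\<lambda>(c, a). (k * c, a)) cs) \<phi> x = k * combo cs \<phi> x"
  "weight (map (\<lambda>(c, a). (k * c, a)) cs) = k * weight cs"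
  by (induction cs) (auto simp: algebra_simps)

lemma admissible_scale: "0 \<le> k \<Longrightarrow> admissible cs \<Longrightarrow> admissible (map (\<lambda>(c, a). (k * c, a)) cs)"
  by (induction cs) auto

lemma combo_translate:
  assumes "g \<in> carrier G" "x \<in> carrier G"
  shows "admissible cs \<Longrightarrow> combo (map (\<lambda>(c, a). (c, inv g \<otimes> a)) cs) \<phi> x = combo cs \<phi> (g \<otimes> x)"
  by (induction cs) (use assms in \<open>auto simp: inv_mult_group m_assoc\<close>)

lemma weight_translate:
  assumes "g \<in> carrier G"
  shows "weight (map (\<lambda>(c, a). (c, inv g \<otimes> a)) cs) = weight cs"
    "admissible cs \<Longrightarrow> admissible (map (\<lambda>(c, a). (c, inv g \<otimes> a)) cs)"
  by (induction cs) (use assms in auto)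

lemma combo_nonneg:
  assumes "test \<phi>" "x \<in> carrier G"
  shows "admissible cs \<Longrightarrow> 0 \<le> combo cs \<phi> x"
  by (induction cs) (use assms in \<open>auto simp: test_def\<close>)

lemma combo_le:
  assumes "x \<in> carrier G" "\<And>x. x \<in> carrier G \<Longrightarrow> \<phi> x \<le> M"
  shows "admissible cs \<Longrightarrow> combo cs \<phi> x \<le> weight cs * M"
proof (induction cs)
  case (Cons p cs)
  obtain c a where p: "p = (c, a)" by (cases p)
  have "c * \<phi> (inv a \<otimes> x) \<le> c * M"
    using Cons.prems assms p by (intro mult_left_mono) auto
  then show ?case using Cons p by (auto simp: algebra_simps)
qed auto

lemma combo_Cc:
  assumes "\<phi> \<in> Cc"
  shows "admissible cs \<Longrightarrow> combo cs \<phi> \<in> Cc"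
proof (induction cs)
  case Nil
  then show ?case by (rule_tac Cc_cong[OF Cc_zero]) auto
next
  case (Cons p cs)
  obtain c a where p: "p = (c, a)" by (cases p)
  have "(\<lambda>x. c * \<phi> (inv a \<otimes> x) + combo cs \<phi> x) \<in> Cc"
    using Cons p assms by (intro Cc_add Cc_scale Cc_ltrans) auto
  then show ?case by (rule Cc_cong) (simp add: p)
qed

lemma dominates_exists:
  assumes "test \<phi>" "f \<in> Cc"
  obtains cs where "dominates cs \<phi> f"
proof -
  obtain K where K: "compactin T K" "\<And>x. x \<in> carrier G \<Longrightarrow> x \<notin> K \<Longrightarrow> f x = 0" using Cc_support[OF assms(2)] by blast
  obtain M where M: "0 < M" "\<And>x. x \<in> carrier G \<Longrightarrow> \<bar>f x\<bar> \<le> M" using Cc_bounded[OF assms(2)] by blast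
  obtain F d where F: "finite F" "F \<subseteq> K" "0 < d" "\<And>x. x \<in> K \<Longrightarrow> d \<le> (\<Sum>a\<in>F. \<phi> (inv a \<otimes> x))"
    using Cc_cover[OF _ _ _ K(1), of \<phi>] assms(1) unfolding test_def by blast
  obtain xs where xs: "set xs = F" "distinct xs" using finite_distinct_list[OF F(1)] by auto
  \<comment> \<open>On \<open>K\<close> the translates add up to at least \<open>d\<close>, so the
    factor \<open>M / d\<close> lifts them above the bound \<open>M\<close> of
    \<open>f\<close>.\<close>
  define cs where "cs = map (\<lambda>a. (M / d, a)) xs"
  have adm: "admissible cs" unfolding admissible_def cs_def
    using xs F M compact_carrier[OF K(1)] by auto
  have combo: "combo cs \<phi> x = (M / d) * (\<Sum>a\<in>F. \<phi> (inv a \<otimes> x))" for x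
    using xs unfolding combo_def cs_def
    by (simp add: o_def sum_list_distinct_conv_sum_set sum_distrib_left)
  have "f x \<le> combo cs \<phi> x" if x: "x \<in> carrier G" for x
  proof (cases "x \<in> K")
    case True
    have "(M / d) * d \<le> combo cs \<phi> x" unfolding combo using F(4)[OF True] M F(3)
      by (intro mult_left_mono) auto
    then show ?thesis using M(2)[OF x] F(3) by simp
  next
    case False
    then show ?thesis using K(2)[OF x False] combo_nonneg[OF assms(1) x adm] by simp
  qed
  then have "dominates cs \<phi> f" using adm unfolding dominates_def by auto
  then show thesis using that by blast
qed

lemma covering_le: "dominates cs \<phi> f \<Longrightarrow> covering f \<phi> \<le> weight cs"
  unfolding covering_def
  by (rule cInf_lower) (auto intro!: bdd_belowI[of _ 0] weight_nonneg simp: dominates_def)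

lemma covering_greatest:
  assumes "test \<phi>" "f \<in> Cc" "\<And>cs. dominates cs \<phi> f \<Longrightarrow> c \<le> weight cs"
  shows "c \<le> covering f \<phi>"
  unfolding covering_def using assms dominates_exists[OF assms(1,2)]
  by (intro cInf_greatest) auto

lemma covering_approx:
  assumes "test \<phi>" "f \<in> Cc" "0 < e"
  obtains cs where "dominates cs \<phi> f" "weight cs < covering f \<phi> + e"
  using covering_greatest[OF assms(1,2), of "covering f \<phi> + e"] assms(3) by fastforce

lemma covering_nonneg: "test \<phi> \<Longrightarrow> f \<in> Cc \<Longrightarrow> 0 \<le> covering f \<phi>"
  by (rule covering_greatest) (auto intro: weight_nonneg simp: dominates_def)

lemma covering_mono:
  assumes "test \<phi>" "g \<in> Cc" "\<And>x. x \<in> carrier G \<Longrightarrow> f x \<le> g x"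
  shows "covering f \<phi> \<le> covering g \<phi>"
  by (rule covering_greatest[OF assms(1,2)], rule covering_le)
    (use assms(3) in \<open>fastforce simp: dominates_def\<close>)

lemma covering_add:
  assumes "test \<phi>" "f \<in> Cc" "g \<in> Cc"
  shows "covering (\<lambda>x. f x + g x) \<phi> \<le> covering f \<phi> + covering g \<phi>"
proof (rule field_le_epsilon)
  fix e :: real assume "0 < e"
  then have e: "0 < e / 2" by simp
  obtain cs where cs: "dominates cs \<phi> f" "weight cs < covering f \<phi> + e / 2"
    using covering_approx[OF assms(1,2) e] by blast
  obtain ds where ds: "dominates ds \<phi> g" "weight ds < covering g \<phi> + e / 2"
    using covering_approx[OF assms(1,3) e] by blast
  have "dominates (cs @ ds) \<phi> (\<lambda>x. f x + g x)"
    using cs ds unfolding dominates_def by (auto intro: add_mono)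
  from covering_le[OF this] show "covering (\<lambda>x. f x + g x) \<phi> \<le> covering f \<phi> + covering g \<phi> + e"
    using cs ds by simp
qed

lemma covering_scale_le:
  assumes "test \<phi>" "f \<in> Cc" "0 < c"
  shows "covering (\<lambda>x. c * f x) \<phi> \<le> c * covering f \<phi>"
proof -
  have "covering (\<lambda>x. c * f x) \<phi> / c \<le> covering f \<phi>"
  proof (rule covering_greatest[OF assms(1,2)])
    fix cs assume cs: "dominates cs \<phi> f"
    have "dominates (map (\<lambda>(b, a). (c * b, a)) cs) \<phi> (\<lambda>x. c * f x)"
      using cs assms(3) unfolding dominates_def by (auto simp: combo_scale admissible_scale)
    from covering_le[OF this] have "covering (\<lambda>x. c * f x) \<phi> \<le> c * weight cs"
      unfolding combo_scale .
    then show "covering (\<lambda>x. c * f x) \<phi> / c \<le> weight cs"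
      using assms(3) by (simp add: field_simps)
  qed
  then show ?thesis using assms(3) by (simp add: field_simps)
qed

lemma covering_zero: "test \<phi> \<Longrightarrow> covering (\<lambda>x. 0) \<phi> = 0"
  using covering_le[of "[]" \<phi> "\<lambda>x. 0"] covering_nonneg[OF _ Cc_zero] by (fastforce simp: dominates_def)

lemma covering_scale:
  assumes "test \<phi>" "f \<in> Cc" "0 \<le> c"
  shows "covering (\<lambda>x. c * f x) \<phi> = c * covering f \<phi>"
proof (cases "c = 0")
  case True
  then show ?thesis using covering_zero assms by simp
next
  case False
  then have c: "0 < c" using assms by simp
  have "covering (\<lambda>x. (1 / c) * (c * f x)) \<phi> \<le> (1 / c) * covering (\<lambda>x. c * f x) \<phi>"
    using c by (intro covering_scale_le assms Cc_scale) auto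
  then have "c * covering f \<phi> \<le> covering (\<lambda>x. c * f x) \<phi>"
    using c by (simp add: field_simps)
  then show ?thesis using covering_scale_le[OF assms(1,2) c] by simp
qed

lemma covering_ltrans_le:
  assumes "test \<phi>" "f \<in> Cc" "g \<in> carrier G"
  shows "covering (\<lambda>x. f (g \<otimes> x)) \<phi> \<le> covering f \<phi>"
proof (rule covering_greatest[OF assms(1,2)])
  fix cs assume cs: "dominates cs \<phi> f"
  have "dominates (map (\<lambda>(c, a). (c, inv g \<otimes> a)) cs) \<phi> (\<lambda>x. f (g \<otimes> x))"
    using cs assms(3) unfolding dominates_def by (auto simp: combo_translate weight_translate)
  from covering_le[OF this] show "covering (\<lambda>x. f (g \<otimes> x)) \<phi> \<le> weight cs"
    using assms(3) by (simp add: weight_translate)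
qed

lemma covering_ltrans:
  assumes "test \<phi>" "f \<in> Cc" "g \<in> carrier G"
  shows "covering (\<lambda>x. f (g \<otimes> x)) \<phi> = covering f \<phi>"
proof (rule antisym[OF covering_ltrans_le[OF assms]])
  have "covering f \<phi> \<le> covering (\<lambda>x. f (g \<otimes> (inv g \<otimes> x))) \<phi>"
    using assms by (intro covering_mono Cc_ltrans[where f="\<lambda>x. f (g \<otimes> x)"] Cc_ltrans) auto
  also have "\<dots> \<le> covering (\<lambda>x. f (g \<otimes> x)) \<phi>"
    using assms by (intro covering_ltrans_le[where f="\<lambda>x. f (g \<otimes> x)"] Cc_ltrans) auto
  finally show "covering f \<phi> \<le> covering (\<lambda>x. f (g \<otimes> x)) \<phi>" .
qed

lemma covering_combo:
  assumes "test \<phi>" "test f"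
  shows "admissible cs \<Longrightarrow> covering (combo cs f) \<phi> \<le> weight cs * covering f \<phi>"
proof (induction cs)
  case Nil
  have "combo [] f = (\<lambda>x. 0)" by auto
  then show ?case using covering_zero assms by simp
next
  case (Cons p cs)
  obtain c a where p: "p = (c, a)" by (cases p)
  have f: "f \<in> Cc" using assms(2) test_def by auto
  have adm: "0 \<le> c" "a \<in> carrier G" "admissible cs" using Cons.prems p by auto
  have "combo (p # cs) f = (\<lambda>x. c * f (inv a \<otimes> x) + combo cs f x)" using p by auto
  then have "covering (combo (p # cs) f) \<phi> \<le> covering (\<lambda>x. c * f (inv a \<otimes> x)) \<phi> + covering (combo cs f) \<phi>"
    using covering_add[OF assms(1) Cc_scale[OF Cc_ltrans[OF inv_closed[OF adm(2)] f]] combo_Cc[OF f adm(3)]]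
    by simp
  also have "covering (\<lambda>x. c * f (inv a \<otimes> x)) \<phi> = c * covering f \<phi>"
    using adm f assms(1) by (simp add: covering_scale Cc_ltrans covering_ltrans)
  finally show ?case using Cons.IH[OF adm(3)] p by (simp add: algebra_simps)
qed

text \<open>Evaluation at the identity: a combination of weight \<open>t\<close> is at most
  \<open>t * M\<close> there, so a dominating one has weight at least
  \<open>f \<one> / M\<close>.\<close>

lemma covering_pos:
  assumes "test \<phi>" "test f"
  shows "0 < covering f \<phi>"
proof -
  have f: "f \<in> Cc" "0 < f \<one>" using assms(2) test_def by auto
  obtain M where M: "0 < M" "\<And>x. x \<in> carrier G \<Longrightarrow> \<bar>\<phi> x\<bar> \<le> M"
    using Cc_bounded assms(1) unfolding test_def by metis
  have "f \<one> / M \<le> covering f \<phi>"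
  proof (rule covering_greatest[OF assms(1) f(1)])
    fix cs assume "dominates cs \<phi> f"
    then have "f \<one> \<le> combo cs \<phi> \<one>" "admissible cs" unfolding dominates_def by auto
    moreover from this have "combo cs \<phi> \<one> \<le> weight cs * M"
      by (intro combo_le) (use M in fastforce)+
    ultimately show "f \<one> / M \<le> weight cs" using M by (simp add: field_simps)
  qed
  moreover have "0 < f \<one> / M" using f M by simp
  ultimately show ?thesis by linarith
qed

text \<open>Covers compose: each translate of \<open>g\<close> in a cover of \<open>f\<close> is
  covered in turn by translates of \<open>\<phi>\<close>. Applied with the reference function
  \<open>f0\<close> in either role, this bounds
  \<open>covering f \<phi> / covering f0 \<phi>\<close> above and below independently of
  \<open>\<phi>\<close>.\<close>

lemma covering_submult:
  assumes "test \<phi>" "test g" "f \<in> Cc"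
  shows "covering f \<phi> \<le> covering f g * covering g \<phi>"
proof -
  have pos: "0 < covering g \<phi>" by (rule covering_pos[OF assms(1,2)])
  have "covering f \<phi> / covering g \<phi> \<le> covering f g"
  proof (rule covering_greatest[OF assms(2,3)])
    fix cs assume cs: "dominates cs g f"
    have "covering f \<phi> \<le> covering (combo cs g) \<phi>"
      using cs assms unfolding dominates_def test_def
      by (intro covering_mono combo_Cc) (auto simp: test_def)
    also have "\<dots> \<le> weight cs * covering g \<phi>"
      using cs unfolding dominates_def by (intro covering_combo assms) auto
    finally show "covering f \<phi> / covering g \<phi> \<le> weight cs" using pos by (simp add: field_simps)
  qed
  then show ?thesis using pos by (simp add: field_simps)
qed

text \<open>The translate of \<open>\<phi>\<close> with base point \<open>a\<close> vanishes unless
  \<open>inv a \<otimes> x \<in> V\<close>, and there \<open>h x\<close> is at most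
  \<open>h a + e\<close>; so multiplying by \<open>h\<close> can be done on the
  coefficients.\<close>

lemma dominates_mult:
  assumes phi: "test \<phi>" "\<And>x. x \<in> carrier G \<Longrightarrow> x \<notin> V \<Longrightarrow> \<phi> x = 0"
    and h: "\<And>x v. x \<in> carrier G \<Longrightarrow> v \<in> V \<Longrightarrow> \<bar>h (x \<otimes> v) - h x\<bar> < e" "\<And>x. x \<in> carrier G \<Longrightarrow> 0 \<le> h x"
    and e: "0 < e" and cs: "dominates cs \<phi> f"
  shows "dominates (map (\<lambda>(c, a). (c * (h a + e), a)) cs) \<phi> (\<lambda>x. f x * h x)"
proof -
  have adm: "admissible cs \<Longrightarrow> admissible (map (\<lambda>(c, a). (c * (h a + e), a)) cs)" for cs
    by (induction cs) (use e h(2) in \<open>auto intro!: mult_nonneg_nonneg add_nonneg_nonneg\<close>)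
  have *: "combo cs \<phi> x * h x \<le> combo (map (\<lambda>(c, a). (c * (h a + e), a)) cs) \<phi> x"
    if x: "x \<in> carrier G" and "admissible cs" for x cs
    using that(2)
  proof (induction cs)
    case (Cons p cs)
    obtain c a where p: "p = (c, a)" by (cases p)
    have adm: "0 \<le> c" "a \<in> carrier G" "admissible cs" using Cons.prems p by auto
    have "\<phi> (inv a \<otimes> x) * h x \<le> \<phi> (inv a \<otimes> x) * (h a + e)"
    proof (cases "inv a \<otimes> x \<in> V")
      case True
      have "a \<otimes> (inv a \<otimes> x) = x" using adm x by simp
      then have "h x \<le> h a + e" using h(1)[OF adm(2) True] by auto
      then show ?thesis using phi(1) adm x unfolding test_def by (intro mult_left_mono) auto
    next
      case False
      then show ?thesis using phi(2)[of "inv a \<otimes> x"] adm x by simp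
    qed
    then have "c * (\<phi> (inv a \<otimes> x) * h x) \<le> c * (\<phi> (inv a \<otimes> x) * (h a + e))"
      using adm(1) mult_left_mono by blast
    then show ?case using Cons.IH[OF adm(3)] p by (simp add: algebra_simps)
  qed auto
  have "f x * h x \<le> combo (map (\<lambda>(c, a). (c * (h a + e), a)) cs) \<phi> x" if x: "x \<in> carrier G" for x
  proof -
    have "f x * h x \<le> combo cs \<phi> x * h x"
      using cs h(2) x unfolding dominates_def by (intro mult_right_mono) auto
    also have "\<dots> \<le> combo (map (\<lambda>(c, a). (c * (h a + e), a)) cs) \<phi> x"
      using * x cs dominates_def by blast
    finally show ?thesis .
  qed
  then show ?thesis using adm cs unfolding dominates_def by auto
qed

text \<open>The converse of \<open>covering_add\<close>, up to an error. A cover of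
  \<open>f1 + f2\<close> is divided between the summands in the ratio of \<open>f1\<close> to
  \<open>f2\<close>; on the support of one small translate of \<open>\<phi>\<close> this ratio is
  nearly constant, so dividing the coefficients suffices.\<close>

lemma covering_superadd:
  assumes f: "f1 \<in> Cc" "\<And>x. x \<in> carrier G \<Longrightarrow> 0 \<le> f1 x" "f2 \<in> Cc" "\<And>x. x \<in> carrier G \<Longrightarrow> 0 \<le> f2 x"
    and f0: "test f0" and e: "0 < e"
  obtains V where "nb V"
    "\<And>\<phi>. test \<phi> \<Longrightarrow> (\<And>x. x \<in> carrier G \<Longrightarrow> x \<notin> V \<Longrightarrow> \<phi> x = 0) \<Longrightarrow>
      covering f1 \<phi> + covering f2 \<phi> \<le> covering (\<lambda>x. f1 x + f2 x) \<phi> + e * covering f0 \<phi>"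
proof -
  obtain K1 where K1: "compactin T K1" "\<And>x. x \<in> carrier G \<Longrightarrow> x \<notin> K1 \<Longrightarrow> f1 x = 0" using Cc_support[OF f(1)] by blast
  obtain K2 where K2: "compactin T K2" "\<And>x. x \<in> carrier G \<Longrightarrow> x \<notin> K2 \<Longrightarrow> f2 x = 0" using Cc_support[OF f(3)] by blast
  define K where "K = K1 \<union> K2"
  have K: "compactin T K" unfolding K_def using K1 K2 compactin_Un by blast
  obtain \<xi> where chi: "\<xi> \<in> Cc" "\<And>x. x \<in> carrier G \<Longrightarrow> 0 \<le> \<xi> x" "\<And>x. x \<in> K \<Longrightarrow> 1 \<le> \<xi> x"
    using cutoff_exists[OF K] by blast
  define s where "s = (\<lambda>x. f1 x + f2 x)"
  have s: "s \<in> Cc" unfolding s_def using f Cc_add by auto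
  define A where "A = covering s f0"
  define B where "B = covering \<xi> f0"
  have AB: "0 \<le> A" "0 \<le> B" unfolding A_def B_def using covering_nonneg f0 s chi by auto
  \<comment> \<open>Both constants are solved for from the end: the error is at most
    \<open>2 * \<epsilon> * A + 2 * \<delta> * B\<close> times \<open>covering f0 \<phi>\<close>,
    and each term is made at most \<open>e / 2\<close>. The cap \<open>1/2\<close> bounds
    \<open>1 + 2 * \<epsilon>\<close> by 2.\<close>
  define \<epsilon> where "\<epsilon> = min (1/2) (e / (4 * (A + 1)))"
  define \<delta> where "\<delta> = e / (4 * (B + 1))"
  have eps: "0 < \<epsilon>" "0 < \<delta>" unfolding \<epsilon>_def \<delta>_def using e AB by auto
  have eps': "\<epsilon> \<le> 1/2" unfolding \<epsilon>_def by (rule min.cobounded1)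
  have epsA: "2 * \<epsilon> * A \<le> e / 2"
  proof -
    have "2 * \<epsilon> * A \<le> 2 * (e / (4 * (A + 1))) * (A + 1)"
      using AB e eps unfolding \<epsilon>_def by (intro mult_mono) auto
    also have "\<dots> = e / 2" using AB by (simp add: field_simps)
    finally show ?thesis .
  qed
  have delB: "2 * \<delta> * B \<le> e / 2"
  proof -
    have "2 * \<delta> * B \<le> 2 * (e / (4 * (B + 1))) * (B + 1)"
      using AB e eps unfolding \<delta>_def by (intro mult_mono) auto
    also have "\<dots> = e / 2" using AB by (simp add: field_simps)
    finally show ?thesis .
  qed
  \<comment> \<open>Quotients by \<open>s\<close> itself could fail to be continuous at the edge of
    its support. With \<open>\<delta> * \<xi>\<close> added the denominator is at least
    \<open>\<delta>\<close> on \<open>K\<close>, and truncating it below at \<open>\<delta>\<close>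
    in \<open>M\<close> leaves it unchanged there; off \<open>K\<close> both numerators
    vanish.\<close>
  define F where "F = (\<lambda>x. s x + \<delta> * \<xi> x)"
  have F: "F \<in> Cc" unfolding F_def using s chi Cc_add Cc_scale by auto
  define M where "M = (\<lambda>x. max (F x) \<delta>)"
  have M: "cont M" "\<And>x. 0 < M x"
    unfolding M_def using continuous_map_real_max[OF Cc_cont[OF F]] eps by (auto simp: less_max_iff_disj)
  define h where "h = (\<lambda>f x. f x * inverse (M x) :: real)"
  have cM: "cont (\<lambda>x. inverse (M x))"
    by (rule continuous_map_real_inverse[OF M(1)]) (use M(2) in \<open>metis less_irrefl\<close>)
  have hC: "h f1 \<in> Cc" "h f2 \<in> Cc" unfolding h_def using f cM Cc_mult' by auto
  have h0: "0 \<le> h f1 x" "0 \<le> h f2 x" if "x \<in> carrier G" for x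
    unfolding h_def using f(2,4)[OF that] M(2)[of x] by auto
  have sK: "s x = 0" "f1 x = 0" "f2 x = 0" if "x \<in> carrier G" "x \<notin> K" for x
    using that K1 K2 unfolding s_def K_def by auto
  have MK: "M x = F x" if "x \<in> K" for x
  proof -
    have x: "x \<in> carrier G" using that compact_carrier[OF K] by auto
    have "\<delta> \<le> \<delta> * \<xi> x" using chi(3)[OF that] eps by simp
    then show ?thesis using f(2,4)[OF x] unfolding M_def F_def s_def by simp
  qed
  have hsum: "h f1 x + h f2 x \<le> 1" if x: "x \<in> carrier G" for x
  proof (cases "x \<in> K")
    case True
    have "s x \<le> M x" unfolding MK[OF True] F_def using chi(2)[OF x] eps by simp
    then show ?thesis unfolding h_def s_def using M(2)[of x] by (simp add: field_simps)
  next
    case False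
    then show ?thesis using sK[OF x False] unfolding h_def by simp
  qed
  have hF: "F x * h f1 x = f1 x" "F x * h f2 x = f2 x" if x: "x \<in> carrier G" for x
  proof -
    have "F x * h f1 x = f1 x \<and> F x * h f2 x = f2 x"
    proof (cases "x \<in> K")
      case True
      then show ?thesis using MK[OF True] M(2)[of x] unfolding h_def by (simp add: field_simps)
    next
      case False
      then show ?thesis using sK[OF x False] unfolding h_def by simp
    qed
    then show "F x * h f1 x = f1 x" "F x * h f2 x = f2 x" by auto
  qed
  obtain V1 where V1: "nb V1" "\<And>x v. x \<in> carrier G \<Longrightarrow> v \<in> V1 \<Longrightarrow> \<bar>h f1 (x \<otimes> v) - h f1 x\<bar> < \<epsilon>"
    using right_ucD[OF Cc_right_uc[OF hC(1)] eps(1)] by blast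
  obtain V2 where V2: "nb V2" "\<And>x v. x \<in> carrier G \<Longrightarrow> v \<in> V2 \<Longrightarrow> \<bar>h f2 (x \<otimes> v) - h f2 x\<bar> < \<epsilon>"
    using right_ucD[OF Cc_right_uc[OF hC(2)] eps(1)] by blast
  show thesis
  proof (rule that)
    show "nb (V1 \<inter> V2)" using V1 V2 nb_Int by auto
    fix \<phi> assume phi: "test \<phi>" "\<And>x. x \<in> carrier G \<Longrightarrow> x \<notin> V1 \<inter> V2 \<Longrightarrow> \<phi> x = 0"
    \<comment> \<open>A coefficient \<open>c\<close> is divided into two whose sum is at most
      \<open>c * (1 + 2 * \<epsilon>)\<close>, because the two ratios add up to at most 1.\<close>
    have "covering f1 \<phi> + covering f2 \<phi> \<le> (1 + 2 * \<epsilon>) * weight cs" if cs: "dominates cs \<phi> F" for cs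
    proof -
      have d: "dominates (map (\<lambda>(c, a). (c * (h f1 a + \<epsilon>), a)) cs) \<phi> (\<lambda>x. F x * h f1 x)"
        "dominates (map (\<lambda>(c, a). (c * (h f2 a + \<epsilon>), a)) cs) \<phi> (\<lambda>x. F x * h f2 x)"
        by (rule dominates_mult[where V="V1 \<inter> V2"]; use phi V1 V2 h0 eps cs in auto)+
      have "covering f1 \<phi> \<le> weight (map (\<lambda>(c, a). (c * (h f1 a + \<epsilon>), a)) cs)"
        "covering f2 \<phi> \<le> weight (map (\<lambda>(c, a). (c * (h f2 a + \<epsilon>), a)) cs)"
        using d hF by (auto intro!: covering_le simp: dominates_def)
      moreover have "weight (map (\<lambda>(c, a). (c * (h f1 a + \<epsilon>), a)) cs) + weight (map (\<lambda>(c, a). (c * (h f2 a + \<epsilon>), a)) cs)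
          \<le> (1 + 2 * \<epsilon>) * weight cs" if "admissible cs" for cs
        using that
      proof (induction cs)
        case (Cons p cs)
        obtain c a where p: "p = (c, a)" by (cases p)
        have adm: "0 \<le> c" "a \<in> carrier G" "admissible cs" using Cons.prems p by auto
        have "c * (h f1 a + h f2 a) \<le> c * 1" using hsum[OF adm(2)] adm(1) by (rule mult_left_mono)
        then show ?case using Cons.IH[OF adm(3)] p by (simp add: algebra_simps)
      qed auto
      ultimately show ?thesis using cs unfolding dominates_def by force
    qed
    then have "(covering f1 \<phi> + covering f2 \<phi>) / (1 + 2 * \<epsilon>) \<le> covering F \<phi>"
      using eps by (intro covering_greatest phi(1) F) (auto simp: field_simps)
    then have "covering f1 \<phi> + covering f2 \<phi> \<le> (1 + 2 * \<epsilon>) * covering F \<phi>"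
      using eps by (simp add: field_simps)
    also have "\<dots> \<le> (1 + 2 * \<epsilon>) * (covering s \<phi> + \<delta> * covering \<xi> \<phi>)"
      using covering_add[OF phi(1) s Cc_scale[OF chi(1), of \<delta>]] covering_scale[OF phi(1) chi(1), of \<delta>] eps
      unfolding F_def by (intro mult_left_mono) auto
    also have "\<dots> = covering s \<phi> + 2 * \<epsilon> * covering s \<phi> + (1 + 2 * \<epsilon>) * (\<delta> * covering \<xi> \<phi>)"
      by (simp add: algebra_simps)
    also have "\<dots> \<le> covering s \<phi> + 2 * \<epsilon> * (A * covering f0 \<phi>) + 2 * (\<delta> * (B * covering f0 \<phi>))"
      unfolding A_def B_def
      using covering_submult[OF phi(1) f0 s] covering_submult[OF phi(1) f0 chi(1)] eps eps'
        covering_nonneg[OF phi(1) chi(1)]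
      by (intro add_mono mult_mono mult_left_mono) auto
    also have "\<dots> = covering s \<phi> + (2 * \<epsilon> * A + 2 * \<delta> * B) * covering f0 \<phi>"
      by (simp add: algebra_simps)
    also have "\<dots> \<le> covering s \<phi> + e * covering f0 \<phi>"
      using epsA delB covering_pos[OF phi(1) f0] by (intro add_left_mono mult_right_mono) auto
    finally show "covering f1 \<phi> + covering f2 \<phi> \<le> covering (\<lambda>x. f1 x + f2 x) \<phi> + e * covering f0 \<phi>"
      unfolding s_def .
  qed
qed

text \<open>An event of this filter is one that holds for all sufficiently small neighbourhoods of
  the identity. An ultrafilter below it is used for the covering numbers and again for the trapped
  products.\<close>

definition nb_filter :: "'a set filter" where
  "nb_filter = (INF U\<in>Collect nb. principal {V. nb V \<and> V \<subseteq> U})"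

lemma eventually_nb_filter:
  "eventually P nb_filter \<longleftrightarrow> (\<exists>U. nb U \<and> (\<forall>V. nb V \<and> V \<subseteq> U \<longrightarrow> P V))"
proof -
  have "eventually P nb_filter \<longleftrightarrow> (\<exists>U\<in>Collect nb. eventually P (principal {V. nb V \<and> V \<subseteq> U}))"
    unfolding nb_filter_def
  proof (rule eventually_INF_base)
    show "Collect nb \<noteq> {}" using nb_topspace by auto
    fix A B assume "A \<in> Collect nb" "B \<in> Collect nb"
    then show "\<exists>C\<in>Collect nb. principal {V. nb V \<and> V \<subseteq> C} \<le> inf (principal {V. nb V \<and> V \<subseteq> A}) (principal {V. nb V \<and> V \<subseteq> B})"
      by (intro bexI[of _ "A \<inter> B"]) (auto intro: nb_Int)
  qed
  then show ?thesis by (auto simp: eventually_principal)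
qed

lemma nb_filter_not_bot: "nb_filter \<noteq> bot"
  unfolding trivial_limit_def eventually_nb_filter by blast

lemma eventually_nb_filterI: "nb U \<Longrightarrow> (\<And>V. nb V \<Longrightarrow> V \<subseteq> U \<Longrightarrow> P V) \<Longrightarrow> eventually P nb_filter"
  unfolding eventually_nb_filter by blast

text \<open>At each stage the normalised covering numbers are only subadditive, but the defect tends
  to 0 as the supports of the test functions shrink, so the limit is additive. Nonnegative functions
  only, since covering numbers do not see negative values.\<close>

lemma haar_positive_functional:
  obtains P :: "('a \<Rightarrow> real) \<Rightarrow> real" where
    "\<And>f g. f \<in> Cc \<Longrightarrow> g \<in> Cc \<Longrightarrow> (\<And>x. x \<in> carrier G \<Longrightarrow> 0 \<le> f x) \<Longrightarrow> (\<And>x. x \<in> carrier G \<Longrightarrow> 0 \<le> g x) \<Longrightarrow>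
      P (\<lambda>x. f x + g x) = P f + P g"
    "\<And>c f. f \<in> Cc \<Longrightarrow> (\<And>x. x \<in> carrier G \<Longrightarrow> 0 \<le> f x) \<Longrightarrow> 0 \<le> c \<Longrightarrow> P (\<lambda>x. c * f x) = c * P f"
    "\<And>f g. f \<in> Cc \<Longrightarrow> g \<in> Cc \<Longrightarrow> (\<And>x. x \<in> carrier G \<Longrightarrow> 0 \<le> f x) \<Longrightarrow> (\<And>x. x \<in> carrier G \<Longrightarrow> f x \<le> g x) \<Longrightarrow> P f \<le> P g"
    "\<And>f a. f \<in> Cc \<Longrightarrow> (\<And>x. x \<in> carrier G \<Longrightarrow> 0 \<le> f x) \<Longrightarrow> a \<in> carrier G \<Longrightarrow> P (\<lambda>x. f (a \<otimes> x)) = P f"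
    "\<And>f. test f \<Longrightarrow> 0 < P f"
proof -
  have "\<forall>V. \<exists>b. nb V \<longrightarrow> test b \<and> (\<forall>x. x \<notin> V \<longrightarrow> b x = 0)"
    using bump_exists unfolding test_def by (metis zero_less_one)
  then obtain b where b: "\<And>V. nb V \<Longrightarrow> test (b V)" "\<And>V x. nb V \<Longrightarrow> x \<notin> V \<Longrightarrow> b V x = 0" by metis
  obtain f0 where f0: "test f0" using b(1)[OF nb_topspace] by blast
  obtain F where F: "F \<le> nb_filter" "ultrafilter F" using ultrafilter_below[OF nb_filter_not_bot] by blast
  have ntF: "F \<noteq> bot" using F(2) ultrafilter_not_bot by blast
  have ev: "eventually nb F"
    by (rule filter_leD[OF F(1)], rule eventually_nb_filterI[OF nb_topspace])
  \<comment> \<open>Normalising by \<open>f0\<close> keeps the values between 0 and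
    \<open>covering f f0\<close>, so \<open>J f\<close> converges along the ultrafilter for every
    \<open>f \<in> Cc\<close>.\<close>
  define J where "J = (\<lambda>f V. covering f (b V) / covering f0 (b V))"
  define P where "P = (\<lambda>f. Lim F (J f))"
  have pos0: "0 < covering f0 (b V)" if "nb V" for V by (rule covering_pos[OF b(1)[OF that] f0])
  have lim: "(J f \<longlongrightarrow> P f) F" if f: "f \<in> Cc" for f
  proof -
    have "eventually (\<lambda>V. 0 \<le> J f V \<and> J f V \<le> covering f f0) F"
      using ev
    proof eventually_elim
      case (elim V)
      then show ?case unfolding J_def
        using covering_nonneg[OF b(1)[OF elim] f] covering_submult[OF b(1)[OF elim] f0 f] pos0[OF elim] by (simp add: field_simps)
    qed
    then obtain l where "(J f \<longlongrightarrow> l) F" using ultrafilter_real_limit[OF F(2)] by blast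
    then show ?thesis unfolding P_def using tendsto_Lim[OF ntF] by metis
  qed
  show thesis
  proof (rule that[of P])
    fix f g assume f: "f \<in> Cc" "\<And>x. x \<in> carrier G \<Longrightarrow> 0 \<le> f x" and g: "g \<in> Cc" "\<And>x. x \<in> carrier G \<Longrightarrow> 0 \<le> g x"
    have fg: "(\<lambda>x. f x + g x) \<in> Cc" using f g Cc_add by auto
    show "P (\<lambda>x. f x + g x) = P f + P g"
    proof (rule antisym)
      show "P (\<lambda>x. f x + g x) \<le> P f + P g"
      proof (rule tendsto_le[OF ntF tendsto_add[OF lim[OF f(1)] lim[OF g(1)]] lim[OF fg]])
        show "eventually (\<lambda>V. J (\<lambda>x. f x + g x) V \<le> J f V + J g V) F"
          using ev
        proof eventually_elim
          case (elim V)
          then show ?case unfolding J_def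
            using covering_add[OF b(1)[OF elim] f(1) g(1)] pos0[OF elim] by (simp add: field_simps)
        qed
      qed
      show "P f + P g \<le> P (\<lambda>x. f x + g x)"
      proof (rule field_le_epsilon)
        fix e :: real assume e: "0 < e"
        obtain U where U: "nb U" "\<And>\<phi>. test \<phi> \<Longrightarrow> (\<And>x. x \<in> carrier G \<Longrightarrow> x \<notin> U \<Longrightarrow> \<phi> x = 0) \<Longrightarrow>
            covering f \<phi> + covering g \<phi> \<le> covering (\<lambda>x. f x + g x) \<phi> + e * covering f0 \<phi>"
          using covering_superadd[OF f g f0 e] by blast
        show "P f + P g \<le> P (\<lambda>x. f x + g x) + e"
        proof (rule tendsto_le[OF ntF tendsto_add[OF lim[OF fg] tendsto_const] tendsto_add[OF lim[OF f(1)] lim[OF g(1)]]])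
          show "eventually (\<lambda>V. J f V + J g V \<le> J (\<lambda>x. f x + g x) V + e) F"
          proof (rule filter_leD[OF F(1)], rule eventually_nb_filterI[OF U(1)])
            fix V assume V: "nb V" "V \<subseteq> U"
            then have "covering f (b V) + covering g (b V) \<le> covering (\<lambda>x. f x + g x) (b V) + e * covering f0 (b V)"
              by (intro U(2) b) (auto intro!: b(2)[OF V(1)])
            then have "(covering f (b V) + covering g (b V)) / covering f0 (b V)
                \<le> (covering (\<lambda>x. f x + g x) (b V) + e * covering f0 (b V)) / covering f0 (b V)"
              using pos0[OF V(1)] by (intro divide_right_mono) auto
            then show "J f V + J g V \<le> J (\<lambda>x. f x + g x) V + e"
              unfolding J_def using pos0[OF V(1)] by (simp add: add_divide_distrib)
          qed
        qed
      qed
    qed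
  next
    fix c f assume f: "f \<in> Cc" and c: "0 \<le> (c::real)"
    have "((\<lambda>V. c * J f V) \<longlongrightarrow> P (\<lambda>x. c * f x)) F"
    proof (rule Lim_transform_eventually[OF lim[OF Cc_scale[OF f]]])
      show "eventually (\<lambda>V. J (\<lambda>x. c * f x) V = c * J f V) F"
        using ev by eventually_elim (simp add: J_def covering_scale[OF b(1) f c])
    qed
    then show "P (\<lambda>x. c * f x) = c * P f"
      using tendsto_unique[OF ntF _ tendsto_mult_left[OF lim[OF f]]] by blast
  next
    fix f g assume f: "f \<in> Cc" and g: "g \<in> Cc" and le: "\<And>x. x \<in> carrier G \<Longrightarrow> f x \<le> g x"
    show "P f \<le> P g"
    proof (rule tendsto_le[OF ntF lim[OF g] lim[OF f]])
      show "eventually (\<lambda>V. J f V \<le> J g V) F"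
        using ev
      proof eventually_elim
        case (elim V)
        then show ?case unfolding J_def
          using covering_mono[OF b(1)[OF elim] g le] pos0[OF elim] by (intro divide_right_mono) auto
      qed
    qed
  next
    fix f a assume f: "f \<in> Cc" and a: "a \<in> carrier G"
    have "(J f \<longlongrightarrow> P (\<lambda>x. f (a \<otimes> x))) F"
    proof (rule Lim_transform_eventually[OF lim[OF Cc_ltrans[OF a f]]])
      show "eventually (\<lambda>V. J (\<lambda>x. f (a \<otimes> x)) V = J f V) F"
        using ev by eventually_elim (simp add: J_def covering_ltrans[OF b(1) f a])
    qed
    then show "P (\<lambda>x. f (a \<otimes> x)) = P f"
      using tendsto_unique[OF ntF _ lim[OF f]] by blast
  next
    fix f assume f: "test f"
    then have fC: "f \<in> Cc" using test_def by auto
    \<comment> \<open>Submultiplicativity with the roles of \<open>f\<close> and \<open>f0\<close>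
      exchanged gives a positive lower bound that survives the limit.\<close>
    have "1 / covering f0 f \<le> P f"
    proof (rule tendsto_lowerbound[OF lim[OF fC] _ ntF])
      show "eventually (\<lambda>V. 1 / covering f0 f \<le> J f V) F"
        using ev
      proof eventually_elim
        case (elim V)
        have "covering f0 (b V) \<le> covering f0 f * covering f (b V)"
          using covering_submult[OF b(1)[OF elim] f, of f0] f0 test_def by auto
        then show ?case unfolding J_def
          using covering_pos[OF f f0] pos0[OF elim] by (simp add: field_simps)
      qed
    qed
    then show "0 < P f" using covering_pos[OF f f0] by (meson less_le_trans zero_less_divide_1_iff)
  qed
qed

text \<open>Linear extension from nonnegative functions by positive and negative parts.\<close>

lemma haar_group_exists: "\<exists>I. haar_group G T I"
proof (rule haar_positive_functional, goal_cases)
  case (1 P)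
  note P = 1
  define p where "p = (\<lambda>(f :: 'a \<Rightarrow> real) x. max (f x) 0)"
  define m where "m = (\<lambda>(f :: 'a \<Rightarrow> real) x. max (- f x) 0)"
  have neg: "(\<lambda>x. - f x) \<in> Cc" if "f \<in> Cc" for f using Cc_scale[OF that, of "-1"] by simp
  have pC: "p f \<in> Cc" "m f \<in> Cc" if "f \<in> Cc" for f
    unfolding p_def m_def using Cc_max0[OF that] Cc_max0[OF neg[OF that]] by auto
  have p0: "0 \<le> p f x" "0 \<le> m f x" for f x unfolding p_def m_def by auto
  define I where "I = (\<lambda>f. P (p f) - P (m f))"
  have I_add: "I (\<lambda>x. f x + g x) = I f + I g" if f: "f \<in> Cc" and g: "g \<in> Cc" for f g
  proof -
    define s where "s = (\<lambda>x. f x + g x)"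
    have s: "s \<in> Cc" unfolding s_def using f g Cc_add by auto
    \<comment> \<open>The positive part is not additive; additivity is read off from an identity
      with nonnegative terms on both sides.\<close>
    have "(\<lambda>x. p s x + (m f x + m g x)) = (\<lambda>x. m s x + (p f x + p g x))"
      unfolding p_def m_def s_def by auto
    then have "P (\<lambda>x. p s x + (m f x + m g x)) = P (\<lambda>x. m s x + (p f x + p g x))" by simp
    then have "P (p s) + (P (m f) + P (m g)) = P (m s) + (P (p f) + P (p g))"
      using P(1)[OF pC(1)[OF s] Cc_add[OF pC(2)[OF f] pC(2)[OF g]]] P(1)[OF pC(2)[OF s] Cc_add[OF pC(1)[OF f] pC(1)[OF g]]]
        P(1)[OF pC(1)[OF f] pC(1)[OF g]] P(1)[OF pC(2)[OF f] pC(2)[OF g]] p0 by (simp add: add_nonneg_nonneg)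
    then show ?thesis unfolding I_def s_def by simp
  qed
  have I_scale: "I (\<lambda>x. c * f x) = c * I f" if f: "f \<in> Cc" for f c
  proof (cases "0 \<le> c")
    case True
    have "p (\<lambda>x. c * f x) = (\<lambda>x. c * p f x)" "m (\<lambda>x. c * f x) = (\<lambda>x. c * m f x)"
      unfolding p_def m_def using True by (auto simp: max_def mult_le_0_iff zero_le_mult_iff)
    then show ?thesis unfolding I_def using P(2)[OF pC(1)[OF f] p0(1) True] P(2)[OF pC(2)[OF f] p0(2) True]
      by (simp add: algebra_simps)
  next
    case False
    then have c: "0 \<le> - c" by simp
    have "p (\<lambda>x. c * f x) = (\<lambda>x. (- c) * m f x)" "m (\<lambda>x. c * f x) = (\<lambda>x. (- c) * p f x)"
      unfolding p_def m_def using False by (auto simp: max_def mult_le_0_iff zero_le_mult_iff)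
    then show ?thesis unfolding I_def using P(2)[OF pC(1)[OF f] p0(1) c] P(2)[OF pC(2)[OF f] p0(2) c]
      by (simp add: algebra_simps)
  qed
  have P0: "P f = 0" if "f \<in> Cc" "\<And>x. x \<in> carrier G \<Longrightarrow> f x = 0" for f
  proof -
    have "P (\<lambda>x. 0 * f x) = 0" using P(2)[OF that(1), of 0] that(2) by simp
    moreover have "P f \<le> P (\<lambda>x. 0 * f x)" "P (\<lambda>x. 0 * f x) \<le> P f"
      using that Cc_scale[of f 0] by (auto intro!: P(3))
    ultimately show ?thesis by simp
  qed
  have I_nonneg: "I f = P (p f)" if f: "f \<in> Cc" and "\<And>x. x \<in> carrier G \<Longrightarrow> 0 \<le> f x" for f
    using P0[OF pC(2)[OF f]] that(2) unfolding I_def by (simp add: m_def)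
  have I_ge0: "0 \<le> I f" if f: "f \<in> Cc" and f0: "\<And>x. x \<in> carrier G \<Longrightarrow> 0 \<le> f x" for f
  proof -
    have "P (\<lambda>x. 0) \<le> P (p f)" using p0 by (intro P(3) Cc_zero pC f) auto
    then show ?thesis using P0[OF Cc_zero] I_nonneg[OF f f0] by simp
  qed
  have "haar_group G T I"
  proof unfold_locales
    fix f g assume f: "f \<in> Cc" and g: "g \<in> Cc" and le: "\<And>x. x \<in> carrier G \<Longrightarrow> f x \<le> g x"
    have "0 \<le> I (\<lambda>x. g x - f x)" using le f g by (intro I_ge0 Cc_diff) auto
    moreover have "I (\<lambda>x. (g x - f x) + f x) = I (\<lambda>x. g x - f x) + I f"
      by (intro I_add Cc_diff f g)
    ultimately show "I f \<le> I g" by simp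
  next
    fix f a assume f: "f \<in> Cc" and a: "a \<in> carrier G"
    have "p (\<lambda>x. f (a \<otimes> x)) = (\<lambda>x. p f (a \<otimes> x))" "m (\<lambda>x. f (a \<otimes> x)) = (\<lambda>x. m f (a \<otimes> x))"
      unfolding p_def m_def by auto
    then show "I (\<lambda>x. f (a \<otimes> x)) = I f"
      unfolding I_def using P(4)[OF pC(1)[OF f] p0(1) a] P(4)[OF pC(2)[OF f] p0(2) a] by simp
  next
    fix f assume f: "f \<in> Cc" "\<And>x. x \<in> carrier G \<Longrightarrow> 0 \<le> f x" "0 < f \<one>"
    then have "test (p f)" unfolding test_def using pC p0 by (auto simp: p_def)
    then show "0 < I f" using I_nonneg[OF f(1) f(2)] P(5) by simp
  qed (use I_add I_scale in auto)
  then show ?thesis by blast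
qed


section \<open>Gleason's trapping lemma\<close>

text \<open>Suprema of left translates are the only non-algebraic way in which new functions arise below;
  right uniform continuity is insensitive to left translation and therefore survives.\<close>

lemma SUP_translates:
  assumes b: "right_uc b" "\<forall>x\<in>carrier G. 0 \<le> b x \<and> b x \<le> 1"
    and A: "A \<noteq> {}" "\<forall>i\<in>A. p i \<in> carrier G \<and> 0 \<le> c i \<and> c i \<le> (1::real)"
  defines "f \<equiv> \<lambda>x. SUP i\<in>A. c i * b (p i \<otimes> x)"
  shows "right_uc f"
    "\<And>i x. i \<in> A \<Longrightarrow> x \<in> carrier G \<Longrightarrow> c i * b (p i \<otimes> x) \<le> f x"
    "\<And>x M. (\<And>i. i \<in> A \<Longrightarrow> c i * b (p i \<otimes> x) \<le> M) \<Longrightarrow> f x \<le> M"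
    "\<And>x. x \<in> carrier G \<Longrightarrow> 0 \<le> f x"
proof -
  have le1: "c i * b (p i \<otimes> x) \<le> 1" if "i \<in> A" "x \<in> carrier G" for i x
    using bspec[OF b(2), of "p i \<otimes> x"] bspec[OF A(2) that(1)] that by (intro mult_le_one) auto
  have bdd: "bdd_above ((\<lambda>i. c i * b (p i \<otimes> x)) ` A)" if "x \<in> carrier G" for x
    using le1[OF _ that] by (intro bdd_aboveI2[of _ _ 1])
  show up: "\<And>i x. i \<in> A \<Longrightarrow> x \<in> carrier G \<Longrightarrow> c i * b (p i \<otimes> x) \<le> f x"
    unfolding f_def using bdd by (intro cSUP_upper)
  show least: "\<And>x M. (\<And>i. i \<in> A \<Longrightarrow> c i * b (p i \<otimes> x) \<le> M) \<Longrightarrow> f x \<le> M"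
    unfolding f_def using A(1) by (intro cSUP_least)
  show "0 \<le> f x" if x: "x \<in> carrier G" for x
  proof -
    obtain i where i: "i \<in> A" using A(1) by auto
    have "0 \<le> c i * b (p i \<otimes> x)" using bspec[OF A(2) i] b(2) x by simp
    then show ?thesis using up[OF i x] by linarith
  qed
  show "right_uc f"
    unfolding right_uc_def
  proof (intro allI impI)
    fix e :: real assume e: "0 < e"
    obtain V where V: "nb V" "\<And>x v. x \<in> carrier G \<Longrightarrow> v \<in> V \<Longrightarrow> \<bar>b (x \<otimes> v) - b x\<bar> < e/2"
      using right_ucD[OF b(1), of "e/2"] e by (metis half_gt_zero)
    have "\<bar>f (x \<otimes> v) - f x\<bar> < e" if x: "x \<in> carrier G" and v: "v \<in> V" for x v
    proof -
      have vc: "v \<in> carrier G" using V(1) v nb_in_carrier by auto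
      have *: "\<bar>c i * b (p i \<otimes> (x \<otimes> v)) - c i * b (p i \<otimes> x)\<bar> \<le> e/2" if i: "i \<in> A" for i
      proof -
        have "\<bar>c i * b (p i \<otimes> (x \<otimes> v)) - c i * b (p i \<otimes> x)\<bar> = c i * \<bar>b (p i \<otimes> x \<otimes> v) - b (p i \<otimes> x)\<bar>"
          using bspec[OF A(2) i] x vc by (simp add: m_assoc abs_mult flip: right_diff_distrib)
        also have "\<dots> \<le> 1 * (e/2)"
          using bspec[OF A(2) i] V(2)[of "p i \<otimes> x" v] x v e by (intro mult_mono) auto
        finally show ?thesis by simp
      qed
      have "f (x \<otimes> v) \<le> f x + e/2"
      proof (rule least)
        fix i assume i: "i \<in> A"
        show "c i * b (p i \<otimes> (x \<otimes> v)) \<le> f x + e/2" using up[OF i x] *[OF i] by linarith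
      qed
      moreover have "f x \<le> f (x \<otimes> v) + e/2"
      proof (rule least)
        fix i assume i: "i \<in> A"
        show "c i * b (p i \<otimes> x) \<le> f (x \<otimes> v) + e/2" using up[OF i m_closed[OF x vc]] *[OF i] by linarith
      qed
      ultimately show ?thesis using e by (auto simp: abs_less_iff)
    qed
    then show "\<exists>V. nb V \<and> (\<forall>x\<in>carrier G. \<forall>v\<in>V. \<bar>f (x \<otimes> v) - f x\<bar> < e)" using V(1) by blast
  qed
qed

text \<open>New factors enter on the left, so that induction over the length peels off a left
  translation.\<close>

primrec spow :: "'a set \<Rightarrow> nat \<Rightarrow> 'a set" where
  "spow Q 0 = {\<one>}"
| "spow Q (Suc n) = Q <#> spow Q n"

lemma spow_carrier: "Q \<subseteq> carrier G \<Longrightarrow> spow Q n \<subseteq> carrier G"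
  by (induction n) (auto simp: set_mult_def)

lemma spow_mono_Suc: "Q \<subseteq> carrier G \<Longrightarrow> \<one> \<in> Q \<Longrightarrow> spow Q n \<subseteq> spow Q (Suc n)"
proof
  fix x assume *: "Q \<subseteq> carrier G" "\<one> \<in> Q" "x \<in> spow Q n"
  then have "\<one> \<otimes> x \<in> spow Q (Suc n)" by (auto intro: set_multI)
  moreover have "x \<in> carrier G" using spow_carrier[OF *(1)] *(3) by (rule subsetD)
  ultimately show "x \<in> spow Q (Suc n)" by simp
qed

lemma spow_mono: "Q \<subseteq> carrier G \<Longrightarrow> \<one> \<in> Q \<Longrightarrow> m \<le> n \<Longrightarrow> spow Q m \<subseteq> spow Q n"
  by (rule lift_Suc_mono_le[of "spow Q"]) (rule spow_mono_Suc)

lemma spow_one: "Q \<subseteq> carrier G \<Longrightarrow> spow Q 1 = Q"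
proof -
  assume "Q \<subseteq> carrier G"
  then have "(\<Union>h\<in>Q. {h \<otimes> \<one>}) = (\<Union>h\<in>Q. {h})" by (intro SUP_cong) auto
  then show ?thesis by (simp add: set_mult_def)
qed

lemma spow_add: "Q \<subseteq> carrier G \<Longrightarrow> x \<in> spow Q m \<Longrightarrow> y \<in> spow Q n \<Longrightarrow> x \<otimes> y \<in> spow Q (m + n)"
proof (induction m arbitrary: x)
  case 0
  then have "y \<in> carrier G" using spow_carrier[OF 0(1)] by blast
  then show ?case using 0 by simp
next
  case (Suc m)
  then obtain q z where qz: "q \<in> Q" "z \<in> spow Q m" "x = q \<otimes> z" by (auto elim: set_multE)
  have "x \<otimes> y = q \<otimes> (z \<otimes> y)"
    using qz Suc.prems spow_carrier[OF Suc.prems(1)] by (subst qz(3), intro m_assoc) auto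
  then show ?case using Suc.IH[OF Suc.prems(1) qz(2) Suc.prems(3)] qz(1) by (auto intro: set_multI)
qed

lemma spow_inv:
  assumes Q: "Q \<subseteq> carrier G" "\<And>q. q \<in> Q \<Longrightarrow> inv q \<in> Q"
  shows "x \<in> spow Q n \<Longrightarrow> inv x \<in> spow Q n"
proof (induction n arbitrary: x)
  case (Suc n)
  then obtain q z where qz: "q \<in> Q" "z \<in> spow Q n" "x = q \<otimes> z" by (auto elim: set_multE)
  have "inv x = inv z \<otimes> inv q"
    using qz Q spow_carrier[OF Q(1)] by (subst qz(3), intro inv_mult_group) auto
  moreover have "inv q \<in> spow Q 1" using spow_one[OF Q(1)] Q(2)[OF qz(1)] by simp
  ultimately show ?case using spow_add[OF Q(1) Suc.IH[OF qz(2)], of "inv q" 1] by simp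
qed auto

end

section \<open>Convolution against the Haar functional\<close>

context haar_group begin

text \<open>The usual convolution. A left translation can be passed to the first factor by
  invariance of \<open>I\<close>, or be absorbed by the second factor as a conjugate; the trapping
  lemma does the one with \<open>q\<close> and the other with \<open>h\<close> to bound a second
  difference.\<close>

definition conv :: "('a \<Rightarrow> real) \<Rightarrow> ('a \<Rightarrow> real) \<Rightarrow> 'a \<Rightarrow> real" where
  "conv \<psi> \<eta> x = I (\<lambda>y. \<psi> y * \<eta> (inv y \<otimes> x))"

lemma Cc_reflect:
  assumes "\<eta> \<in> Cc" "x \<in> carrier G"
  shows "(\<lambda>y. \<eta> (inv y \<otimes> x)) \<in> Cc"
  using Cc_ltrans[OF inv_closed[OF assms(2)] Cc_inv[OF assms(1)]]
  by (rule Cc_cong) (use assms in \<open>simp add: inv_mult_group\<close>)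

lemma conv_Cc:
  assumes "\<psi> \<in> Cc" "\<eta> \<in> Cc" "x \<in> carrier G"
  shows "(\<lambda>y. \<psi> y * \<eta> (inv y \<otimes> x)) \<in> Cc"
  using Cc_mult'[OF assms(1) Cc_cont[OF Cc_reflect[OF assms(2,3)]]] .

lemma conv_ltrans:
  assumes "\<psi> \<in> Cc" "\<eta> \<in> Cc" "x \<in> carrier G" "h \<in> carrier G"
  shows "conv \<psi> \<eta> (h \<otimes> x) = conv (\<lambda>y. \<psi> (h \<otimes> y)) \<eta> x"
proof -
  have hx: "h \<otimes> x \<in> carrier G" using assms by simp
  have "conv \<psi> \<eta> (h \<otimes> x) = I (\<lambda>y. \<psi> (h \<otimes> y) * \<eta> (inv (h \<otimes> y) \<otimes> (h \<otimes> x)))"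
    unfolding conv_def using I_ltrans[OF conv_Cc[OF assms(1,2) hx] assms(4)] by simp
  also have "\<dots> = conv (\<lambda>y. \<psi> (h \<otimes> y)) \<eta> x"
    unfolding conv_def
  proof (rule I_cong)
    show "(\<lambda>y. \<psi> (h \<otimes> y) * \<eta> (inv (h \<otimes> y) \<otimes> (h \<otimes> x))) \<in> Cc"
      using Cc_ltrans[OF assms(4) conv_Cc[OF assms(1,2) hx]] .
    fix y assume y: "y \<in> carrier G"
    have "inv (h \<otimes> y) \<otimes> (h \<otimes> x) = inv y \<otimes> x" using y assms by (simp add: inv_mult_group m_assoc)
    then show "\<psi> (h \<otimes> y) * \<eta> (inv (h \<otimes> y) \<otimes> (h \<otimes> x)) = \<psi> (h \<otimes> y) * \<eta> (inv y \<otimes> x)" by simp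
  qed
  finally show ?thesis .
qed

lemma conv_diff:
  assumes "\<psi> \<in> Cc" "\<psi>' \<in> Cc" "\<eta> \<in> Cc" "x \<in> carrier G"
  shows "conv (\<lambda>y. \<psi> y - \<psi>' y) \<eta> x = conv \<psi> \<eta> x - conv \<psi>' \<eta> x"
  unfolding conv_def using I_diff[OF conv_Cc[OF assms(1,3,4)] conv_Cc[OF assms(2,3,4)]]
  by (simp add: algebra_simps)

lemma conv_bounded:
  assumes "\<psi> \<in> Cc" "\<eta> \<in> Cc"
  obtains M where "\<And>x. x \<in> carrier G \<Longrightarrow> \<bar>conv \<psi> \<eta> x\<bar> \<le> M"
proof -
  obtain M where M: "0 < M" "\<And>x. x \<in> carrier G \<Longrightarrow> \<bar>\<eta> x\<bar> \<le> M" using Cc_bounded[OF assms(2)] by blast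
  have "\<bar>conv \<psi> \<eta> x\<bar> \<le> I (\<lambda>y. M * \<bar>\<psi> y\<bar>)" if x: "x \<in> carrier G" for x
    unfolding conv_def
  proof (rule I_abs_le)
    show "(\<lambda>y. M * \<bar>\<psi> y\<bar>) \<in> Cc" using assms Cc_scale Cc_abs by auto
    fix y assume "y \<in> carrier G"
    then show "\<bar>\<psi> y * \<eta> (inv y \<otimes> x)\<bar> \<le> M * \<bar>\<psi> y\<bar>"
      using M(2)[of "inv y \<otimes> x"] x by (simp add: abs_mult mult.commute[of M] mult_left_mono)
  qed (rule conv_Cc[OF assms x])
  then show thesis using that by blast
qed

text \<open>Gleason's lemma on trapping: the supremum \<open>\<psi>\<close> below is \<open>1/n\<close>-Lipschitz along \<open>Q\<close>, so its
  smoothing \<open>\<phi>\<close> has second differences of size \<open>\<epsilon>/n\<close> along small elements; averaging over the powers of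
  \<open>q \<in> Q\<close>, all of which are small, turns this into a bound \<open>\<epsilon>/n\<close> on the first differences.\<close>

lemma gleason_trapping:
  fixes m :: nat
  assumes B: "compactin T B" and U: "nb U"
  obtains V where "nb V"
    "\<And>Q n. Q \<subseteq> carrier G \<Longrightarrow> \<one> \<in> Q \<Longrightarrow> (\<And>q. q \<in> Q \<Longrightarrow> inv q \<in> Q) \<Longrightarrow>
      (\<And>q i. q \<in> Q \<Longrightarrow> q [^] (i::nat) \<in> V) \<Longrightarrow> 0 < n \<Longrightarrow> spow Q n \<subseteq> B \<Longrightarrow> spow Q (m * n) \<subseteq> B <#> U"
proof -
  obtain U1 where U1: "nb U1" "\<And>x y. x \<in> U1 \<Longrightarrow> y \<in> U1 \<Longrightarrow> x \<otimes> y \<in> U"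
    using nb_mult_sym[OF U] by metis
  obtain C where C: "nb C" "compactin T C" "C \<subseteq> U1" using nb_compact[OF U1(1)] by blast
  obtain b where b: "b \<in> Cc" "\<And>x. 0 \<le> b x" "\<And>x. b x \<le> 1" "b \<one> = 1" "\<And>x. x \<notin> C \<Longrightarrow> b x = 0"
    using bump_exists[OF C(1)] by blast
  \<comment> \<open>This has to contain the support of
    \<open>\<psi> (q \<otimes> y) - \<psi> y\<close> as a function of \<open>y\<close>:
    \<open>\<psi>\<close> lives on \<open>B <#> C\<close>, and undoing the factor \<open>q\<close>
    costs one more element \<open>inv q\<close> of \<open>B\<close>.\<close>
  define B' where "B' = B <#> (B <#> C)"
  have B': "compactin T B'" unfolding B'_def using B C compact_set_mult by auto
  obtain \<xi> where xi: "\<xi> \<in> Cc" "\<And>x. x \<in> carrier G \<Longrightarrow> 0 \<le> \<xi> x" "\<And>x. x \<in> B' \<Longrightarrow> 1 \<le> \<xi> x"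
    using cutoff_exists[OF B'] by blast
  define c0 where "c0 = conv b b \<one>"
  have c0: "0 < c0" unfolding c0_def conv_def
    by (rule I_pos[OF conv_Cc[OF b(1) b(1) one_closed]]) (use b in auto)
  define X where "X = I \<xi>"
  have X: "0 \<le> X" unfolding X_def using xi by (intro I_nonneg)
  \<comment> \<open>Along \<open>m * n\<close> factors \<open>\<phi>\<close> changes by at most
    \<open>m * n * (\<epsilon> * X / n) = m * \<epsilon> * X\<close>; this must stay below
    \<open>c0\<close>, a lower bound of \<open>\<phi>\<close> at the identity.\<close>
  define \<epsilon> where "\<epsilon> = c0 / (real m * X + 1)"
  have mX: "0 < real m * X + 1" using X by (simp add: add_nonneg_pos)
  have eps: "0 < \<epsilon>" "real m * (\<epsilon> * X) < c0"
    unfolding \<epsilon>_def using c0 mX by (auto simp: field_simps)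
  obtain V1 where V1: "nb V1" "\<And>x v. x \<in> carrier G \<Longrightarrow> v \<in> V1 \<Longrightarrow> \<bar>b (v \<otimes> x) - b x\<bar> < \<epsilon>"
    using Cc_left_uc[OF b(1) eps(1)] by blast
  obtain V where V: "nb V" "\<And>x v. x \<in> B' \<Longrightarrow> v \<in> V \<Longrightarrow> inv x \<otimes> v \<otimes> x \<in> V1"
    using nb_conj_compact[OF B' V1(1)] by blast
  show thesis
  proof (rule that[OF V(1)])
    fix Q and n :: nat
    assume Q: "Q \<subseteq> carrier G" "\<one> \<in> Q" "\<And>q. q \<in> Q \<Longrightarrow> inv q \<in> Q"
      "\<And>q i. q \<in> Q \<Longrightarrow> q [^] (i::nat) \<in> V" and n: "0 < n" and QB: "spow Q n \<subseteq> B"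
    note sc = spow_carrier[OF Q(1)]
    have QsubB: "Q \<subseteq> B" using spow_mono[OF Q(1,2), of 1 n] n QB spow_one[OF Q(1)] by simp
    define A where "A = {(j, p). j \<le> n \<and> p \<in> spow Q j}"
    \<comment> \<open>A copy of \<open>b\<close> at each \<open>j\<close>-fold product, of height
      \<open>1 - j / n\<close>: one more factor from \<open>Q\<close> lowers the height by
      \<open>1 / n\<close>, and at \<open>j = n\<close> the height is already 0, so products of
      length \<open>n + 1\<close> are not missed.\<close>
    define \<psi> where "\<psi> = (\<lambda>x. SUP i\<in>A. (1 - real (fst i) / n) * b (inv (snd i) \<otimes> x))"
    have A: "A \<noteq> {}" "\<forall>i\<in>A. inv (snd i) \<in> carrier G \<and> 0 \<le> 1 - real (fst i) / n \<and> 1 - real (fst i) / n \<le> 1"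
      unfolding A_def using sc n by (force simp: field_simps)+
    have b01: "\<forall>x\<in>carrier G. 0 \<le> b x \<and> b x \<le> 1" using b by auto
    note SUP = SUP_translates[where p="\<lambda>i. inv (snd i)" and c="\<lambda>i. 1 - real (fst i) / n" and A=A,
        OF Cc_right_uc[OF b(1)] b01 A]
    have S1: "right_uc \<psi>"
      unfolding \<psi>_def by (rule SUP(1))
    have S2: "(1 - real (fst i) / n) * b (inv (snd i) \<otimes> x) \<le> \<psi> x" if "i \<in> A" "x \<in> carrier G" for i x
      unfolding \<psi>_def by (rule SUP(2)[OF that])
    have S3: "\<psi> x \<le> M" if "\<And>i. i \<in> A \<Longrightarrow> (1 - real (fst i) / n) * b (inv (snd i) \<otimes> x) \<le> M" for x M
      unfolding \<psi>_def using that by (rule SUP(3))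
    have S4: "0 \<le> \<psi> x" if "x \<in> carrier G" for x
      unfolding \<psi>_def by (rule SUP(4)[OF that])
    have psi_b: "b x \<le> \<psi> x" if x: "x \<in> carrier G" for x
      using S2[where i="(0, \<one>)" and x=x] x unfolding A_def by simp
    have psi_supp: "x \<in> B <#> C" if x: "x \<in> carrier G" "\<psi> x \<noteq> 0" for x
    proof (rule ccontr)
      assume nx: "x \<notin> B <#> C"
      have "(1 - real (fst i) / n) * b (inv (snd i) \<otimes> x) \<le> 0" if i: "i \<in> A" for i
      proof -
        have "snd i \<in> B" using i QB spow_mono[OF Q(1,2)] unfolding A_def by (auto simp: subset_iff)
        moreover have "snd i \<otimes> (inv (snd i) \<otimes> x) = x"
          using i sc x unfolding A_def by (auto simp: subset_iff)
        ultimately have "inv (snd i) \<otimes> x \<notin> C" using nx by (metis set_multI)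
        then show ?thesis using b(5) by simp
      qed
      then have "\<psi> x \<le> 0" by (rule S3)
      then show False using S4[OF x(1)] x(2) by simp
    qed
    have psiC: "\<psi> \<in> Cc"
      by (rule CcI[OF right_uc_cont[OF S1] compact_set_mult[OF B C(2)]]) (use psi_supp in blast)
    have psi_step: "\<psi> y \<le> \<psi> (q \<otimes> y) + 1 / n" if q: "q \<in> Q" and y: "y \<in> carrier G" for q y
    proof (rule S3)
      fix i assume i: "i \<in> A"
      obtain j p where jp: "i = (j, p)" by (cases i)
      then have j: "j \<le> n" "p \<in> spow Q j" using i unfolding A_def by auto
      have c: "q \<in> carrier G" "p \<in> carrier G" using q Q(1) sc[of j] j by auto
      show "(1 - real (fst i) / n) * b (inv (snd i) \<otimes> y) \<le> \<psi> (q \<otimes> y) + 1 / n"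
      proof (cases "j = n")
        case True
        then show ?thesis using S4[where x="q \<otimes> y"] c y n unfolding jp by simp
      next
        case False
        then have "(Suc j, q \<otimes> p) \<in> A" unfolding A_def using j q by (auto intro: set_multI)
        from S2[OF this, where x="q \<otimes> y"] have "(1 - real (Suc j) / n) * b (inv (q \<otimes> p) \<otimes> (q \<otimes> y)) \<le> \<psi> (q \<otimes> y)"
          using c y by simp
        moreover have "inv (q \<otimes> p) \<otimes> (q \<otimes> y) = inv p \<otimes> y" using c y by (simp add: inv_mult_group m_assoc)
        moreover have "(1 - real j / n) * b (inv p \<otimes> y) = (1 - real (Suc j) / n) * b (inv p \<otimes> y) + b (inv p \<otimes> y) / n"
          using n by (simp add: field_simps)
        moreover have "b (inv p \<otimes> y) / n \<le> 1 / n" using b(3) by (intro divide_right_mono) auto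
        ultimately show ?thesis unfolding jp by simp
      qed
    qed
    have psi_lip: "\<bar>\<psi> (q \<otimes> y) - \<psi> y\<bar> \<le> 1 / n" if q: "q \<in> Q" and y: "y \<in> carrier G" for q y
    proof -
      have c: "q \<in> carrier G" using q Q by auto
      have "\<psi> (q \<otimes> y) \<le> \<psi> (inv q \<otimes> (q \<otimes> y)) + 1 / n" using psi_step[OF Q(3)[OF q], of "q \<otimes> y"] c y by simp
      then show ?thesis using psi_step[OF q y] c y by simp
    qed
    define \<phi> where "\<phi> = conv \<psi> b"
    obtain M where M: "\<And>x. x \<in> carrier G \<Longrightarrow> \<bar>\<phi> x\<bar> \<le> M"
      using conv_bounded[OF psiC b(1)] unfolding \<phi>_def by blast
    have first: "\<phi> (q \<otimes> x) - \<phi> x = I (\<lambda>y. (\<psi> (q \<otimes> y) - \<psi> y) * b (inv y \<otimes> x))"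
      if q: "q \<in> Q" and x: "x \<in> carrier G" for q x
    proof -
      have c: "q \<in> carrier G" using q Q by auto
      show ?thesis
        unfolding \<phi>_def conv_ltrans[OF psiC b(1) x c] conv_diff[OF Cc_ltrans[OF c psiC] psiC b(1) x, symmetric]
        unfolding conv_def ..
    qed
    \<comment> \<open>The factor \<open>q\<close> is shifted onto \<open>\<psi>\<close>, where it
      leaves a difference of at most \<open>1 / n\<close>; \<open>h\<close> is shifted onto
      \<open>b\<close>, where conjugation by \<open>y \<in> B'\<close> puts it into
      \<open>V1\<close> and the difference is at most \<open>\<epsilon>\<close>.\<close>
    have second: "\<bar>(\<phi> (q \<otimes> (h \<otimes> x)) - \<phi> (h \<otimes> x)) - (\<phi> (q \<otimes> x) - \<phi> x)\<bar> \<le> \<epsilon> * X / n"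
      if q: "q \<in> Q" and h: "h \<in> V" and x: "x \<in> carrier G" for q h x
    proof -
      have c: "q \<in> carrier G" "h \<in> carrier G" "h \<otimes> x \<in> carrier G" using q Q h x V(1) nb_in_carrier by auto
      define D where "D = (\<lambda>y. \<psi> (q \<otimes> y) - \<psi> y)"
      have D: "D \<in> Cc" unfolding D_def using Cc_diff[OF Cc_ltrans[OF c(1) psiC] psiC] .
      have D_supp: "y \<in> B'" if y: "y \<in> carrier G" "D y \<noteq> 0" for y
      proof -
        have "\<psi> (q \<otimes> y) \<noteq> 0 \<or> \<psi> y \<noteq> 0" using y unfolding D_def by auto
        then have "q \<otimes> y \<in> B <#> C \<or> \<one> \<otimes> y \<in> B <#> C" using psi_supp c y by auto
        moreover have "inv q \<otimes> (q \<otimes> y) = y" "\<one> \<otimes> (\<one> \<otimes> y) = y" using c y by auto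
        moreover have "inv q \<in> B" "\<one> \<in> B" using Q(2) Q(3)[OF q] QsubB by auto
        ultimately show ?thesis unfolding B'_def by (metis set_multI)
      qed
      have "(\<phi> (q \<otimes> (h \<otimes> x)) - \<phi> (h \<otimes> x)) - (\<phi> (q \<otimes> x) - \<phi> x)
          = I (\<lambda>y. D y * b (inv y \<otimes> (h \<otimes> x)) - D y * b (inv y \<otimes> x))"
        unfolding first[OF q c(3)] first[OF q x]
        using I_diff[OF conv_Cc[OF D b(1) c(3)] conv_Cc[OF D b(1) x]] unfolding D_def by simp
      also have "\<bar>\<dots>\<bar> \<le> I (\<lambda>y. (\<epsilon> / n) * \<xi> y)"
      proof (rule I_abs_le)
        show "(\<lambda>y. D y * b (inv y \<otimes> (h \<otimes> x)) - D y * b (inv y \<otimes> x)) \<in> Cc"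
          using Cc_diff[OF conv_Cc[OF D b(1) c(3)] conv_Cc[OF D b(1) x]] .
        show "(\<lambda>y. (\<epsilon> / n) * \<xi> y) \<in> Cc" using xi(1) by (rule Cc_scale)
        fix y assume y: "y \<in> carrier G"
        show "\<bar>D y * b (inv y \<otimes> (h \<otimes> x)) - D y * b (inv y \<otimes> x)\<bar> \<le> (\<epsilon> / n) * \<xi> y"
        proof (cases "D y = 0")
          case True
          then show ?thesis using xi(2)[OF y] eps n by simp
        next
          case False
          then have yB: "y \<in> B'" using D_supp y by auto
          have e: "inv y \<otimes> (h \<otimes> x) = (inv y \<otimes> h \<otimes> y) \<otimes> (inv y \<otimes> x)"
            using y c x by (simp add: m_assoc)
          have "\<bar>b (inv y \<otimes> (h \<otimes> x)) - b (inv y \<otimes> x)\<bar> < \<epsilon>"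
            unfolding e using V1(2)[OF _ V(2)[OF yB h], of "inv y \<otimes> x"] y x by simp
          then have "\<bar>D y\<bar> * \<bar>b (inv y \<otimes> (h \<otimes> x)) - b (inv y \<otimes> x)\<bar> \<le> (1 / n) * \<epsilon>"
            using psi_lip[OF q y] eps unfolding D_def by (intro mult_mono) auto
          also have "\<dots> \<le> (1 / n) * \<epsilon> * \<xi> y"
            using xi(3)[OF yB] eps n by (simp add: field_simps)
          finally show ?thesis by (simp add: abs_mult flip: right_diff_distrib)
        qed
      qed
      also have "\<dots> = \<epsilon> * X / n" unfolding X_def using I_scale[OF xi(1), of "\<epsilon> / n"] by simp
      finally show ?thesis .
    qed
    have small: "\<bar>\<phi> (q \<otimes> x) - \<phi> x\<bar> \<le> \<epsilon> * X / n" if q: "q \<in> Q" and x: "x \<in> carrier G" for q x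
    proof -
      have c: "q \<in> carrier G" using q Q by auto
      define a where "a = (\<lambda>i::nat. \<phi> (q [^] i \<otimes> x))"
      have s: "q [^] (Suc i) \<otimes> x = q \<otimes> (q [^] i \<otimes> x)" for i :: nat
        using c x nat_pow_Suc2[OF c, of i] by (simp add: m_assoc)
      have a01: "a 0 = \<phi> x" "a 1 = \<phi> (q \<otimes> x)" unfolding a_def using c x by auto
      have "\<bar>a 1 - a 0\<bar> \<le> \<epsilon> * X / n"
      proof (rule bounded_sequence_increment_le)
        show "\<bar>a i\<bar> \<le> M" for i unfolding a_def using M c x by auto
        show "\<bar>(a (Suc i) - a i) - (a 1 - a 0)\<bar> \<le> \<epsilon> * X / n" for i
          unfolding a01 unfolding a_def s using second[OF q Q(4)[OF q] x] .
      qed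
      then show ?thesis unfolding a01 .
    qed
    have far: "\<bar>\<phi> z - \<phi> \<one>\<bar> \<le> k * (\<epsilon> * X / n)" if "z \<in> spow Q k" for z k
      using that
    proof (induction k arbitrary: z)
      case (Suc k)
      then obtain q y where qy: "q \<in> Q" "y \<in> spow Q k" "z = q \<otimes> y" by (auto elim: set_multE)
      have "\<bar>\<phi> z - \<phi> y\<bar> \<le> \<epsilon> * X / n" unfolding qy(3) using small qy sc by auto
      moreover have "real (Suc k) * (\<epsilon> * X / n) = k * (\<epsilon> * X / n) + \<epsilon> * X / n"
        unfolding of_nat_Suc distrib_right by simp
      ultimately show ?case using Suc.IH[OF qy(2)] by linarith
    qed auto
    have phi1: "c0 \<le> \<phi> \<one>"
      unfolding c0_def \<phi>_def conv_def
      by (intro I_mono conv_Cc b(1) psiC one_closed mult_right_mono psi_b b(2))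
    show "spow Q (m * n) \<subseteq> B <#> U"
    proof
      fix z assume z: "z \<in> spow Q (m * n)"
      then have zc: "z \<in> carrier G" using sc by auto
      have "\<bar>\<phi> z - \<phi> \<one>\<bar> \<le> real m * (\<epsilon> * X)" using far[OF z] n by simp
      then have pz: "\<phi> z \<noteq> 0" using phi1 eps(2) by auto
      \<comment> \<open>A nonzero convolution at \<open>z\<close> writes \<open>z\<close> as a point
        of \<open>B <#> C\<close>, where \<open>\<psi>\<close> lives, times a point of
        \<open>C\<close>, where \<open>b\<close> lives.\<close>
      have "\<exists>y\<in>carrier G. \<psi> y * b (inv y \<otimes> z) \<noteq> 0"
      proof (rule ccontr)
        assume "\<not> ?thesis"
        then have "I (\<lambda>y. \<psi> y * b (inv y \<otimes> z)) = I (\<lambda>y. 0)"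
          by (intro I_cong conv_Cc[OF psiC b(1) zc]) auto
        then show False using pz I_zero unfolding \<phi>_def conv_def by simp
      qed
      then obtain y where y: "y \<in> carrier G" "\<psi> y \<noteq> 0" "b (inv y \<otimes> z) \<noteq> 0" by auto
      obtain u c where uc: "u \<in> B" "c \<in> C" "y = u \<otimes> c" using psi_supp[OF y(1,2)] by (auto elim: set_multE)
      have "inv y \<otimes> z \<in> C" using b(5) y(3) by blast
      then have "c \<otimes> (inv y \<otimes> z) \<in> U" using U1(2) uc C(3) by auto
      moreover have "z = u \<otimes> (c \<otimes> (inv y \<otimes> z))"
      proof -
        have "u \<in> carrier G" "c \<in> carrier G" using uc compact_carrier B C by auto
        then have "u \<otimes> (c \<otimes> (inv y \<otimes> z)) = y \<otimes> (inv y \<otimes> z)"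
          unfolding uc(3) using y(1) zc m_assoc[of u c "inv y \<otimes> z"] uc(3) by simp
        then show ?thesis using y zc by simp
      qed
      ultimately show "z \<in> B <#> U" using uc(1) by (metis set_multI)
    qed
  qed
qed

end

context lc_group begin

section \<open>The trapped compact subgroup\<close>

lemma limitin_mult:
  assumes "limitin T y a F" "limitin T z b F"
  shows "limitin T (\<lambda>i. y i \<otimes> z i) (a \<otimes> b) F"
proof -
  have "limitin (prod_topology T T) (\<lambda>i. (y i, z i)) (a, b) F"
    using assms by (simp add: limitin_pairwise o_def)
  from continuous_map_limit[OF continuous_mult this] show ?thesis by (simp add: o_def)
qed

lemma limitin_inv: "limitin T y a F \<Longrightarrow> limitin T (\<lambda>i. inv (y i)) (inv a) F"
  using continuous_map_limit[OF continuous_inv] by (fastforce simp: o_def)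

lemma limitin_nb:
  assumes "limitin T y \<one> F" "nb U"
  shows "eventually (\<lambda>i. y i \<in> U) F"
proof -
  obtain W where W: "openin T W" "\<one> \<in> W" "W \<subseteq> U" using assms(2) unfolding neighbourhood_in_def by auto
  show ?thesis by (rule eventually_mono[OF limitinD[OF assms(1) W(1,2)]]) (use W(3) in auto)
qed

lemma limitin_rquotient:
  assumes "limitin T y a F" "nb U"
  shows "eventually (\<lambda>i. y i \<otimes> inv a \<in> U) F"
proof -
  have a: "a \<in> carrier G" using limitin_topspace[OF assms(1)] topspace_eq_carrier by simp
  then have "limitin T (\<lambda>i. inv a) (inv a) F" using topspace_eq_carrier by simp
  from limitin_mult[OF assms(1) this] have "limitin T (\<lambda>i. y i \<otimes> inv a) \<one> F" using a by simp
  then show ?thesis using limitin_nb assms(2) by blast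
qed

text \<open>Inverse powers are included so that the set is symmetric, as the trapping lemma
  requires.\<close>

definition core :: "'a set \<Rightarrow> 'a set" where
  "core V = {g \<in> carrier G. \<forall>i::nat. g [^] i \<in> V \<and> inv g [^] i \<in> V}"

definition small_powers :: bool where
  "small_powers \<longleftrightarrow> (\<forall>U. nb U \<longrightarrow> (\<exists>V. nb V \<and> (\<forall>g\<in>V. \<forall>i::nat. g [^] i \<in> U)))"

lemma core_props:
  shows "core V \<subseteq> carrier G" "\<And>g. g \<in> core V \<Longrightarrow> inv g \<in> core V" "\<And>g i. g \<in> core V \<Longrightarrow> g [^] (i::nat) \<in> V"
    "core V \<subseteq> V" "nb V \<Longrightarrow> \<one> \<in> core V"
proof -
  show "core V \<subseteq> V"
  proof
    fix g assume g: "g \<in> core V"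
    then have "g [^] (1::nat) \<in> V" unfolding core_def by blast
    then show "g \<in> V" using g unfolding core_def by simp
  qed
qed (auto simp: core_def nb_one)

lemma nb_core:
  assumes "small_powers" "nb V"
  shows "nb (core V)"
proof -
  have "nb (V \<inter> {x \<in> carrier G. inv x \<in> V})" using nb_Int[OF assms(2) nb_inv[OF assms(2)]] .
  then obtain W where W: "nb W" "\<And>g i. g \<in> W \<Longrightarrow> g [^] (i::nat) \<in> V \<inter> {x \<in> carrier G. inv x \<in> V}"
    using assms(1) unfolding small_powers_def by blast
  have "W \<subseteq> core V"
  proof
    fix g assume g: "g \<in> W"
    then have gc: "g \<in> carrier G" using W(1) nb_in_carrier by blast
    have "inv g [^] i = inv (g [^] i)" for i :: nat using nat_pow_inv[OF gc] by simp
    then show "g \<in> core V" using W(2)[OF g] gc unfolding core_def by auto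
  qed
  then show ?thesis by (rule nb_mono[OF W(1)]) (rule core_props)
qed

end

context haar_group begin

text \<open>The subgroup consists of the limits of products \<open>q\<^sub>1 \<cdots> q\<^sub>k\<close> with \<open>k = m * n V\<close> and \<open>q\<^sub>i\<close> in the core of
  \<open>V\<close>, as \<open>V\<close> shrinks, where \<open>n V\<close> is maximal such that the products of length \<open>n V\<close> stay in \<open>B\<close>;
  trapping confines them to \<open>B <#> B\<close> for each fixed \<open>m\<close>.\<close>

lemma trapped_subgroup:
  assumes small: small_powers and U: "nb U" and no: "\<And>H. subgroup H G \<Longrightarrow> nb H \<Longrightarrow> \<not> H \<subseteq> U"
  obtains H C where "subgroup H G" "compactin T C" "H \<subseteq> C" "H \<noteq> {\<one>}"
    "\<And>W h. nb W \<Longrightarrow> h \<in> H \<Longrightarrow> \<exists>k. h \<in> spow (H \<inter> W) k"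
proof -
  obtain B where B: "nb B" "compactin T B" "B \<subseteq> U" using nb_compact[OF U] by blast
  define C where "C = B <#> B"
  have C: "compactin T C" unfolding C_def using B compact_set_mult by auto
  have Cclosed: "closedin T C" using compactin_imp_closedin[OF Hausdorff C] .
  note cc = core_props(1)
  have "\<exists>n. 0 < n \<and> spow (core V) n \<subseteq> B \<and> \<not> spow (core V) (2 * n) \<subseteq> B" if V: "nb V" "V \<subseteq> B" for V
  proof -
    have one: "\<one> \<in> core V" using core_props(5)[OF V(1)] .
    \<comment> \<open>If the powers never left \<open>B\<close>, their union would be a subgroup
      that is a neighbourhood of the identity inside \<open>U\<close>.\<close>
    have ex: "\<exists>k. \<not> spow (core V) k \<subseteq> B"
    proof (rule ccontr)
      assume *: "\<not> ?thesis"
      define H where "H = (\<Union>k. spow (core V) k)"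
      have "subgroup H G"
      proof (rule subgroupI)
        show "H \<subseteq> carrier G" unfolding H_def using spow_carrier[OF cc] by blast
        have "\<one> \<in> spow (core V) 0" by simp
        then show "H \<noteq> {}" unfolding H_def by blast
        show "inv x \<in> H" if "x \<in> H" for x
          using that spow_inv[OF cc core_props(2)] unfolding H_def by blast
        show "x \<otimes> y \<in> H" if "x \<in> H" "y \<in> H" for x y
          using that spow_add[OF cc] unfolding H_def by blast
      qed
      moreover have "core V \<subseteq> H" unfolding H_def using spow_one[OF cc] by (metis UNIV_I UN_upper)
      then have "nb H" using nb_mono[OF nb_core[OF small V(1)]] \<open>subgroup H G\<close> subgroup.subset by blast
      moreover have "H \<subseteq> U" unfolding H_def using * B(3) by blast
      ultimately show False using no by blast
    qed
    define N where "N = (LEAST k. \<not> spow (core V) k \<subseteq> B)"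
    have N: "\<not> spow (core V) N \<subseteq> B" unfolding N_def by (rule LeastI_ex[OF ex])
    have less: "spow (core V) k \<subseteq> B" if "k < N" for k
      using not_less_Least that unfolding N_def by blast
    have "N \<noteq> 0" using N nb_one[OF B(1)] by (cases N) auto
    moreover have "N \<noteq> 1" using N spow_one[OF cc] core_props(4) V(2) by (metis subset_trans)
    ultimately have N2: "2 \<le> N" by simp
    \<comment> \<open>\<open>N\<close> is the first exit time and \<open>N - 1\<close> the last
      trapped one; \<open>N \<ge> 2\<close> gives \<open>N \<le> 2 * (N - 1)\<close>, so doubling
      the trapped time leads past the exit.\<close>
    have "spow (core V) N \<subseteq> spow (core V) (2 * (N - 1))" using N2 by (intro spow_mono cc one) simp
    then show ?thesis using N N2 less[of "N - 1"] by (intro exI[of _ "N - 1"]) auto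
  qed
  then obtain n where n: "\<And>V. nb V \<Longrightarrow> V \<subseteq> B \<Longrightarrow> 0 < n V \<and> spow (core V) (n V) \<subseteq> B \<and> \<not> spow (core V) (2 * n V) \<subseteq> B"
    by metis
  obtain F where F: "F \<le> nb_filter" "ultrafilter F" using ultrafilter_below[OF nb_filter_not_bot] by blast
  have ntF: "F \<noteq> bot" using F(2) ultrafilter_not_bot by blast
  have evV: "eventually (\<lambda>V. nb V \<and> V \<subseteq> W) F" if "nb W" for W
    by (rule filter_leD[OF F(1)], rule eventually_nb_filterI[OF that]) auto
  \<comment> \<open>The neighbourhood provided by trapping depends on \<open>m\<close>. Along the
    ultrafilter \<open>V\<close> eventually lies below it for each single \<open>m\<close>, which is
    enough as \<open>H\<close> is a union over \<open>m\<close>.\<close>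
  have trap: "eventually (\<lambda>V. spow (core V) (m * n V) \<subseteq> C) F" for m
  proof -
    obtain V0 where V0: "nb V0" "\<And>Q n. Q \<subseteq> carrier G \<Longrightarrow> \<one> \<in> Q \<Longrightarrow> (\<And>q. q \<in> Q \<Longrightarrow> inv q \<in> Q) \<Longrightarrow>
      (\<And>q i. q \<in> Q \<Longrightarrow> q [^] (i::nat) \<in> V0) \<Longrightarrow> 0 < n \<Longrightarrow> spow Q n \<subseteq> B \<Longrightarrow> spow Q (m * n) \<subseteq> B <#> B"
      using gleason_trapping[OF B(2,1), of m] by blast
    show ?thesis
      using evV[OF nb_Int[OF V0(1) B(1)]]
    proof eventually_elim
      case (elim V)
      then have V: "nb V" "V \<subseteq> B" "V \<subseteq> V0" by auto
      show ?case unfolding C_def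
      proof (rule V0(2)[OF cc core_props(5)[OF V(1)] core_props(2)])
        show "q [^] i \<in> V0" if "q \<in> core V" for q and i :: nat
          using core_props(3)[OF that] V(3) by blast
      qed (use n[OF V(1,2)] in auto)
    qed
  qed
  \<comment> \<open>Lengths add under multiplication, so \<open>E m\<close> times
    \<open>E m'\<close> lies in \<open>E (m + m')\<close> and the union over \<open>m\<close> is
    closed under products.\<close>
  define E where "E = (\<lambda>m. {x. \<exists>y. limitin T y x F \<and> eventually (\<lambda>V. y V \<in> spow (core V) (m * n V)) F})"
  define H where "H = (\<Union>m. E m)"
  have EC: "E m \<subseteq> C" for m
  proof
    fix x assume "x \<in> E m"
    then obtain y where y: "limitin T y x F" "eventually (\<lambda>V. y V \<in> spow (core V) (m * n V)) F"
      unfolding E_def by blast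
    have "eventually (\<lambda>V. y V \<in> C) F" using y(2) trap[of m] by eventually_elim blast
    then show "x \<in> C" using limitin_closedin[OF y(1) Cclosed] ntF by blast
  qed
  have lim_in_E: "\<exists>x\<in>E m. limitin T y x F" if "eventually (\<lambda>V. y V \<in> spow (core V) (m * n V)) F" for y m
  proof -
    have "eventually (\<lambda>V. y V \<in> C) F" using that trap[of m] by eventually_elim blast
    then obtain l where "limitin T y l F" using ultrafilter_compact_limit[OF F(2) C] by blast
    then show ?thesis using that unfolding E_def by blast
  qed
  have HC: "H \<subseteq> C" unfolding H_def using EC by blast
  have sub: "subgroup H G"
  proof (rule subgroupI)
    show Hc: "H \<subseteq> carrier G" using HC compact_carrier[OF C] by blast
    have "\<one> \<in> E 0" unfolding E_def using topspace_eq_carrier by (auto intro!: exI[of _ "\<lambda>_. \<one>"])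
    then show "H \<noteq> {}" unfolding H_def by blast
    show "inv x \<in> H" if xH: "x \<in> H" for x
    proof -
      obtain m y where y: "limitin T y x F" "eventually (\<lambda>V. y V \<in> spow (core V) (m * n V)) F"
        using xH unfolding H_def E_def by blast
      have "eventually (\<lambda>V. inv (y V) \<in> spow (core V) (m * n V)) F"
        using y(2) by eventually_elim (rule spow_inv[OF cc core_props(2)])
      then have "inv x \<in> E m" unfolding E_def using limitin_inv[OF y(1)] by blast
      then show ?thesis unfolding H_def by blast
    qed
    show "x \<otimes> x' \<in> H" if xH: "x \<in> H" "x' \<in> H" for x x'
    proof -
      obtain m y where y: "limitin T y x F" "eventually (\<lambda>V. y V \<in> spow (core V) (m * n V)) F"
        using xH(1) unfolding H_def E_def by blast
      obtain m' y' where y': "limitin T y' x' F" "eventually (\<lambda>V. y' V \<in> spow (core V) (m' * n V)) F"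
        using xH(2) unfolding H_def E_def by blast
      have "eventually (\<lambda>V. y V \<otimes> y' V \<in> spow (core V) ((m + m') * n V)) F"
        using y(2) y'(2) by eventually_elim (simp add: spow_add[OF cc] distrib_right)
      then have "x \<otimes> x' \<in> E (m + m')" unfolding E_def using limitin_mult[OF y(1) y'(1)] by blast
      then show ?thesis unfolding H_def by blast
    qed
  qed
  have nontriv: "H \<noteq> {\<one>}"
  proof
    assume H1: "H = {\<one>}"
    \<comment> \<open>Products of double length leave the neighbourhood \<open>B\<close> of the
      identity, and witnesses outside \<open>B\<close> cannot converge to the identity.\<close>
    have "\<forall>V. \<exists>z. nb V \<and> V \<subseteq> B \<longrightarrow> z \<in> spow (core V) (2 * n V) \<and> z \<notin> B" using n by blast
    then obtain y where y: "\<And>V. nb V \<and> V \<subseteq> B \<Longrightarrow> y V \<in> spow (core V) (2 * n V) \<and> y V \<notin> B" by metis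
    have "eventually (\<lambda>V. y V \<in> spow (core V) (2 * n V)) F"
      using evV[OF B(1)] by eventually_elim (use y in blast)
    then obtain x where x: "x \<in> E 2" "limitin T y x F" using lim_in_E by blast
    have "x \<in> H" using x(1) unfolding H_def by blast
    then have "limitin T y \<one> F" using H1 x(2) by simp
    from limitin_nb[OF this B(1)] evV[OF B(1)] have "eventually (\<lambda>V. False) F"
      by eventually_elim (use y in blast)
    then show False using ntF by (simp add: trivial_limit_def)
  qed
  \<comment> \<open>Uniform over the whole product set: otherwise a choice of bad points would have
    a limit in \<open>E m\<close>, to which the points are eventually close.\<close>
  have approx: "eventually (\<lambda>V. \<forall>y\<in>spow (core V) (m * n V). \<exists>e\<in>E m. y \<otimes> inv e \<in> W) F" if W: "nb W" for m W
  proof (rule ccontr)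
    assume "\<not> ?thesis"
    from ultrafilter_not_eventually[OF F(2) this]
    have ev: "eventually (\<lambda>V. \<exists>y. y \<in> spow (core V) (m * n V) \<and> (\<forall>e\<in>E m. y \<otimes> inv e \<notin> W)) F"
      by eventually_elim blast
    define y where "y = (\<lambda>V. SOME y. y \<in> spow (core V) (m * n V) \<and> (\<forall>e\<in>E m. y \<otimes> inv e \<notin> W))"
    have y: "eventually (\<lambda>V. y V \<in> spow (core V) (m * n V) \<and> (\<forall>e\<in>E m. y V \<otimes> inv e \<notin> W)) F"
      using ev by eventually_elim (unfold y_def, rule someI_ex)
    then have "eventually (\<lambda>V. y V \<in> spow (core V) (m * n V)) F" by eventually_elim blast
    then obtain x where x: "x \<in> E m" "limitin T y x F" using lim_in_E by blast
    from limitin_rquotient[OF x(2) W] y have "eventually (\<lambda>V. False) F"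
      by eventually_elim (use x(1) in blast)
    then show False using ntF by (simp add: trivial_limit_def)
  qed
  have chain: "\<exists>k. h \<in> spow (H \<inter> W) k" if W: "nb W" and h: "h \<in> H" for W h
  proof -
    obtain W2 where W2: "nb W2" "\<And>x y. x \<in> W2 \<Longrightarrow> y \<in> W2 \<Longrightarrow> x \<otimes> y \<in> W" using nb_mult_sym[OF W] by metis
    obtain W1 where W1: "nb W1" "W1 \<subseteq> W2" "\<And>x. x \<in> W1 \<Longrightarrow> inv x \<in> W1" "\<And>x y. x \<in> W1 \<Longrightarrow> y \<in> W1 \<Longrightarrow> x \<otimes> y \<in> W2"
      using nb_mult_sym[OF W2(1)] by metis
    note W1c = nb_in_carrier[OF W1(1)]
    obtain m y where y: "limitin T y h F" "eventually (\<lambda>V. y V \<in> spow (core V) (m * n V)) F"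
      using h unfolding H_def E_def by blast
    have "eventually (\<lambda>V. (\<forall>y\<in>spow (core V) (m * n V). \<exists>e\<in>E m. y \<otimes> inv e \<in> W1) \<and> y V \<in> spow (core V) (m * n V)
        \<and> y V \<otimes> inv h \<in> W1 \<and> nb V \<and> V \<subseteq> W1) F"
      using approx[OF W1(1), of m] y(2) limitin_rquotient[OF y(1) W1(1)] evV[OF W1(1)] by eventually_elim blast
    then obtain V where V: "\<And>z. z \<in> spow (core V) (m * n V) \<Longrightarrow> \<exists>e\<in>E m. z \<otimes> inv e \<in> W1"
      "y V \<in> spow (core V) (m * n V)" "y V \<otimes> inv h \<in> W1" "nb V" "V \<subseteq> W1"
      using eventually_happens'[OF ntF] by blast
    have HWc: "H \<inter> W \<subseteq> carrier G" using nb_carrier[OF W] by blast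
    \<comment> \<open>A walk along the partial products \<open>z\<close>, with a point
      \<open>e\<close> of \<open>H\<close> kept close to each. The quotient of consecutive points is
      a product of three elements of \<open>W1\<close>, hence lies in \<open>W\<close>. The extra
      factor in \<open>Suc j\<close> pays for the start, from the identity to a point of
      \<open>H\<close> near it.\<close>
    have "e \<in> spow (H \<inter> W) (Suc j)"
      if "j \<le> m * n V" "z \<in> spow (core V) j" "e \<in> H" "z \<otimes> inv e \<in> W1" for j z e
      using that
    proof (induction j arbitrary: z e)
      case 0
      then have e: "e \<in> carrier G" "inv e \<in> W1" using sub subgroup.subset by fastforce+
      then have "e \<in> W1" using W1(3)[OF e(2)] by simp
      then have "e \<otimes> \<one> \<in> W" using W1(2) nb_one[OF W1(1)] W2(2) by blast
      then have "e \<in> H \<inter> W" using e 0 by simp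
      then show ?case using spow_one[OF HWc] by simp
    next
      case (Suc j)
      then obtain q z' where qz: "q \<in> core V" "z' \<in> spow (core V) j" "z = q \<otimes> z'" by (auto elim: set_multE)
      have "z' \<in> spow (core V) (m * n V)"
        using spow_mono[OF cc core_props(5)[OF V(4)], of j "m * n V"] qz(2) Suc.prems(1) by auto
      then obtain e' where e': "e' \<in> E m" "z' \<otimes> inv e' \<in> W1" using V(1) by blast
      have e'H: "e' \<in> H" using e' unfolding H_def by blast
      have e'S: "e' \<in> spow (H \<inter> W) (Suc j)" by (rule Suc.IH[OF _ qz(2) e'H e'(2)]) (use Suc.prems in simp)
      have c: "e \<in> carrier G" "e' \<in> carrier G" "q \<in> carrier G" "z' \<in> carrier G"
        using Suc.prems(3) e'H sub subgroup.subset qz cc spow_carrier[OF cc] by blast+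
      have qW: "q \<in> W1" using qz(1) core_props(4) V(5) by blast
      have "inv (z \<otimes> inv e) \<otimes> q \<in> W2" using W1(3)[OF Suc.prems(4)] qW W1(4) by blast
      then have "(inv (z \<otimes> inv e) \<otimes> q) \<otimes> (z' \<otimes> inv e') \<in> W" using e'(2) W1(2) W2(2) by blast
      moreover have "(inv (z \<otimes> inv e) \<otimes> q) \<otimes> (z' \<otimes> inv e') = e \<otimes> inv e'"
        unfolding qz(3) using c by (simp add: inv_mult_group m_assoc)
      ultimately have "e \<otimes> inv e' \<in> H \<inter> W"
        using sub Suc.prems(3) e'H subgroup.m_closed subgroup.m_inv_closed by fastforce
      then have "(e \<otimes> inv e') \<otimes> e' \<in> spow (H \<inter> W) (Suc (Suc j))" using e'S by (auto intro: set_multI)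
      then show ?case using c by (simp add: m_assoc)
    qed
    from this[OF order_refl V(2) h V(3)] show ?thesis by blast
  qed
  show thesis by (rule that[OF sub C HC nontriv chain])
qed


section \<open>Convolution operators\<close>

text \<open>Points with \<open>\<psi> y = 0\<close> do not contribute, so the kernel has to be
  controlled only where \<open>\<psi>\<close> lives; this makes conjugation estimates over a compact
  set applicable.\<close>

lemma conv_diff_le:
  assumes "\<psi> \<in> Cc" "\<eta> \<in> Cc" "x \<in> carrier G" "x' \<in> carrier G" "0 \<le> \<epsilon>"
    and le: "\<And>y. y \<in> carrier G \<Longrightarrow> \<psi> y \<noteq> 0 \<Longrightarrow> \<bar>\<eta> (inv y \<otimes> x') - \<eta> (inv y \<otimes> x)\<bar> \<le> \<epsilon>"
  shows "\<bar>conv \<psi> \<eta> x' - conv \<psi> \<eta> x\<bar> \<le> \<epsilon> * I (\<lambda>y. \<bar>\<psi> y\<bar>)"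
proof -
  have "conv \<psi> \<eta> x' - conv \<psi> \<eta> x = I (\<lambda>y. \<psi> y * \<eta> (inv y \<otimes> x') - \<psi> y * \<eta> (inv y \<otimes> x))"
    unfolding conv_def using I_diff[OF conv_Cc[OF assms(1,2,4)] conv_Cc[OF assms(1,2,3)]] by simp
  also have "\<bar>\<dots>\<bar> \<le> I (\<lambda>y. \<epsilon> * \<bar>\<psi> y\<bar>)"
  proof (rule I_abs_le[OF Cc_diff[OF conv_Cc[OF assms(1,2,4)] conv_Cc[OF assms(1,2,3)]] Cc_scale[OF Cc_abs[OF assms(1)]]])
    fix y assume y: "y \<in> carrier G"
    have "\<bar>\<psi> y\<bar> * \<bar>\<eta> (inv y \<otimes> x') - \<eta> (inv y \<otimes> x)\<bar> \<le> \<bar>\<psi> y\<bar> * \<epsilon>"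
      using le[OF y] by (cases "\<psi> y = 0") (auto intro: mult_left_mono)
    then show "\<bar>\<psi> y * \<eta> (inv y \<otimes> x') - \<psi> y * \<eta> (inv y \<otimes> x)\<bar> \<le> \<epsilon> * \<bar>\<psi> y\<bar>"
      by (simp add: abs_mult mult.commute flip: right_diff_distrib)
  qed
  also have "\<dots> = \<epsilon> * I (\<lambda>y. \<bar>\<psi> y\<bar>)" by (rule I_scale[OF Cc_abs[OF assms(1)]])
  finally show ?thesis .
qed

lemma conv_right_uc:
  assumes "\<psi> \<in> Cc" "\<eta> \<in> Cc"
  shows "right_uc (conv \<psi> \<eta>)"
  unfolding right_uc_def
proof (intro allI impI)
  fix e :: real assume e: "0 < e"
  define B where "B = I (\<lambda>y. \<bar>\<psi> y\<bar>)"
  have B: "0 \<le> B" unfolding B_def by (rule I_nonneg[OF Cc_abs[OF assms(1)]]) simp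
  define \<epsilon> where "\<epsilon> = e / (B + 1)"
  have eps: "0 < \<epsilon>" "\<epsilon> * B < e" unfolding \<epsilon>_def using e B by (auto simp: field_simps)
  obtain V where V: "nb V" "\<And>x v. x \<in> carrier G \<Longrightarrow> v \<in> V \<Longrightarrow> \<bar>\<eta> (x \<otimes> v) - \<eta> x\<bar> < \<epsilon>"
    using right_ucD[OF Cc_right_uc[OF assms(2)] eps(1)] by blast
  have "\<bar>conv \<psi> \<eta> (x \<otimes> v) - conv \<psi> \<eta> x\<bar> < e" if x: "x \<in> carrier G" and v: "v \<in> V" for x v
  proof -
    have vc: "v \<in> carrier G" using V(1) v nb_in_carrier by blast
    have "\<bar>conv \<psi> \<eta> (x \<otimes> v) - conv \<psi> \<eta> x\<bar> \<le> \<epsilon> * B"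
      unfolding B_def
    proof (rule conv_diff_le[OF assms x])
      fix y assume "y \<in> carrier G"
      then show "\<bar>\<eta> (inv y \<otimes> (x \<otimes> v)) - \<eta> (inv y \<otimes> x)\<bar> \<le> \<epsilon>"
        using V(2)[of "inv y \<otimes> x" v] x v vc by (simp add: m_assoc)
    qed (use x vc eps in auto)
    then show ?thesis using eps(2) by linarith
  qed
  then show "\<exists>V. nb V \<and> (\<forall>x\<in>carrier G. \<forall>v\<in>V. \<bar>conv \<psi> \<eta> (x \<otimes> v) - conv \<psi> \<eta> x\<bar> < e)"
    using V(1) by blast
qed

text \<open>A Fubini theorem: a partition of unity approximates the kernel \<open>\<kappa> (inv y \<otimes> x)\<close> uniformly by
  finite sums of products, for which both sides agree.\<close>

lemma conv_selfadjoint: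
  assumes p: "p \<in> Cc" and q: "q \<in> Cc" and \<kappa>: "\<kappa> \<in> Cc" and sym: "\<And>x. x \<in> carrier G \<Longrightarrow> \<kappa> (inv x) = \<kappa> x"
  shows "I (\<lambda>x. conv p \<kappa> x * q x) = I (\<lambda>x. p x * conv q \<kappa> x)"
proof -
  define L where "L = I (\<lambda>x. conv p \<kappa> x * q x)"
  define R where "R = I (\<lambda>x. p x * conv q \<kappa> x)"
  define P where "P = I (\<lambda>x. \<bar>p x\<bar>)"
  define Q where "Q = I (\<lambda>x. \<bar>q x\<bar>)"
  have PQ: "0 \<le> P" "0 \<le> Q" unfolding P_def Q_def
    using I_nonneg[OF Cc_abs[OF p]] I_nonneg[OF Cc_abs[OF q]] by auto
  have Ccp: "(\<lambda>x. conv p \<kappa> x * q x) \<in> Cc" and Ccq: "(\<lambda>x. p x * conv q \<kappa> x) \<in> Cc"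
    using Cc_mult[OF right_uc_cont[OF conv_right_uc[OF p \<kappa>]] q] Cc_mult'[OF p right_uc_cont[OF conv_right_uc[OF q \<kappa>]]]
    by auto
  obtain K where K: "compactin T K" "\<And>x. x \<in> carrier G \<Longrightarrow> x \<notin> K \<Longrightarrow> p x = 0" using Cc_support[OF p] by blast
  have bound: "\<bar>L - R\<bar> \<le> 2 * (e * P * Q)" if e: "0 < e" for e
  proof -
    obtain V0 where V0: "nb V0" "\<And>x v. x \<in> carrier G \<Longrightarrow> v \<in> V0 \<Longrightarrow> \<bar>\<kappa> (v \<otimes> x) - \<kappa> x\<bar> < e"
      using Cc_left_uc[OF \<kappa> e] by blast
    \<comment> \<open>Inverted because \<open>near\<close> compares \<open>y\<close> with
      \<open>a\<close> through \<open>inv (inv a \<otimes> y)\<close>.\<close>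
    define V where "V = {x \<in> carrier G. inv x \<in> V0}"
    have V: "nb V" unfolding V_def by (rule nb_inv[OF V0(1)])
    obtain b where b: "b \<in> Cc" "\<And>x. 0 \<le> b x" "\<And>x. b x \<le> 1" "b \<one> = 1" "\<And>x. x \<notin> V \<Longrightarrow> b x = 0"
      using bump_exists[OF V] by blast
    have "0 < b \<one>" using b(4) by simp
    then obtain F d where F: "finite F" "F \<subseteq> K" "0 < d" "\<And>x. x \<in> K \<Longrightarrow> d \<le> (\<Sum>a\<in>F. b (inv a \<otimes> x))"
      using Cc_cover[OF b(1) b(2) _ K(1)] by blast
    have Fc: "a \<in> carrier G" if "a \<in> F" for a using that F(2) compact_carrier[OF K(1)] by auto
    define Z where "Z = (\<lambda>x. \<Sum>a\<in>F. b (inv a \<otimes> x))"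
    have Z: "Z \<in> Cc" unfolding Z_def using Fc by (intro Cc_sum F Cc_ltrans b) auto
    define M where "M = (\<lambda>x. max (Z x) d)"
    have M: "cont M" "\<And>x. 0 < M x" unfolding M_def
      using continuous_map_real_max[OF Cc_cont[OF Z]] F(3) by (auto simp: less_max_iff_disj)
    have cM: "cont (\<lambda>x. inverse (M x))"
      by (rule continuous_map_real_inverse[OF M(1)]) (use M(2) in \<open>metis less_irrefl\<close>)
    \<comment> \<open>The partition of unity splits \<open>p\<close> into pieces,
      \<open>pa a\<close> living near \<open>a\<close>. Dividing by \<open>M\<close> instead of
      \<open>Z\<close> keeps the quotient continuous; the two agree on \<open>K\<close>, off which
      \<open>p\<close> vanishes.\<close>
    define pa where "pa = (\<lambda>a x. p x * (b (inv a \<otimes> x) * inverse (M x)))"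
    have pa: "pa a \<in> Cc" if "a \<in> F" for a
      unfolding pa_def
      by (rule Cc_mult'[OF p], rule continuous_map_real_mult[OF cont_ltrans[OF inv_closed[OF Fc[OF that]] Cc_cont[OF b(1)]] cM])
    have sum_pa: "(\<Sum>a\<in>F. \<bar>pa a x\<bar>) = \<bar>p x\<bar>" "(\<Sum>a\<in>F. pa a x) = p x" if x: "x \<in> carrier G" for x
    proof -
      have eq: "p x * (Z x * inverse (M x)) = p x" "\<bar>p x\<bar> * (Z x * inverse (M x)) = \<bar>p x\<bar>"
      proof -
        have "Z x * inverse (M x) = 1 \<or> p x = 0"
        proof (cases "x \<in> K")
          case True
          then have "M x = Z x" unfolding M_def using F(4)[OF True] by (simp add: Z_def)
          then show ?thesis using M(2)[of x] by simp
        qed (use K(2)[OF x] in auto)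
        then show "p x * (Z x * inverse (M x)) = p x" "\<bar>p x\<bar> * (Z x * inverse (M x)) = \<bar>p x\<bar>" by auto
      qed
      have "\<bar>pa a x\<bar> = \<bar>p x\<bar> * (b (inv a \<otimes> x) * inverse (M x))" for a
        unfolding pa_def using b(2) M(2)[of x] by (simp add: abs_mult)
      then show "(\<Sum>a\<in>F. \<bar>pa a x\<bar>) = \<bar>p x\<bar>"
        using eq(2) unfolding Z_def by (simp add: sum_distrib_left sum_distrib_right)
      show "(\<Sum>a\<in>F. pa a x) = p x"
        using eq(1) unfolding pa_def Z_def by (simp add: sum_distrib_left sum_distrib_right)
    qed
    have near: "\<bar>\<kappa> (inv y \<otimes> x) - \<kappa> (inv a \<otimes> x)\<bar> \<le> e"
      if a: "a \<in> F" and y: "y \<in> carrier G" and x: "x \<in> carrier G" and nz: "pa a y \<noteq> 0" for a x y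
    proof -
      have "b (inv a \<otimes> y) \<noteq> 0" using nz unfolding pa_def by auto
      then have "inv (inv a \<otimes> y) \<in> V0" using b(5)[of "inv a \<otimes> y"] unfolding V_def by blast
      then have "\<bar>\<kappa> (inv (inv a \<otimes> y) \<otimes> (inv a \<otimes> x)) - \<kappa> (inv a \<otimes> x)\<bar> < e"
        using V0(2) Fc[OF a] x by simp
      moreover have "inv (inv a \<otimes> y) \<otimes> (inv a \<otimes> x) = inv y \<otimes> x"
        using Fc[OF a] x y by (simp add: inv_mult_group m_assoc)
      ultimately show ?thesis by simp
    qed
    have conv_q: "conv q \<kappa> a = I (\<lambda>x. \<kappa> (inv a \<otimes> x) * q x)" if a: "a \<in> carrier G" for a
      unfolding conv_def
    proof (rule I_cong[OF conv_Cc[OF q \<kappa> a]])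
      fix y assume y: "y \<in> carrier G"
      have "\<kappa> (inv y \<otimes> a) = \<kappa> (inv a \<otimes> y)" using sym[of "inv a \<otimes> y"] a y by (simp add: inv_mult_group)
      then show "q y * \<kappa> (inv y \<otimes> a) = \<kappa> (inv a \<otimes> y) * q y" by simp
    qed
    have kq: "(\<lambda>x. \<kappa> (inv a \<otimes> x) * q x) \<in> Cc" if "a \<in> carrier G" for a
      using Cc_mult[OF cont_ltrans[OF inv_closed[OF that] Cc_cont[OF \<kappa>]] q] .
    \<comment> \<open>The common value of both iterated integrals once
      \<open>\<kappa> (inv y \<otimes> x)\<close> is replaced by
      \<open>\<kappa> (inv a \<otimes> x)\<close> on the piece \<open>pa a\<close>; \<open>L\<close>
      and \<open>R\<close> are each within \<open>e * P * Q\<close> of it.\<close>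
    define S where "S = (\<Sum>a\<in>F. I (pa a) * conv q \<kappa> a)"
    have SL: "S = I (\<lambda>x. \<Sum>a\<in>F. I (pa a) * (\<kappa> (inv a \<otimes> x) * q x))"
      unfolding S_def using F(1) Fc kq by (simp add: I_sum Cc_scale I_scale conv_q)
    have SR: "S = I (\<lambda>y. \<Sum>a\<in>F. conv q \<kappa> a * pa a y)"
    proof -
      have "I (\<lambda>y. \<Sum>a\<in>F. conv q \<kappa> a * pa a y) = (\<Sum>a\<in>F. conv q \<kappa> a * I (pa a))"
        using F(1) pa by (simp add: I_sum Cc_scale I_scale)
      then show ?thesis unfolding S_def by (simp add: mult.commute)
    qed
    have sumL: "(\<lambda>x. \<Sum>a\<in>F. I (pa a) * (\<kappa> (inv a \<otimes> x) * q x)) \<in> Cc"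
      using Fc by (intro Cc_sum F Cc_scale kq)
    have sumR: "(\<lambda>y. \<Sum>a\<in>F. conv q \<kappa> a * pa a y) \<in> Cc"
      by (intro Cc_sum F Cc_scale pa)
    have "\<bar>I (\<lambda>x. conv p \<kappa> x * q x - (\<Sum>a\<in>F. I (pa a) * (\<kappa> (inv a \<otimes> x) * q x)))\<bar> \<le> I (\<lambda>x. (e * P) * \<bar>q x\<bar>)"
    proof (rule I_abs_le[OF Cc_diff[OF Ccp sumL] Cc_scale[OF Cc_abs[OF q]]])
      fix x assume x: "x \<in> carrier G"
      have c2: "(\<lambda>y. \<Sum>a\<in>F. \<kappa> (inv a \<otimes> x) * pa a y) \<in> Cc" by (intro Cc_sum F Cc_scale pa)
      have "conv p \<kappa> x - (\<Sum>a\<in>F. I (pa a) * \<kappa> (inv a \<otimes> x))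
          = I (\<lambda>y. p y * \<kappa> (inv y \<otimes> x) - (\<Sum>a\<in>F. \<kappa> (inv a \<otimes> x) * pa a y))"
      proof -
        have "I (\<lambda>y. \<Sum>a\<in>F. \<kappa> (inv a \<otimes> x) * pa a y) = (\<Sum>a\<in>F. \<kappa> (inv a \<otimes> x) * I (pa a))"
          using F(1) pa by (simp add: I_sum Cc_scale I_scale)
        then show ?thesis
          unfolding conv_def using I_diff[OF conv_Cc[OF p \<kappa> x] c2] by (simp add: mult.commute)
      qed
      also have "\<bar>\<dots>\<bar> \<le> I (\<lambda>y. e * \<bar>p y\<bar>)"
      proof (rule I_abs_le[OF Cc_diff[OF conv_Cc[OF p \<kappa> x] c2] Cc_scale[OF Cc_abs[OF p]]])
        fix y assume y: "y \<in> carrier G"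
        have "p y * \<kappa> (inv y \<otimes> x) - (\<Sum>a\<in>F. \<kappa> (inv a \<otimes> x) * pa a y)
            = (\<Sum>a\<in>F. pa a y) * \<kappa> (inv y \<otimes> x) - (\<Sum>a\<in>F. \<kappa> (inv a \<otimes> x) * pa a y)"
          by (simp only: sum_pa(2)[OF y])
        also have "\<dots> = (\<Sum>a\<in>F. pa a y * (\<kappa> (inv y \<otimes> x) - \<kappa> (inv a \<otimes> x)))"
          by (simp add: sum_distrib_right sum_subtractf algebra_simps)
        also have "\<bar>\<dots>\<bar> \<le> (\<Sum>a\<in>F. \<bar>pa a y * (\<kappa> (inv y \<otimes> x) - \<kappa> (inv a \<otimes> x))\<bar>)" by (rule sum_abs)
        also have "\<dots> \<le> (\<Sum>a\<in>F. \<bar>pa a y\<bar> * e)"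
        proof (rule sum_mono)
          fix a assume "a \<in> F"
          then show "\<bar>pa a y * (\<kappa> (inv y \<otimes> x) - \<kappa> (inv a \<otimes> x))\<bar> \<le> \<bar>pa a y\<bar> * e"
            using near[OF _ y x] by (cases "pa a y = 0") (auto simp: abs_mult intro!: mult_left_mono)
        qed
        also have "\<dots> = e * \<bar>p y\<bar>" unfolding sum_distrib_right[symmetric] sum_pa(1)[OF y] by simp
        finally show "\<bar>p y * \<kappa> (inv y \<otimes> x) - (\<Sum>a\<in>F. \<kappa> (inv a \<otimes> x) * pa a y)\<bar> \<le> e * \<bar>p y\<bar>" .
      qed
      also have "\<dots> = e * P" unfolding P_def by (rule I_scale[OF Cc_abs[OF p]])
      finally have "\<bar>conv p \<kappa> x - (\<Sum>a\<in>F. I (pa a) * \<kappa> (inv a \<otimes> x))\<bar> * \<bar>q x\<bar> \<le> (e * P) * \<bar>q x\<bar>"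
        by (rule mult_right_mono) simp
      moreover have "conv p \<kappa> x * q x - (\<Sum>a\<in>F. I (pa a) * (\<kappa> (inv a \<otimes> x) * q x))
          = (conv p \<kappa> x - (\<Sum>a\<in>F. I (pa a) * \<kappa> (inv a \<otimes> x))) * q x"
        by (simp add: left_diff_distrib sum_distrib_right mult.assoc)
      ultimately show "\<bar>conv p \<kappa> x * q x - (\<Sum>a\<in>F. I (pa a) * (\<kappa> (inv a \<otimes> x) * q x))\<bar> \<le> (e * P) * \<bar>q x\<bar>"
        by (simp add: abs_mult)
    qed
    then have "\<bar>L - S\<bar> \<le> e * P * Q"
      unfolding SL L_def Q_def I_diff[OF Ccp sumL] I_scale[OF Cc_abs[OF q]] .
    moreover have "\<bar>I (\<lambda>y. p y * conv q \<kappa> y - (\<Sum>a\<in>F. conv q \<kappa> a * pa a y))\<bar> \<le> I (\<lambda>y. (e * Q) * \<bar>p y\<bar>)"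
    proof (rule I_abs_le[OF Cc_diff[OF Ccq sumR] Cc_scale[OF Cc_abs[OF p]]])
      fix y assume y: "y \<in> carrier G"
      have close: "\<bar>conv q \<kappa> y - conv q \<kappa> a\<bar> \<le> e * Q" if a: "a \<in> F" and nz: "pa a y \<noteq> 0" for a
        unfolding Q_def
      proof (rule conv_diff_le[OF q \<kappa> Fc[OF a] y])
        fix x assume x: "x \<in> carrier G"
        have "\<kappa> (inv x \<otimes> y) = \<kappa> (inv y \<otimes> x)" "\<kappa> (inv x \<otimes> a) = \<kappa> (inv a \<otimes> x)"
          using sym[of "inv y \<otimes> x"] sym[of "inv a \<otimes> x"] Fc[OF a] x y by (auto simp: inv_mult_group)
        then show "\<bar>\<kappa> (inv x \<otimes> y) - \<kappa> (inv x \<otimes> a)\<bar> \<le> e" using near[OF a y x nz] by simp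
      qed (use e in simp)
      have "p y * conv q \<kappa> y - (\<Sum>a\<in>F. conv q \<kappa> a * pa a y)
          = (\<Sum>a\<in>F. pa a y) * conv q \<kappa> y - (\<Sum>a\<in>F. conv q \<kappa> a * pa a y)"
        by (simp only: sum_pa(2)[OF y])
      also have "\<dots> = (\<Sum>a\<in>F. pa a y * (conv q \<kappa> y - conv q \<kappa> a))"
        by (simp add: sum_distrib_right sum_subtractf algebra_simps)
      also have "\<bar>\<dots>\<bar> \<le> (\<Sum>a\<in>F. \<bar>pa a y * (conv q \<kappa> y - conv q \<kappa> a)\<bar>)" by (rule sum_abs)
      also have "\<dots> \<le> (\<Sum>a\<in>F. \<bar>pa a y\<bar> * (e * Q))"
      proof (rule sum_mono)
        fix a assume "a \<in> F"
        then show "\<bar>pa a y * (conv q \<kappa> y - conv q \<kappa> a)\<bar> \<le> \<bar>pa a y\<bar> * (e * Q)"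
          using close by (cases "pa a y = 0") (auto simp: abs_mult intro!: mult_left_mono)
      qed
      also have "\<dots> = (e * Q) * \<bar>p y\<bar>" unfolding sum_distrib_right[symmetric] sum_pa(1)[OF y] by simp
      finally show "\<bar>p y * conv q \<kappa> y - (\<Sum>a\<in>F. conv q \<kappa> a * pa a y)\<bar> \<le> (e * Q) * \<bar>p y\<bar>" .
    qed
    then have "\<bar>R - S\<bar> \<le> e * Q * P"
      unfolding SR R_def P_def I_diff[OF Ccq sumR] I_scale[OF Cc_abs[OF p]] .
    moreover have "e * Q * P = e * P * Q" by simp
    ultimately show ?thesis by linarith
  qed
  have "\<bar>L - R\<bar> \<le> 0"
  proof (rule field_le_epsilon)
    fix e :: real assume e: "0 < e"
    define e' where "e' = e / (2 * (P * Q + 1))"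
    have pq: "0 < P * Q + 1" using PQ by (simp add: add_nonneg_pos)
    have e': "0 < e'" unfolding e'_def using pq e by simp
    have "2 * (e' * P * Q) \<le> 2 * (e' * (P * Q + 1))" using e' by (simp add: algebra_simps)
    also have "\<dots> = e" unfolding e'_def using pq by (simp add: field_simps)
    finally show "\<bar>L - R\<bar> \<le> 0 + e" using bound[OF e'] by linarith
  qed
  then show ?thesis unfolding L_def R_def by simp
qed

end

section \<open>The weighted convolution operator and its eigenfunctions\<close>

locale haar_kernel = haar_group +
  fixes w \<kappa> :: "'a \<Rightarrow> real"
  assumes w_Cc: "w \<in> Cc" and w_nonneg: "\<And>x. x \<in> carrier G \<Longrightarrow> 0 \<le> w x" and w_one: "0 < w \<one>"
    and kernel_Cc: "\<kappa> \<in> Cc" and kernel_nonneg: "\<And>x. x \<in> carrier G \<Longrightarrow> 0 \<le> \<kappa> x"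
    and kernel_le: "\<And>x. x \<in> carrier G \<Longrightarrow> \<kappa> x \<le> 1"
    and kernel_sym: "\<And>x. x \<in> carrier G \<Longrightarrow> \<kappa> (inv x) = \<kappa> x"
begin

text \<open>An integral operator on L2 of the measure with density \<open>w\<close>, whose inner
  product is \<open>ip\<close>. The weight sits inside the convolution, so that symmetry of
  \<open>\<kappa>\<close> makes \<open>L\<close> self-adjoint for \<open>ip\<close>.\<close>

definition L :: "('a \<Rightarrow> real) \<Rightarrow> 'a \<Rightarrow> real" where
  "L f = conv (\<lambda>y. f y * w y) \<kappa>"

definition ip :: "('a \<Rightarrow> real) \<Rightarrow> ('a \<Rightarrow> real) \<Rightarrow> real" where
  "ip f g = I (\<lambda>x. f x * g x * w x)"

text \<open>The L1 norm for the weight, a stepping stone: it is controlled by the L2 norm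
  (\<open>wnorm_ip\<close>) and controls \<open>L f\<close> uniformly (\<open>L_le\<close>).\<close>

definition wnorm :: "('a \<Rightarrow> real) \<Rightarrow> real" where
  "wnorm f = I (\<lambda>y. \<bar>f y * w y\<bar>)"

definition wsupp :: "'a set" where
  "wsupp = {x \<in> carrier G. w x \<noteq> 0}"

definition mass :: real where
  "mass = I w"

lemma mass_pos: "0 < mass"
  unfolding mass_def by (rule I_pos[OF w_Cc w_nonneg w_one])

lemma weighted_Cc: "cont f \<Longrightarrow> (\<lambda>y. f y * w y) \<in> Cc"
  by (rule Cc_mult[OF _ w_Cc])

lemma L_cont: "cont f \<Longrightarrow> cont (L f)"
  unfolding L_def by (rule right_uc_cont[OF conv_right_uc[OF weighted_Cc kernel_Cc]])

lemma L_le: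
  assumes "cont f" "x \<in> carrier G"
  shows "\<bar>L f x\<bar> \<le> wnorm f"
  unfolding L_def conv_def wnorm_def
proof (rule I_abs_le[OF conv_Cc[OF weighted_Cc[OF assms(1)] kernel_Cc assms(2)] Cc_abs[OF weighted_Cc[OF assms(1)]]])
  fix y assume y: "y \<in> carrier G"
  have "\<bar>\<kappa> (inv y \<otimes> x)\<bar> \<le> 1" using kernel_nonneg[of "inv y \<otimes> x"] kernel_le[of "inv y \<otimes> x"] y assms(2) by simp
  then have "\<bar>f y * w y\<bar> * \<bar>\<kappa> (inv y \<otimes> x)\<bar> \<le> \<bar>f y * w y\<bar> * 1" by (rule mult_left_mono) simp
  then show "\<bar>f y * w y * \<kappa> (inv y \<otimes> x)\<bar> \<le> \<bar>f y * w y\<bar>" by (simp add: abs_mult)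
qed

text \<open>The modulus of continuity comes from the kernel alone, so \<open>L\<close> sends sets
  bounded in \<open>wnorm\<close> to equicontinuous ones. This is the form in which compactness of
  \<open>L\<close> is used.\<close>

lemma L_diff_le:
  assumes "cont f" "x \<in> carrier G" "x' \<in> carrier G" "0 \<le> \<epsilon>"
    and "\<And>y. y \<in> wsupp \<Longrightarrow> \<bar>\<kappa> (inv y \<otimes> x') - \<kappa> (inv y \<otimes> x)\<bar> \<le> \<epsilon>"
  shows "\<bar>L f x' - L f x\<bar> \<le> \<epsilon> * wnorm f"
  unfolding L_def wnorm_def
  by (rule conv_diff_le[OF weighted_Cc[OF assms(1)] kernel_Cc assms(2-4)]) (auto intro!: assms(5) simp: wsupp_def)

lemma L_cong:
  assumes "cont f" "\<And>y. y \<in> carrier G \<Longrightarrow> f y * w y = g y * w y" "x \<in> carrier G"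
  shows "L f x = L g x"
  unfolding L_def conv_def
  by (rule I_cong[OF conv_Cc[OF weighted_Cc[OF assms(1)] kernel_Cc assms(3)]]) (simp add: assms(2))

lemma L_diff:
  assumes "cont f" "cont g" "x \<in> carrier G"
  shows "L (\<lambda>y. f y - g y) x = L f x - L g x"
  unfolding L_def
  using conv_diff[OF weighted_Cc[OF assms(1)] weighted_Cc[OF assms(2)] kernel_Cc assms(3)]
  by (simp add: left_diff_distrib)

lemma L_scale:
  assumes "cont f" "x \<in> carrier G"
  shows "L (\<lambda>y. c * f y) x = c * L f x"
  unfolding L_def conv_def
  using I_scale[OF conv_Cc[OF weighted_Cc[OF assms(1)] kernel_Cc assms(2)], of c]
  by (simp add: mult.assoc)

lemma cont_scale: "cont f \<Longrightarrow> cont (\<lambda>x. c * f x)"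
  by (rule continuous_map_real_mult_left)

lemma cont_diff: "cont f \<Longrightarrow> cont g \<Longrightarrow> cont (\<lambda>x. f x - g x)"
  by (rule continuous_map_diff)

lemma wnorm_le_sup:
  assumes "cont f" "\<And>x. x \<in> wsupp \<Longrightarrow> \<bar>f x\<bar> \<le> m"
  shows "wnorm f \<le> m * mass"
proof -
  have "wnorm f \<le> I (\<lambda>x. m * w x)"
    unfolding wnorm_def
  proof (rule I_mono[OF Cc_abs[OF weighted_Cc[OF assms(1)]] Cc_scale[OF w_Cc]])
    fix x assume x: "x \<in> carrier G"
    show "\<bar>f x * w x\<bar> \<le> m * w x"
      using w_nonneg[OF x] assms(2)[of x] x unfolding wsupp_def
      by (cases "w x = 0") (auto simp: abs_mult intro!: mult_right_mono)
  qed
  then show ?thesis unfolding mass_def I_scale[OF w_Cc] .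
qed

lemma ip_Cc: "cont f \<Longrightarrow> cont g \<Longrightarrow> (\<lambda>x. f x * g x * w x) \<in> Cc"
  by (rule Cc_mult[OF continuous_map_real_mult w_Cc])

lemma ip_commute: "ip f g = ip g f"
  unfolding ip_def by (simp add: mult.commute)

lemma ip_scale: "cont f \<Longrightarrow> cont g \<Longrightarrow> ip (\<lambda>x. c * f x) g = c * ip f g"
  unfolding ip_def using I_scale[OF ip_Cc, of f g c] by (simp add: mult.assoc)

lemma ip_diff: "cont f \<Longrightarrow> cont f' \<Longrightarrow> cont g \<Longrightarrow> ip (\<lambda>x. f x - f' x) g = ip f g - ip f' g"
  unfolding ip_def using I_diff[OF ip_Cc ip_Cc, of f g f' g] by (simp add: left_diff_distrib)

lemma ip_cong:
  assumes "cont f" "cont g" "\<And>x. x \<in> carrier G \<Longrightarrow> f x = f' x" "\<And>x. x \<in> carrier G \<Longrightarrow> g x = g' x"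
  shows "ip f g = ip f' g'"
  unfolding ip_def by (rule I_cong[OF ip_Cc[OF assms(1,2)]]) (simp add: assms(3,4))

lemma ip_nonneg: "cont f \<Longrightarrow> 0 \<le> ip f f"
  unfolding ip_def by (rule I_nonneg[OF ip_Cc]) (auto simp: w_nonneg)

lemma ip_pos:
  assumes "cont f" "f \<one> \<noteq> 0"
  shows "0 < ip f f"
  unfolding ip_def
proof (rule I_pos[OF ip_Cc[OF assms(1,1)]])
  have "0 < (f \<one>)\<^sup>2" using assms(2) by simp
  then show "0 < f \<one> * f \<one> * w \<one>" using w_one by (simp add: power2_eq_square)
qed (auto simp: w_nonneg)

lemma ip_minus_scale:
  assumes f: "cont f" and g: "cont g"
  shows "ip (\<lambda>x. f x - t * g x) (\<lambda>x. f x - t * g x) = ip f f - 2 * t * ip f g + t\<^sup>2 * ip g g"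
proof -
  note tg = cont_scale[OF g, of t]
  note d = cont_diff[OF f tg]
  have "ip (\<lambda>x. f x - t * g x) (\<lambda>x. f x - t * g x) = ip f (\<lambda>x. f x - t * g x) - t * ip g (\<lambda>x. f x - t * g x)"
    using ip_diff[OF f tg d] ip_scale[OF g d, of t] by simp
  also have "ip f (\<lambda>x. f x - t * g x) = ip f f - t * ip g f"
    using ip_commute[of f "\<lambda>x. f x - t * g x"] ip_diff[OF f tg f] ip_scale[OF g f, of t] by simp
  also have "ip g (\<lambda>x. f x - t * g x) = ip f g - t * ip g g"
    using ip_commute[of g "\<lambda>x. f x - t * g x"] ip_diff[OF f tg g] ip_scale[OF g g, of t] by simp
  finally show ?thesis using ip_commute[of f g] by (simp add: algebra_simps power2_eq_square)
qed

lemma ip_Cauchy_Schwarz: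
  assumes f: "cont f" and g: "cont g"
  shows "(ip f g)\<^sup>2 \<le> ip f f * ip g g"
proof -
  have *: "0 \<le> ip f f - 2 * t * ip f g + t\<^sup>2 * ip g g" for t
    using ip_nonneg[OF cont_diff[OF f cont_scale[OF g, of t]]] unfolding ip_minus_scale[OF f g] .
  show ?thesis
  proof (cases "ip g g = 0")
    case True
    have "ip f g = 0"
    proof (rule ccontr)
      assume "ip f g \<noteq> 0"
      \<comment> \<open>With \<open>ip g g = 0\<close> the quadratic is linear in \<open>t\<close>,
        and this \<open>t\<close> gives it the value -1.\<close>
      then show False using *[of "(ip f f + 1) / (2 * ip f g)"] True by (simp add: field_simps)
    qed
    then show ?thesis using True by simp
  next
    case False
    then have pos: "0 < ip g g" using ip_nonneg[OF g] by simp
    have "0 \<le> ip f f - (ip f g)\<^sup>2 / ip g g"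
      using *[of "ip f g / ip g g"] pos by (simp add: power2_eq_square field_simps)
    then show ?thesis using pos by (simp add: field_simps)
  qed
qed

lemma wnorm_ip:
  assumes f: "cont f"
  shows "(wnorm f)\<^sup>2 \<le> mass * ip f f"
proof -
  have a: "cont (\<lambda>x. \<bar>f x\<bar>)" by (rule continuous_map_real_abs[OF f])
  have one: "cont (\<lambda>x. 1)" by simp
  have "wnorm f = ip (\<lambda>x. \<bar>f x\<bar>) (\<lambda>x. 1)"
    unfolding wnorm_def ip_def
    by (rule I_cong[OF Cc_abs[OF weighted_Cc[OF f]]]) (simp add: abs_mult w_nonneg)
  then show ?thesis
    using ip_Cauchy_Schwarz[OF a one] unfolding ip_def mass_def by (simp add: mult.commute)
qed

lemma L_selfadjoint:
  assumes f: "cont f" and g: "cont g"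
  shows "ip (L f) g = ip f (L g)"
  unfolding ip_def L_def
  using conv_selfadjoint[OF weighted_Cc[OF f] weighted_Cc[OF g] kernel_Cc kernel_sym]
  by (simp add: mult.assoc mult.commute mult.left_commute)

lemma ip_L_le:
  assumes f: "cont f"
  shows "ip (L f) (L f) \<le> mass\<^sup>2 * ip f f"
proof -
  have "ip (L f) (L f) \<le> I (\<lambda>x. (wnorm f)\<^sup>2 * w x)"
    unfolding ip_def
  proof (rule I_mono[OF ip_Cc[OF L_cont[OF f] L_cont[OF f]] Cc_scale[OF w_Cc]])
    fix x assume x: "x \<in> carrier G"
    have "L f x * L f x \<le> (wnorm f)\<^sup>2"
      using L_le[OF f x] unfolding power2_eq_square by (metis abs_le_square_iff abs_of_nonneg abs_ge_zero order_trans power2_eq_square)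
    then show "L f x * L f x * w x \<le> (wnorm f)\<^sup>2 * w x" using w_nonneg[OF x] by (rule mult_right_mono)
  qed
  also have "\<dots> = (wnorm f)\<^sup>2 * mass" unfolding mass_def by (rule I_scale[OF w_Cc])
  also have "\<dots> \<le> (mass * ip f f) * mass" using wnorm_ip[OF f] mass_pos by (intro mult_right_mono) auto
  finally show ?thesis by (simp add: power2_eq_square mult.commute mult.left_commute)
qed

text \<open>Power iteration: the quotients \<open>A (k + 1) / A k\<close> with \<open>A k = \<parallel>F k\<parallel>\<^sup>2\<close> increase to some \<open>s\<close>, and the
  normalised iterates, being equicontinuous, accumulate at an eigenfunction of \<open>L\<^sup>2\<close> with eigenvalue \<open>s\<close>.\<close>

lemma power_iteration:
  assumes F: "\<And>k. cont (F k)" "\<And>k x. x \<in> carrier G \<Longrightarrow> L (F k) x = F (Suc k) x" "F (Suc 0) \<one> \<noteq> 0"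
  obtains s g M \<rho> where "0 < s" "cont g" "\<And>x. x \<in> carrier G \<Longrightarrow> \<bar>g x\<bar> \<le> M"
    "\<And>x. x \<in> carrier G \<Longrightarrow> L (L g) x = s * g x" "0 < (\<rho>::real)"
    "\<And>\<epsilon>. 0 < \<epsilon> \<Longrightarrow> \<exists>k c. (\<forall>x\<in>wsupp. \<bar>c * F k x - g x\<bar> \<le> \<epsilon> \<and> \<bar>c * F k x\<bar> \<le> M) \<and>
       \<rho> \<le> ip (\<lambda>x. c * F k x) (\<lambda>x. c * F k x)"
proof -
  define A where "A = (\<lambda>k. ip (F k) (F k))"
  \<comment> \<open>By self-adjointness the inner product of two iterates depends only on the sum of
    their indices; with Cauchy-Schwarz this makes \<open>A\<close> log-convex and the ratios
    \<open>r\<close> increasing.\<close>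
  have shift: "ip (F (Suc k)) (F j) = ip (F k) (F (Suc j))" for k j
  proof -
    have "ip (F (Suc k)) (F j) = ip (L (F k)) (F j)"
      by (rule ip_cong[symmetric]) (use F L_cont in auto)
    also have "\<dots> = ip (F k) (L (F j))" by (rule L_selfadjoint[OF F(1) F(1)])
    also have "\<dots> = ip (F k) (F (Suc j))"
      by (rule ip_cong) (use F L_cont in auto)
    finally show ?thesis .
  qed
  have logconv: "(A (Suc k))\<^sup>2 \<le> A k * A (Suc (Suc k))" for k
    unfolding A_def shift[of k] by (rule ip_Cauchy_Schwarz[OF F(1) F(1)])
  have A0: "0 \<le> A k" for k unfolding A_def by (rule ip_nonneg[OF F(1)])
  have A1: "0 < A (Suc 0)" unfolding A_def by (rule ip_pos[OF F(1) F(3)])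
  have ASuc: "0 < A (Suc k)" for k
  proof (induction k)
    case (Suc k)
    then have "0 < A k * A (Suc (Suc k))" using logconv[of k] by (meson less_le_trans zero_less_power)
    then show ?case using A0[of k] A0[of "Suc (Suc k)"] by (auto simp: zero_less_mult_iff)
  qed (rule A1)
  have Apos: "0 < A k" for k
  proof (cases k)
    case 0
    have "0 < A 0 * A (Suc (Suc 0))" using logconv[of 0] A1 by (meson less_le_trans zero_less_power)
    then show ?thesis using A0[of 0] A0[of "Suc (Suc 0)"] 0 by (auto simp: zero_less_mult_iff)
  qed (use ASuc in simp)
  define r where "r = (\<lambda>k. A (Suc k) / A k)"
  have rpos: "0 < r k" for k unfolding r_def using Apos by simp
  have "r k \<le> r (Suc k)" for k
    unfolding r_def using logconv[of k] Apos[of k] Apos[of "Suc k"]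
    by (simp add: field_simps power2_eq_square)
  then have inc: "incseq r" by (rule incseq_SucI)
  have rbd: "r k \<le> mass\<^sup>2" for k
  proof -
    have "A (Suc k) = ip (L (F k)) (L (F k))"
      unfolding A_def by (rule ip_cong[symmetric]) (use F L_cont in auto)
    also have "\<dots> \<le> mass\<^sup>2 * A k" unfolding A_def by (rule ip_L_le[OF F(1)])
    finally show ?thesis unfolding r_def using Apos[of k] by (simp add: field_simps)
  qed
  obtain s where s: "r \<longlonglongrightarrow> s" "\<And>k. r k \<le> s" using incseq_convergent[OF inc] rbd by metis
  have spos: "0 < s" using rpos[of 0] s(2)[of 0] by linarith
  define c where "c = (\<lambda>k. 1 / sqrt (A k))"
  have cA: "(c k)\<^sup>2 * A k = 1" for k unfolding c_def using Apos[of k] by (simp add: power_divide)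
  \<comment> \<open>The index \<open>Suc k\<close> against the normalisation by \<open>A k\<close>
    exhibits \<open>gk k\<close> as \<open>L\<close> of a unit vector, whence bounds and
    equicontinuity uniform in \<open>k\<close>.\<close>
  define gk where "gk = (\<lambda>k x. c k * F (Suc k) x)"
  have gkC: "cont (gk k)" for k unfolding gk_def by (rule cont_scale[OF F(1)])
  define M where "M = sqrt mass"
  have M: "0 < M" unfolding M_def using mass_pos by simp
  have cF: "cont (\<lambda>x. c k * F j x)" for k j by (rule cont_scale[OF F(1)])
  have ipc: "ip (\<lambda>x. c k * F j x) (\<lambda>x. c k * F j x) = (c k)\<^sup>2 * A j" for k j
    unfolding A_def
    using ip_scale[OF F(1) cF, of "c k" j k j] ip_scale[OF F(1) F(1), of "c k" j j] ip_commute[of "F j" "\<lambda>x. c k * F j x"]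
    by (simp add: power2_eq_square)
  have NG: "wnorm (\<lambda>x. c k * F k x) \<le> M" for k
  proof -
    have "(wnorm (\<lambda>x. c k * F k x))\<^sup>2 \<le> mass" using wnorm_ip[OF cF, of k k] ipc[of k k] cA[of k] by simp
    then show ?thesis unfolding M_def by (rule real_le_rsqrt)
  qed
  have gkL: "gk k x = L (\<lambda>x. c k * F k x) x" if "x \<in> carrier G" for k x
    unfolding gk_def using L_scale[OF F(1) that] F(2)[OF that] by simp
  have gk_le: "\<bar>gk k x\<bar> \<le> M" if x: "x \<in> carrier G" for k x
    unfolding gkL[OF x] using L_le[OF cF x, of k k] NG[of k] by linarith
  have equi: "\<exists>V. nb V \<and> (\<forall>k. \<forall>x\<in>carrier G. \<forall>v\<in>V. \<bar>gk k (x \<otimes> v) - gk k x\<bar> \<le> e)" if e: "0 < e" for e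
  proof -
    obtain V where V: "nb V" "\<And>x v. x \<in> carrier G \<Longrightarrow> v \<in> V \<Longrightarrow> \<bar>\<kappa> (x \<otimes> v) - \<kappa> x\<bar> < e / M"
      using right_ucD[OF Cc_right_uc[OF kernel_Cc], of "e / M"] e M by (metis zero_less_divide_iff)
    have "\<bar>gk k (x \<otimes> v) - gk k x\<bar> \<le> e" if x: "x \<in> carrier G" and v: "v \<in> V" for k x v
    proof -
      have vc: "v \<in> carrier G" using V(1) v nb_in_carrier by blast
      have "\<bar>L (\<lambda>x. c k * F k x) (x \<otimes> v) - L (\<lambda>x. c k * F k x) x\<bar> \<le> (e / M) * wnorm (\<lambda>x. c k * F k x)"
      proof (rule L_diff_le[OF cF x])
        fix y assume "y \<in> wsupp"
        then have "y \<in> carrier G" unfolding wsupp_def by simp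
        then show "\<bar>\<kappa> (inv y \<otimes> (x \<otimes> v)) - \<kappa> (inv y \<otimes> x)\<bar> \<le> e / M"
          using V(2)[of "inv y \<otimes> x" v] x v vc by (simp add: m_assoc)
      qed (use x vc e M in auto)
      also have "\<dots> \<le> (e / M) * M" using NG e M by (intro mult_left_mono) auto
      finally show ?thesis using gkL x vc M by simp
    qed
    then show ?thesis using V(1) by blast
  qed
  have "sequentially \<noteq> bot" by simp
  \<comment> \<open>An ultrafilter on the indices gives limits at all points simultaneously, without
    choosing subsequences.\<close>
  then obtain U where U: "U \<le> sequentially" "ultrafilter U" using ultrafilter_below by blast
  have ntU: "U \<noteq> bot" using U(2) ultrafilter_not_bot by blast
  define g where "g = (\<lambda>x. Lim U (\<lambda>k. gk k x))"
  have glim: "((\<lambda>k. gk k x) \<longlongrightarrow> g x) U" if x: "x \<in> carrier G" for x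
  proof -
    have ev: "eventually (\<lambda>k. - M \<le> gk k x \<and> gk k x \<le> M) U"
      using gk_le[OF x] by (intro always_eventually allI) (simp add: abs_le_iff minus_le_iff)
    obtain l where "((\<lambda>k. gk k x) \<longlongrightarrow> l) U" using ultrafilter_real_limit[OF U(2) ev] by blast
    then show ?thesis unfolding g_def using tendsto_Lim[OF ntU] by metis
  qed
  have g_le: "\<bar>g x\<bar> \<le> M" if x: "x \<in> carrier G" for x
    by (rule tendsto_upperbound[OF tendsto_rabs[OF glim[OF x]] always_eventually ntU]) (use gk_le[OF x] in blast)
  have gequi: "\<bar>g (x \<otimes> v) - g x\<bar> \<le> e"
    if "\<forall>k. \<bar>gk k (x \<otimes> v) - gk k x\<bar> \<le> e" "x \<in> carrier G" "x \<otimes> v \<in> carrier G" for e x v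
    by (rule tendsto_upperbound[OF tendsto_rabs[OF tendsto_diff[OF glim[OF that(3)] glim[OF that(2)]]] always_eventually[OF that(1)] ntU])
  have "right_uc g"
    unfolding right_uc_def
  proof (intro allI impI)
    fix e :: real assume e: "0 < e"
    then obtain V where V: "nb V" "\<forall>k. \<forall>x\<in>carrier G. \<forall>v\<in>V. \<bar>gk k (x \<otimes> v) - gk k x\<bar> \<le> e / 2"
      using equi[of "e / 2"] by auto
    have "\<bar>g (x \<otimes> v) - g x\<bar> < e" if "x \<in> carrier G" "v \<in> V" for x v
      using gequi[of x v "e / 2"] V nb_in_carrier[OF V(1)] that e by fastforce
    then show "\<exists>V. nb V \<and> (\<forall>x\<in>carrier G. \<forall>v\<in>V. \<bar>g (x \<otimes> v) - g x\<bar> < e)" using V(1) by blast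
  qed
  then have gC: "cont g" by (rule right_uc_cont)
  obtain K where K: "compactin T K" "\<And>x. x \<in> carrier G \<Longrightarrow> x \<notin> K \<Longrightarrow> w x = 0" using Cc_support[OF w_Cc] by blast
  have SK: "wsupp \<subseteq> K" using K(2) unfolding wsupp_def by blast
  \<comment> \<open>Pointwise convergence on a finite net plus the common modulus of continuity, as
    in the Arzela-Ascoli theorem. Uniformity on \<open>wsupp\<close> is enough because
    \<open>L\<close> sees nothing else.\<close>
  have unif: "eventually (\<lambda>k. \<forall>x\<in>wsupp. \<bar>gk k x - g x\<bar> \<le> e) U" if e: "0 < e" for e
  proof -
    obtain V where V: "nb V" "\<forall>k. \<forall>x\<in>carrier G. \<forall>v\<in>V. \<bar>gk k (x \<otimes> v) - gk k x\<bar> \<le> e / 3"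
      using equi[of "e / 3"] e by auto
    obtain P where P: "finite P" "P \<subseteq> K" "\<And>x. x \<in> K \<Longrightarrow> \<exists>a\<in>P. inv a \<otimes> x \<in> V"
      using compact_cover_translates[OF K(1) V(1)] by metis
    have Pc: "a \<in> carrier G" if "a \<in> P" for a using that P(2) compact_carrier[OF K(1)] by blast
    have "eventually (\<lambda>k. \<forall>a\<in>P. \<bar>gk k a - g a\<bar> < e / 3) U"
    proof (rule eventually_ball_finite[OF P(1)], intro ballI)
      fix a assume "a \<in> P"
      then have "eventually (\<lambda>k. dist (gk k a) (g a) < e / 3) U"
        using glim[OF Pc] e by (intro tendstoD) auto
      then show "eventually (\<lambda>k. \<bar>gk k a - g a\<bar> < e / 3) U" by (simp add: dist_real_def)
    qed
    then show ?thesis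
    proof eventually_elim
      case (elim k)
      show ?case
      proof
        fix x assume x: "x \<in> wsupp"
        then have xc: "x \<in> carrier G" unfolding wsupp_def by simp
        obtain a where a: "a \<in> P" "inv a \<otimes> x \<in> V" using P(3) x SK by blast
        have ax: "a \<otimes> (inv a \<otimes> x) = x" using Pc[OF a(1)] xc by simp
        have 1: "\<forall>k. \<bar>gk k (a \<otimes> (inv a \<otimes> x)) - gk k a\<bar> \<le> e / 3" using V(2) Pc[OF a(1)] a(2) by blast
        have "\<bar>gk k x - gk k a\<bar> \<le> e / 3" using 1 unfolding ax by blast
        moreover have "\<bar>g x - g a\<bar> \<le> e / 3" using gequi[OF 1 Pc[OF a(1)]] xc unfolding ax by blast
        moreover have "\<bar>gk k a - g a\<bar> < e / 3" using elim a(1) by blast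
        ultimately show "\<bar>gk k x - g x\<bar> \<le> e" by linarith
      qed
    qed
  qed
  have eig: "L (L g) x = s * g x" if x: "x \<in> carrier G" for x
  proof -
    have 1: "((\<lambda>k. L (L (gk k)) x) \<longlongrightarrow> L (L g) x) U"
    proof (rule tendstoI)
      fix e :: real assume e: "0 < e"
      define e' where "e' = e / (2 * mass\<^sup>2)"
      have e': "0 < e'" unfolding e'_def using e mass_pos by simp
      show "eventually (\<lambda>k. dist (L (L (gk k)) x) (L (L g) x) < e) U"
        using unif[OF e']
      proof eventually_elim
        case (elim k)
        define D where "D = (\<lambda>y. gk k y - g y)"
        have D: "cont D" unfolding D_def by (rule cont_diff[OF gkC gC])
        have "L (L D) x = L (\<lambda>y. L (gk k) y - L g y) x"
          by (rule L_cong[OF L_cont[OF D] _ x]) (simp add: D_def L_diff[OF gkC gC])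
        then have eq: "L (L D) x = L (L (gk k)) x - L (L g) x"
          using L_diff[OF L_cont[OF gkC] L_cont[OF gC] x] by simp
        have "wnorm D \<le> e' * mass" by (rule wnorm_le_sup[OF D]) (use elim D_def in auto)
        then have "\<bar>L D y\<bar> \<le> e' * mass" if "y \<in> wsupp" for y
          using L_le[OF D, of y] that unfolding wsupp_def by auto
        then have "wnorm (L D) \<le> (e' * mass) * mass" by (rule wnorm_le_sup[OF L_cont[OF D]])
        moreover have "(e' * mass) * mass = e / 2" unfolding e'_def using mass_pos by (simp add: power2_eq_square)
        ultimately have "\<bar>L (L D) x\<bar> \<le> e / 2" using L_le[OF L_cont[OF D] x] by linarith
        then show ?case unfolding dist_real_def eq[symmetric] using e by linarith
      qed
    qed
    \<comment> \<open>The difference is \<open>L D\<close> with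
      \<open>ip D D = r (Suc k) * r k - 2 * s * r k + s\<^sup>2\<close>, which tends to
      \<open>s\<^sup>2 - 2 * s\<^sup>2 + s\<^sup>2 = 0\<close>; and \<open>L D\<close> is controlled
      pointwise by the L2 norm of \<open>D\<close>.\<close>
    have 2: "((\<lambda>k. L (L (gk k)) x - s * gk k x) \<longlongrightarrow> 0) U"
    proof (rule tendsto_mono[OF U(1)])
      have "(\<lambda>k. r (Suc k) * r k - 2 * s * r k + s\<^sup>2) \<longlonglongrightarrow> s * s - 2 * s * s + s\<^sup>2"
        by (intro tendsto_intros s(1) LIMSEQ_Suc)
      then have "(\<lambda>k. sqrt (mass * (r (Suc k) * r k - 2 * s * r k + s\<^sup>2))) \<longlonglongrightarrow> sqrt (mass * 0)"
        by (intro tendsto_real_sqrt tendsto_mult_left) (simp add: power2_eq_square)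
      then have lim0: "(\<lambda>k. sqrt (mass * (r (Suc k) * r k - 2 * s * r k + s\<^sup>2))) \<longlonglongrightarrow> 0" by simp
      show "(\<lambda>k. L (L (gk k)) x - s * gk k x) \<longlonglongrightarrow> 0"
      proof (rule Lim_null_comparison[OF always_eventually lim0], intro allI)
        fix k
        define D where "D = (\<lambda>y. c k * F (Suc (Suc k)) y - s * (c k * F k y))"
        have D: "cont D" unfolding D_def by (rule cont_diff[OF cF cont_scale[OF cF]])
        have "L (gk k) y = c k * F (Suc (Suc k)) y" if "y \<in> carrier G" for y
          unfolding gk_def L_scale[OF F(1) that] F(2)[OF that] ..
        then have "L (L (gk k)) x = L (\<lambda>y. c k * F (Suc (Suc k)) y) x"
          by (intro L_cong L_cont gkC x) simp
        then have "L (L (gk k)) x - s * gk k x = L D x"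
          unfolding D_def L_diff[OF cF cont_scale[OF cF] x] L_scale[OF cF x] gkL[OF x] by simp
        moreover have "\<bar>L D x\<bar> \<le> sqrt (mass * (r (Suc k) * r k - 2 * s * r k + s\<^sup>2))"
        proof -
          have "ip (\<lambda>x. c k * F (Suc (Suc k)) x) (\<lambda>x. c k * F k x) = (c k)\<^sup>2 * A (Suc k)"
            unfolding A_def shift[of k "Suc k"]
            using ip_scale[OF F(1) cF, of "c k" "Suc (Suc k)" k k] ip_scale[OF F(1) F(1), of "c k" k "Suc (Suc k)"]
              ip_commute[of "F (Suc (Suc k))" "\<lambda>x. c k * F k x"]
            by (simp add: power2_eq_square)
          then have "ip D D = (c k)\<^sup>2 * A (Suc (Suc k)) - 2 * s * ((c k)\<^sup>2 * A (Suc k)) + s\<^sup>2 * ((c k)\<^sup>2 * A k)"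
            unfolding D_def ip_minus_scale[OF cF cF] ipc by simp
          moreover have c2: "(c k)\<^sup>2 = 1 / A k" using cA[of k] Apos[of k] by (simp add: field_simps)
          ultimately have "ip D D = r (Suc k) * r k - 2 * s * r k + s\<^sup>2"
            unfolding r_def using Apos[of k] Apos[of "Suc k"] by simp
          then have "(wnorm D)\<^sup>2 \<le> mass * (r (Suc k) * r k - 2 * s * r k + s\<^sup>2)" using wnorm_ip[OF D] by simp
          then have "wnorm D \<le> sqrt (mass * (r (Suc k) * r k - 2 * s * r k + s\<^sup>2))" by (rule real_le_rsqrt)
          then show ?thesis using L_le[OF D x] by linarith
        qed
        ultimately show "norm (L (L (gk k)) x - s * gk k x) \<le> sqrt (mass * (r (Suc k) * r k - 2 * s * r k + s\<^sup>2))"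
          by simp
      qed
    qed
    have "((\<lambda>k. L (L (gk k)) x - s * gk k x) \<longlongrightarrow> L (L g) x - s * g x) U"
      by (rule tendsto_diff[OF 1 tendsto_mult_left[OF glim[OF x]]])
    from tendsto_unique[OF ntU this 2] show ?thesis by simp
  qed
  show thesis
  proof (rule that[OF spos gC g_le eig rpos[of 0]])
    fix e :: real assume "0 < e"
    from eventually_happens'[OF ntU unif[OF this]] obtain k where k: "\<forall>x\<in>wsupp. \<bar>gk k x - g x\<bar> \<le> e" by blast
    \<comment> \<open>The squared norm of \<open>gk k\<close> is the ratio \<open>r k\<close>, and
      these increase; hence \<open>r 0\<close> as the value of \<open>\<rho>\<close>, keeping the
      approximants away from 0.\<close>
    have "r 0 \<le> r k" using inc by (simp add: incseq_def)
    also have "\<dots> = ip (gk k) (gk k)"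
      unfolding gk_def ipc r_def using cA[of k] Apos[of k] by (simp add: field_simps)
    finally have "r 0 \<le> ip (\<lambda>x. c k * F (Suc k) x) (\<lambda>x. c k * F (Suc k) x)" unfolding gk_def .
    moreover have "\<forall>x\<in>wsupp. \<bar>c k * F (Suc k) x - g x\<bar> \<le> e \<and> \<bar>c k * F (Suc k) x\<bar> \<le> M"
      using k gk_le unfolding gk_def wsupp_def by blast
    ultimately show "\<exists>k c. (\<forall>x\<in>wsupp. \<bar>c * F k x - g x\<bar> \<le> e \<and> \<bar>c * F k x\<bar> \<le> M) \<and> r 0 \<le> ip (\<lambda>x. c * F k x) (\<lambda>x. c * F k x)"
      by blast
  qed
qed


section \<open>Triviality of the trapped subgroup\<close>

lemma L_ltrans:
  assumes "cont f" "h \<in> carrier G" "\<forall>x\<in>carrier G. w (h \<otimes> x) = w x" "x \<in> carrier G"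
  shows "L f (h \<otimes> x) = L (\<lambda>y. f (h \<otimes> y)) x"
proof -
  have "L f (h \<otimes> x) = conv (\<lambda>y. f (h \<otimes> y) * w (h \<otimes> y)) \<kappa> x"
    unfolding L_def by (rule conv_ltrans[OF weighted_Cc[OF assms(1)] kernel_Cc assms(4,2)])
  also have "\<dots> = L (\<lambda>y. f (h \<otimes> y)) x"
    unfolding L_def conv_def
    by (rule I_cong[OF conv_Cc[OF Cc_ltrans[OF assms(2) weighted_Cc[OF assms(1)]] kernel_Cc assms(4)]])
      (simp add: assms(3))
  finally show ?thesis .
qed

text \<open>Eigenspaces of \<open>L\<^sup>2\<close> are equicontinuous, so \<open>H\<close> acts on them norm-continuously; an element whose
  powers all act within distance \<open>1/2\<close> of the identity acts trivially.\<close>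

lemma eigenfunction_invariant:
  assumes small: small_powers and s: "0 < s" and g: "cont g" "\<And>x. x \<in> carrier G \<Longrightarrow> \<bar>g x\<bar> \<le> M"
    "\<And>x. x \<in> carrier G \<Longrightarrow> L (L g) x = s * g x"
    and H: "subgroup H G" "\<And>h x. h \<in> H \<Longrightarrow> x \<in> carrier G \<Longrightarrow> w (h \<otimes> x) = w x"
    "\<And>W h. nb W \<Longrightarrow> h \<in> H \<Longrightarrow> \<exists>k. h \<in> spow (H \<inter> W) k"
    and h: "h \<in> H" and x: "x \<in> wsupp"
  shows "g (h \<otimes> x) = g x"
proof -
  have Hc: "h \<in> carrier G" if "h \<in> H" for h using H(1) that subgroup.subset by blast
  have SH: "h \<otimes> x \<in> wsupp" if "h \<in> H" "x \<in> wsupp" for h x using H(2) Hc that unfolding wsupp_def by auto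
  have Sc: "wsupp \<subseteq> carrier G" unfolding wsupp_def by auto
  have S1: "\<one> \<in> wsupp" using w_one unfolding wsupp_def by auto
  obtain K where K: "compactin T K" "\<And>x. x \<in> carrier G \<Longrightarrow> x \<notin> K \<Longrightarrow> w x = 0" using Cc_support[OF w_Cc] by blast
  have SK: "wsupp \<subseteq> K" using K(2) unfolding wsupp_def by blast
  \<comment> \<open>A bound \<open>m\<close> on \<open>d\<close> gives
    \<open>wnorm (L d) \<le> m * mass\<^sup>2\<close>. After division by the eigenvalue
    \<open>s\<close>, this \<open>\<epsilon>\<close> leaves exactly \<open>m / 2\<close>.\<close>
  define \<epsilon> where "\<epsilon> = s / (2 * mass\<^sup>2)"
  have eps: "0 < \<epsilon>" unfolding \<epsilon>_def using s mass_pos by simp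
  obtain V0 where V0: "nb V0" "\<And>x v. x \<in> carrier G \<Longrightarrow> v \<in> V0 \<Longrightarrow> \<bar>\<kappa> (v \<otimes> x) - \<kappa> x\<bar> < \<epsilon>"
    using Cc_left_uc[OF kernel_Cc eps] by blast
  obtain V where V: "nb V" "\<And>x v. x \<in> K \<Longrightarrow> v \<in> V \<Longrightarrow> inv x \<otimes> v \<otimes> x \<in> V0"
    using nb_conj_compact[OF K(1) V0(1)] by blast
  obtain W where W: "nb W" "\<And>h i. h \<in> W \<Longrightarrow> h [^] (i::nat) \<in> V"
    using small V(1) unfolding small_powers_def by blast
  have local: "g (h \<otimes> x) = g x" if h: "h \<in> H" "h \<in> W" and x: "x \<in> wsupp" for h x
  proof -
    note hc = Hc[OF h(1)]
    have wh: "\<forall>x\<in>carrier G. w (h \<otimes> x) = w x" using H(2)[OF h(1)] by blast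
    \<comment> \<open>Invariance of \<open>w\<close> makes translation by \<open>h\<close> commute
      with \<open>L\<close>, so \<open>d\<close> is again an eigenfunction and obeys an estimate
      proportional to its own supremum.\<close>
    define d where "d = (\<lambda>x. g (h \<otimes> x) - g x)"
    have gh: "cont (\<lambda>x. g (h \<otimes> x))" by (rule cont_ltrans[OF hc g(1)])
    have d: "cont d" unfolding d_def by (rule cont_diff[OF gh g(1)])
    have Ld: "L d y = L g (h \<otimes> y) - L g y" if y: "y \<in> carrier G" for y
      unfolding d_def L_diff[OF gh g(1) y] L_ltrans[OF g(1) hc wh y] ..
    have LLd: "L (L d) y = s * d y" if y: "y \<in> carrier G" for y
    proof -
      have "L (L d) y = L (\<lambda>y. L g (h \<otimes> y) - L g y) y"
        by (rule L_cong[OF L_cont[OF d] _ y]) (simp add: Ld)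
      also have "\<dots> = L (L g) (h \<otimes> y) - L (L g) y"
        unfolding L_diff[OF cont_ltrans[OF hc L_cont[OF g(1)]] L_cont[OF g(1)] y]
          L_ltrans[OF L_cont[OF g(1)] hc wh y] ..
      finally show ?thesis using g(3) y hc unfolding d_def by (simp add: right_diff_distrib)
    qed
    define m where "m = (SUP x\<in>wsupp. \<bar>d x\<bar>)"
    have d2M: "\<bar>d y\<bar> \<le> 2 * M" if "y \<in> carrier G" for y
      using g(2)[OF that] g(2)[of "h \<otimes> y"] hc that unfolding d_def by auto
    have dm: "\<bar>d y\<bar> \<le> m" if "y \<in> wsupp" for y
      unfolding m_def by (rule cSUP_upper[OF that bdd_aboveI2[of _ _ "2 * M"]]) (use d2M Sc in auto)
    have "wnorm d \<le> m * mass" by (rule wnorm_le_sup[OF d dm])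
    then have "\<bar>L d y\<bar> \<le> m * mass" if "y \<in> wsupp" for y using L_le[OF d, of y] that Sc by force
    then have NLd: "wnorm (L d) \<le> m * mass * mass" by (rule wnorm_le_sup[OF L_cont[OF d]])
    have half: "\<bar>d (v \<otimes> y) - d y\<bar> \<le> m / 2" if v: "v \<in> V" and y: "y \<in> carrier G" for v y
    proof -
      have vc: "v \<in> carrier G" using V(1) v nb_in_carrier by blast
      have "\<bar>L (L d) (v \<otimes> y) - L (L d) y\<bar> \<le> \<epsilon> * wnorm (L d)"
      proof (rule L_diff_le[OF L_cont[OF d] y])
        fix z assume z: "z \<in> wsupp"
        then have zc: "z \<in> carrier G" using Sc by auto
        have "inv z \<otimes> (v \<otimes> y) = (inv z \<otimes> v \<otimes> z) \<otimes> (inv z \<otimes> y)" using zc vc y by (simp add: m_assoc)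
        then show "\<bar>\<kappa> (inv z \<otimes> (v \<otimes> y)) - \<kappa> (inv z \<otimes> y)\<bar> \<le> \<epsilon>"
          using V0(2)[OF _ V(2)[OF _ v], of "inv z \<otimes> y" z] z SK zc y by fastforce
      qed (use vc y eps in auto)
      also have "\<dots> \<le> \<epsilon> * (m * mass * mass)" using NLd eps by (intro mult_left_mono) auto
      also have "\<dots> = s * (m / 2)" unfolding \<epsilon>_def using mass_pos by (simp add: power2_eq_square)
      finally have "s * \<bar>d (v \<otimes> y) - d y\<bar> \<le> s * (m / 2)"
        using LLd y vc s by (simp add: abs_mult flip: right_diff_distrib)
      then show ?thesis using s by simp
    qed
    have "\<bar>d y\<bar> \<le> m / 2" if y: "y \<in> wsupp" for y
    proof -
      have yc: "y \<in> carrier G" using y Sc by auto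
      define a where "a = (\<lambda>i::nat. g (h [^] i \<otimes> y))"
      have st: "h [^] (Suc i) \<otimes> y = h \<otimes> (h [^] i \<otimes> y)" for i :: nat
        using hc yc nat_pow_Suc2[OF hc, of i] by (simp add: m_assoc)
      have da: "a (Suc i) - a i = d (h [^] i \<otimes> y)" for i unfolding a_def d_def st ..
      have d0: "a 1 - a 0 = d y" unfolding a_def d_def using hc yc by simp
      \<comment> \<open>All \<open>h [^] i\<close> lie in \<open>V\<close>, so along the orbit of
        \<open>y\<close> the values of \<open>d\<close> differ from the first by at most
        \<open>m / 2\<close>, while their partial sums, differences of values of \<open>g\<close>,
        stay bounded.\<close>
      have "\<bar>a 1 - a 0\<bar> \<le> m / 2"
      proof (rule bounded_sequence_increment_le)
        show "\<bar>a i\<bar> \<le> M" for i unfolding a_def using g(2) hc yc by simp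
        show "\<bar>(a (Suc i) - a i) - (a 1 - a 0)\<bar> \<le> m / 2" for i
          unfolding da d0 by (rule half[OF W(2)[OF h(2)] yc])
      qed
      then show ?thesis unfolding d0 .
    qed
    then have "m \<le> m / 2" unfolding m_def using S1 by (intro cSUP_least) auto
    then have "\<bar>d x\<bar> \<le> 0" using dm[OF x] by linarith
    then show ?thesis unfolding d_def by simp
  qed
  \<comment> \<open>From elements close to the identity to all of \<open>H\<close>: every
    \<open>h\<close> is a product of elements of \<open>H \<inter> W\<close>, and
    \<open>wsupp\<close> is stable under \<open>H\<close>.\<close>
  have "\<forall>x\<in>wsupp. g (h \<otimes> x) = g x" if "h \<in> spow (H \<inter> W) k" for k h
    using that
  proof (induction k arbitrary: h)
    case 0
    then show ?case using Sc by auto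
  next
    case (Suc k)
    then obtain q z where qz: "q \<in> H \<inter> W" "z \<in> spow (H \<inter> W) k" "h = q \<otimes> z" by (auto elim: set_multE)
    have zH: "z \<in> H"
      using qz(2)
    proof (induction k arbitrary: z)
      case 0
      then show ?case using H(1) subgroup.one_closed by auto
    next
      case (Suc k)
      then show ?case using H(1) subgroup.m_closed by (fastforce elim: set_multE)
    qed
    show ?case
    proof
      fix x assume x: "x \<in> wsupp"
      have "h \<otimes> x = q \<otimes> (z \<otimes> x)" unfolding qz(3) using Hc qz(1) zH x Sc by (intro m_assoc) auto
      then have "g (h \<otimes> x) = g (z \<otimes> x)" using local[of q "z \<otimes> x"] qz(1) SH[OF zH x] by simp
      then show "g (h \<otimes> x) = g x" using Suc.IH[OF qz(2)] x by simp
    qed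
  qed
  then show ?thesis using H(3)[OF W(1) h] x by blast
qed

end

context haar_group begin

text \<open>For \<open>h\<^sub>0 \<in> H\<close> outside the support of the kernel, \<open>F 0 = \<kappa> (h\<^sub>0 \<cdot>) - \<kappa>\<close> is orthogonal to all
  \<open>H\<close>-invariant functions, and so are its iterates and their limit; but the limit is \<open>H\<close>-invariant.\<close>

lemma chain_connected_subgroup_trivial:
  assumes small: small_powers and H: "subgroup H G" "compactin T C" "H \<subseteq> C"
    and chain: "\<And>W h. nb W \<Longrightarrow> h \<in> H \<Longrightarrow> \<exists>k. h \<in> spow (H \<inter> W) k"
  shows "H = {\<one>}"
proof (rule ccontr)
  assume "H \<noteq> {\<one>}"
  then obtain h0 where h0: "h0 \<in> H" "h0 \<noteq> \<one>" using H(1) subgroup.one_closed by blast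
  have Hc: "h \<in> carrier G" if "h \<in> H" for h using H(1) that subgroup.subset by blast
  have "closedin T {h0}"
    by (rule compactin_imp_closedin[OF Hausdorff]) (use Hc[OF h0(1)] in \<open>simp add: topspace_eq_carrier\<close>)
  then have "nb (carrier G - {h0})"
    using h0 by (intro nb_open) (auto simp: closedin_def topspace_eq_carrier)
  \<comment> \<open>With \<open>h0\<close> outside \<open>W1 <#> W1\<close> and \<open>W1\<close>
    symmetric, a kernel supported in \<open>W1\<close> and its translate by \<open>h0\<close> have
    disjoint supports.\<close>
  then obtain W1 where W1: "nb W1" "\<And>x. x \<in> W1 \<Longrightarrow> inv x \<in> W1" "\<And>x y. x \<in> W1 \<Longrightarrow> y \<in> W1 \<Longrightarrow> x \<otimes> y \<in> carrier G - {h0}"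
    using nb_mult_sym by metis
  obtain b where b: "b \<in> Cc" "\<And>x. 0 \<le> b x" "\<And>x. b x \<le> 1" "b \<one> = 1" "\<And>x. x \<notin> W1 \<Longrightarrow> b x = 0"
    using bump_exists[OF W1(1)] by blast
  define \<kappa> where "\<kappa> = (\<lambda>x. b x * b (inv x))"
  \<comment> \<open>A supremum over \<open>H\<close> in place of an average. It is
    \<open>H\<close>-invariant, and it is supported in the compact set \<open>C <#> K\<close>
    because \<open>H \<subseteq> C\<close>.\<close>
  define w where "w = (\<lambda>x. SUP h\<in>H. 1 * b (h \<otimes> x))"
  have b01: "\<forall>x\<in>carrier G. 0 \<le> b x \<and> b x \<le> 1" using b by auto
  have Hne: "H \<noteq> {}" "\<forall>h\<in>H. h \<in> carrier G \<and> 0 \<le> (1::real) \<and> 1 \<le> (1::real)" using h0 Hc by auto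
  note SUP = SUP_translates[where p="\<lambda>h. h" and c="\<lambda>h. 1" and A=H, OF Cc_right_uc[OF b(1)] b01 Hne]
  have w1: "right_uc w" unfolding w_def by (rule SUP(1))
  have w2: "b (h \<otimes> x) \<le> w x" if "h \<in> H" "x \<in> carrier G" for h x unfolding w_def using SUP(2)[OF that] by simp
  have w3: "w x \<le> M" if "\<And>h. h \<in> H \<Longrightarrow> 1 * b (h \<otimes> x) \<le> M" for x M unfolding w_def using that by (rule SUP(3))
  have w4: "0 \<le> w x" if "x \<in> carrier G" for x unfolding w_def by (rule SUP(4)[OF that])
  obtain K where K: "compactin T K" "\<And>x. x \<in> carrier G \<Longrightarrow> x \<notin> K \<Longrightarrow> b x = 0" using Cc_support[OF b(1)] by blast
  have wCc: "w \<in> Cc"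
  proof (rule CcI[OF right_uc_cont[OF w1] compact_set_mult[OF H(2) K(1)]])
    fix x assume x: "x \<in> carrier G" "x \<notin> C <#> K"
    have "1 * b (h \<otimes> x) \<le> 0" if h: "h \<in> H" for h
    proof -
      have "inv h \<in> C" using H(1,3) h subgroup.m_inv_closed by fastforce
      then have "h \<otimes> x \<notin> K" using x Hc[OF h] by (metis cancel_inv1 set_multI)
      then show ?thesis using K(2) Hc[OF h] x(1) by simp
    qed
    then have "w x \<le> 0" by (rule w3)
    then show "w x = 0" using w4[OF x(1)] by simp
  qed
  have winv_le: "w (h \<otimes> x) \<le> w x" if h: "h \<in> H" and x: "x \<in> carrier G" for h x
  proof (rule w3)
    fix h' assume h': "h' \<in> H"
    have "b ((h' \<otimes> h) \<otimes> x) \<le> w x" by (rule w2[OF subgroup.m_closed[OF H(1) h' h] x])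
    then show "1 * b (h' \<otimes> (h \<otimes> x)) \<le> w x" using Hc[OF h] Hc[OF h'] x by (simp add: m_assoc)
  qed
  have winv: "w (h \<otimes> x) = w x" if h: "h \<in> H" and x: "x \<in> carrier G" for h x
  proof (rule antisym[OF winv_le[OF h x]])
    have "w (inv h \<otimes> (h \<otimes> x)) \<le> w (h \<otimes> x)"
      using subgroup.m_inv_closed[OF H(1) h] Hc[OF h] x by (intro winv_le) auto
    then show "w x \<le> w (h \<otimes> x)" using Hc[OF h] x by simp
  qed
  interpret haar_kernel G T I w \<kappa>
  proof
    show "w \<in> Cc" by (rule wCc)
    show "0 \<le> w x" if "x \<in> carrier G" for x by (rule w4[OF that])
    show "0 < w \<one>" using w2[OF subgroup.one_closed[OF H(1)] one_closed] b(4) by simp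
    show "\<kappa> \<in> Cc" unfolding \<kappa>_def by (rule Cc_mult'[OF b(1) cont_inv[OF Cc_cont[OF b(1)]]])
    show "0 \<le> \<kappa> x" for x unfolding \<kappa>_def using b by simp
    show "\<kappa> x \<le> 1" for x unfolding \<kappa>_def using b by (intro mult_le_one) auto
    show "\<kappa> (inv x) = \<kappa> x" if "x \<in> carrier G" for x unfolding \<kappa>_def using that by (simp add: mult.commute)
  qed
  note h0c = Hc[OF h0(1)]
  have wh0: "\<forall>x\<in>carrier G. w (h0 \<otimes> x) = w x" using winv[OF h0(1)] by blast
  define v where "v = (\<lambda>k. (L ^^ k) \<kappa>)"
  have v: "cont (v k)" "L (v k) = v (Suc k)" for k
    unfolding v_def by (induction k) (auto intro: L_cont Cc_cont[OF kernel_Cc])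
  define F where "F = (\<lambda>k x. v k (h0 \<otimes> x) - v k x)"
  have vh: "cont (\<lambda>x. v k (h0 \<otimes> x))" for k by (rule cont_ltrans[OF h0c v(1)])
  have Fc: "cont (F k)" for k unfolding F_def by (rule cont_diff[OF vh v(1)])
  have FL: "L (F k) x = F (Suc k) x" if x: "x \<in> carrier G" for k x
    unfolding F_def L_diff[OF vh v(1) x] v(2)[symmetric] L_ltrans[OF v(1) h0c wh0 x] ..
  \<comment> \<open>At the identity the operator integrates against \<open>\<kappa>\<close> itself,
    by symmetry. The translated term drops out by disjointness of supports, and minus the weighted
    integral of the square of \<open>\<kappa>\<close> remains.\<close>
  have F1: "F (Suc 0) \<one> \<noteq> 0"
  proof -
    have kwk: "(\<lambda>y. \<kappa> y * \<kappa> y * w y) \<in> Cc" by (rule ip_Cc[OF Cc_cont[OF kernel_Cc] Cc_cont[OF kernel_Cc]])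
    have "F (Suc 0) \<one> = L (F 0) \<one>" using FL[of \<one> 0] by simp
    also have "\<dots> = I (\<lambda>y. (-1) * (\<kappa> y * \<kappa> y * w y))"
      unfolding L_def conv_def
    proof (rule I_cong[OF conv_Cc[OF weighted_Cc[OF Fc] kernel_Cc one_closed]])
      fix y assume y: "y \<in> carrier G"
      have "\<kappa> (h0 \<otimes> y) * \<kappa> y = 0"
      proof (rule ccontr)
        assume "\<kappa> (h0 \<otimes> y) * \<kappa> y \<noteq> 0"
        then have "h0 \<otimes> y \<in> W1" "y \<in> W1" using b(5) unfolding \<kappa>_def by auto
        then have "(h0 \<otimes> y) \<otimes> inv y \<noteq> h0" using W1(2,3) by blast
        then show False using h0c y by (simp add: m_assoc)
      qed
      then show "F 0 y * w y * \<kappa> (inv y \<otimes> \<one>) = (-1) * (\<kappa> y * \<kappa> y * w y)"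
        unfolding F_def v_def using y kernel_sym[OF y] by (auto simp: algebra_simps)
    qed
    also have "\<dots> = (-1) * I (\<lambda>y. \<kappa> y * \<kappa> y * w y)" by (rule I_scale[OF kwk])
    finally have "F (Suc 0) \<one> = - I (\<lambda>y. \<kappa> y * \<kappa> y * w y)" by simp
    moreover have "\<kappa> \<one> = 1" unfolding \<kappa>_def using b(4) by simp
    then have "0 < I (\<lambda>y. \<kappa> y * \<kappa> y * w y)"
      using w_one by (intro I_pos[OF kwk]) (auto simp: w_nonneg)
    ultimately show ?thesis by simp
  qed
  show False
  proof (rule power_iteration[of F, OF Fc FL F1], goal_cases)
    case (2 s g M \<rho>)
    note g = 2(1-4) and rho = 2(5) and app = 2(6)
    have inv: "g (h0 \<otimes> x) = g x" if "x \<in> wsupp" for x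
      by (rule eigenfunction_invariant[OF small g H(1) winv chain h0(1) that])
    have M: "0 \<le> M" using g(3)[OF one_closed] by linarith
    \<comment> \<open>The approximant \<open>c * F k x\<close> is orthogonal to \<open>g\<close>, so
      its squared norm is its inner product with its own error, at most
      \<open>M * \<epsilon> * mass\<close>; this has to fall below the lower bound
      \<open>\<rho>\<close>.\<close>
    define \<epsilon> where "\<epsilon> = \<rho> / (2 * (M * mass + 1))"
    have MX: "0 < M * mass + 1" using M mass_pos by (simp add: add_nonneg_pos)
    have eps: "0 < \<epsilon>" "M * \<epsilon> * mass < \<rho>"
      unfolding \<epsilon>_def using rho MX M mass_pos by (auto simp: field_simps add_pos_nonneg)
    obtain k c where k: "\<And>x. x \<in> wsupp \<Longrightarrow> \<bar>c * F k x - g x\<bar> \<le> \<epsilon>" "\<And>x. x \<in> wsupp \<Longrightarrow> \<bar>c * F k x\<bar> \<le> M"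
      "\<rho> \<le> ip (\<lambda>x. c * F k x) (\<lambda>x. c * F k x)" using app[OF eps(1)] by blast
    \<comment> \<open>Where \<open>w\<close> is nonzero \<open>g\<close> is invariant under
      \<open>h0\<close>, and so is \<open>w\<close> everywhere; substituting
      \<open>h0 \<otimes> x\<close> for \<open>x\<close> therefore removes \<open>h0\<close> from
      the inner product.\<close>
    have "ip (\<lambda>x. v k (h0 \<otimes> x)) g = I (\<lambda>x. v k (h0 \<otimes> x) * g (h0 \<otimes> x) * w (h0 \<otimes> x))"
      unfolding ip_def
    proof (rule I_cong[OF ip_Cc[OF vh g(2)]])
      fix x assume x: "x \<in> carrier G"
      have "g x * w x = g (h0 \<otimes> x) * w (h0 \<otimes> x)"
        using inv[of x] winv[OF h0(1) x] x unfolding wsupp_def by (cases "w x = 0") auto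
      then show "v k (h0 \<otimes> x) * g x * w x = v k (h0 \<otimes> x) * g (h0 \<otimes> x) * w (h0 \<otimes> x)" by simp
    qed
    also have "\<dots> = ip (v k) g" unfolding ip_def by (rule I_ltrans[OF ip_Cc[OF v(1) g(2)] h0c])
    finally have "ip (F k) g = 0" unfolding F_def ip_diff[OF vh v(1) g(2)] by simp
    then have orth: "ip (\<lambda>x. c * F k x) g = 0" using ip_scale[OF Fc g(2)] by simp
    define f where "f = (\<lambda>x. c * F k x)"
    have f: "cont f" unfolding f_def by (rule cont_scale[OF Fc])
    have "ip f f = ip (\<lambda>x. f x - g x) f"
      using ip_diff[OF f g(2) f] orth ip_commute[of g f] unfolding f_def by simp
    also have "\<dots> \<le> I (\<lambda>x. (M * \<epsilon>) * w x)"
      unfolding ip_def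
    proof (rule I_mono[OF ip_Cc[OF cont_diff[OF f g(2)] f] Cc_scale[OF w_Cc]])
      fix x assume x: "x \<in> carrier G"
      show "(f x - g x) * f x * w x \<le> (M * \<epsilon>) * w x"
      proof (cases "w x = 0")
        case False
        then have xS: "x \<in> wsupp" using x unfolding wsupp_def by simp
        have "\<bar>f x - g x\<bar> * \<bar>f x\<bar> \<le> \<epsilon> * M"
          using k(1,2)[OF xS] eps unfolding f_def by (intro mult_mono) auto
        then have "(f x - g x) * f x \<le> M * \<epsilon>" by (simp add: abs_mult[symmetric] mult.commute)
        then show ?thesis by (rule mult_right_mono[OF _ w_nonneg[OF x]])
      qed simp
    qed
    also have "\<dots> = M * \<epsilon> * mass" unfolding mass_def by (rule I_scale[OF w_Cc])
    finally show False using k(3) eps(2) unfolding f_def by linarith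
  qed
qed

text \<open>Without such an \<open>H\<close> the trapped subgroup would be both nontrivial and
  trivial.\<close>

lemma small_powers_open_subgroup:
  assumes small_powers "nb U"
  obtains H where "subgroup H G" "nb H" "H \<subseteq> U"
  using trapped_subgroup[OF assms] chain_connected_subgroup_trivial[OF assms(1)] by metis

end

context lc_group begin

section \<open>Open subgroups\<close>

text \<open>Each \<open>x\<close> has a neighbourhood inside its own left coset \<open>x H\<close>,
  and there membership in \<open>a H\<close> is constant.\<close>

lemma open_subgroup_coset:
  assumes H: "subgroup H G" "nb H" and a: "a \<in> carrier G"
  shows "openin T {x \<in> carrier G. inv a \<otimes> x \<in> H}" "openin T {x \<in> carrier G. inv a \<otimes> x \<notin> H}"
proof -
  have *: "\<exists>W. openin T W \<and> x \<in> W \<and> (\<forall>y\<in>W. y \<in> carrier G \<and> (inv a \<otimes> y \<in> H \<longleftrightarrow> inv a \<otimes> x \<in> H))"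
    if x: "x \<in> carrier G" for x
  proof -
    obtain W where W: "openin T W" "x \<in> W" "\<And>y. y \<in> W \<Longrightarrow> inv x \<otimes> y \<in> H"
      using nb_translate[OF H(2) x] by blast
    have "y \<in> carrier G \<and> (inv a \<otimes> y \<in> H \<longleftrightarrow> inv a \<otimes> x \<in> H)" if y: "y \<in> W" for y
    proof -
      have yc: "y \<in> carrier G" using W(1) y openin_subset topspace_eq_carrier by blast
      have "(inv a \<otimes> x) \<otimes> (inv x \<otimes> y) = inv a \<otimes> y" "(inv a \<otimes> y) \<otimes> inv (inv x \<otimes> y) = inv a \<otimes> x"
        using a x yc by (simp_all add: m_assoc inv_mult_group)
      then show ?thesis
        using W(3)[OF y] yc subgroup.m_closed[OF H(1)] subgroup.m_inv_closed[OF H(1)] by metis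
    qed
    then show ?thesis using W by blast
  qed
  show "openin T {x \<in> carrier G. inv a \<otimes> x \<in> H}"
  proof (subst openin_subopen, intro ballI)
    fix x assume "x \<in> {x \<in> carrier G. inv a \<otimes> x \<in> H}"
    then show "\<exists>W. openin T W \<and> x \<in> W \<and> W \<subseteq> {x \<in> carrier G. inv a \<otimes> x \<in> H}" using *[of x] by blast
  qed
  show "openin T {x \<in> carrier G. inv a \<otimes> x \<notin> H}"
  proof (subst openin_subopen, intro ballI)
    fix x assume "x \<in> {x \<in> carrier G. inv a \<otimes> x \<notin> H}"
    then show "\<exists>W. openin T W \<and> x \<in> W \<and> W \<subseteq> {x \<in> carrier G. inv a \<otimes> x \<notin> H}" using *[of x] by blast
  qed
qed

text \<open>For \<open>y \<noteq> a\<close> some \<open>H\<close> omits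
  \<open>inv a \<otimes> y\<close>; the coset \<open>a H\<close> contains \<open>a\<close> but not
  \<open>y\<close>, and it is open with open complement, so no connected set contains both.\<close>

lemma open_subgroups_totally_disconnected:
  assumes "\<And>U. nb U \<Longrightarrow> \<exists>H. subgroup H G \<and> nb H \<and> H \<subseteq> U"
  shows "totally_disconnected_space T"
  unfolding totally_disconnected_space_def
proof
  fix C assume C: "C \<in> connected_components_of T"
  then have "C \<noteq> {}" and conn: "connectedin T C"
    using nonempty_connected_components_of connectedin_connected_components_of by blast+
  then obtain a where a: "a \<in> C" by blast
  have Cc: "C \<subseteq> carrier G" using connectedin_subset_topspace[OF conn] topspace_eq_carrier by simp
  have "y = a" if y: "y \<in> C" for y
  proof (rule ccontr)
    assume ne: "y \<noteq> a"
    have yc: "y \<in> carrier G" and ac: "a \<in> carrier G" using y a Cc by auto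
    have "closedin T {inv a \<otimes> y}"
      by (rule compactin_imp_closedin[OF Hausdorff]) (use yc ac in \<open>simp add: topspace_eq_carrier\<close>)
    moreover have "inv a \<otimes> y \<noteq> \<one>"
    proof
      assume "inv a \<otimes> y = \<one>"
      then have "a \<otimes> (inv a \<otimes> y) = a" using ac by simp
      then show False using ne ac yc by simp
    qed
    ultimately have "nb (carrier G - {inv a \<otimes> y})"
      by (intro nb_open) (auto simp: closedin_def topspace_eq_carrier)
    then obtain H where H: "subgroup H G" "nb H" "H \<subseteq> carrier G - {inv a \<otimes> y}" using assms by blast
    define E1 E2 where "E1 = {x \<in> carrier G. inv a \<otimes> x \<in> H}" and "E2 = {x \<in> carrier G. inv a \<otimes> x \<notin> H}"
    have "openin T E1" "openin T E2"
      unfolding E1_def E2_def by (rule open_subgroup_coset[OF H(1,2) ac])+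
    moreover have "C \<subseteq> E1 \<union> E2" "E1 \<inter> E2 \<inter> C = {}" using Cc unfolding E1_def E2_def by auto
    moreover have "a \<in> E1 \<inter> C" using a ac subgroup.one_closed[OF H(1)] unfolding E1_def by simp
    moreover have "y \<in> E2 \<inter> C" using y yc H(3) unfolding E2_def by auto
    ultimately show False using conn unfolding connectedin by blast
  qed
  then show "\<exists>x. C = {x}" using a by blast
qed

text \<open>In a compact Hausdorff space components and quasi-components agree, so a clopen subset
  \<open>A\<close> of \<open>C\<close> separates the identity from the part of \<open>C\<close>
  outside \<open>W\<close>. The subgroup is the right stabiliser of \<open>A\<close>, a
  neighbourhood of the identity because \<open>A\<close> is compact and open.\<close>

lemma van_Dantzig:
  assumes td: "totally_disconnected_space T" and U: "nb U"
  obtains H where "subgroup H G" "nb H" "H \<subseteq> U"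
proof -
  obtain C where C: "nb C" "compactin T C" "C \<subseteq> U" using nb_compact[OF U] by blast
  obtain W where W: "openin T W" "\<one> \<in> W" "W \<subseteq> C" using C(1) unfolding neighbourhood_in_def by auto
  define Y where "Y = subtopology T C"
  have tY: "topspace Y = C" unfolding Y_def using compactin_subset_topspace[OF C(2)] by auto
  have Y: "compact_space Y" "Hausdorff_space Y"
    unfolding Y_def using C(2) Hausdorff by (auto intro: compact_space_subtopology Hausdorff_space_subtopology)
  have "quasi_component_of Y \<one> = connected_component_of Y \<one>"
    by (rule quasi_eq_connected_component_of) (use Y in blast)
  moreover have "connected_component_of_set Y \<one> \<subseteq> {\<one>}"
  proof -
    have "connectedin T (connected_component_of_set Y \<one>)"
      using connectedin_connected_component_of[of Y \<one>] unfolding Y_def connectedin_subtopology by blast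
    moreover have "\<one> \<in> connected_component_of_set Y \<one>"
      using W tY by (auto simp: connected_component_of_refl)
    ultimately have "connected_component_of_set Y \<one> \<subseteq> connected_component_of_set T \<one>"
      by (rule connected_component_of_maximal)
    moreover have "connected_component_of_set T \<one> \<in> connected_components_of T"
      by (simp add: connected_component_in_connected_components_of topspace_eq_carrier)
    then obtain x where "connected_component_of_set T \<one> = {x}"
      using td unfolding totally_disconnected_space_def by blast
    moreover have "\<one> \<in> connected_component_of_set T \<one>"
      by (simp add: connected_component_of_refl topspace_eq_carrier)
    ultimately show ?thesis by auto
  qed
  ultimately have q: "quasi_component_of_set Y \<one> \<subseteq> {\<one>}" by simp
  have one: "\<one> \<in> topspace Y" using W tY by auto
  have qc: "quasi_component_of_set Y \<one> \<in> quasi_components_of Y"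
    using one unfolding quasi_components_of_def by blast
  have "openin Y (C \<inter> W)" unfolding Y_def by (rule openin_subtopology_Int2[OF W(1)])
  then have "closedin Y (topspace Y - C \<inter> W)" by blast
  then have "closedin Y (topspace Y - W)" unfolding tY by (simp add: Diff_Int)
  then have "compactin Y (topspace Y - W)" using Y(1) closedin_compact_space by blast
  then have "separated_between Y (quasi_component_of_set Y \<one>) (topspace Y - W)"
    using separated_between_quasi_component_compact[OF qc] q W(2) unfolding disjnt_def by blast
  then obtain A B where AB: "openin Y A" "openin Y B" "A \<union> B = topspace Y" "disjnt A B"
    "quasi_component_of_set Y \<one> \<subseteq> A" "topspace Y - W \<subseteq> B"
    unfolding separated_between_def by blast
  have oneA: "\<one> \<in> A" using AB(5) one by (auto simp: quasi_component_of_refl)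
  have AW: "A \<subseteq> W" using AB(3,4,6) unfolding disjnt_def by blast
  obtain O' where O': "openin T O'" "A = O' \<inter> C" using AB(1) unfolding Y_def openin_subtopology by blast
  \<comment> \<open>Open relative to \<open>C\<close> becomes open in \<open>T\<close> because
    \<open>A\<close> stays inside the open set \<open>W \<subseteq> C\<close>.\<close>
  have "A = O' \<inter> W" using O'(2) AW W(3) by blast
  then have Aopen: "openin T A" using O'(1) W(1) by auto
  have "A = topspace Y - B" using AB(3,4) unfolding disjnt_def by blast
  then have "closedin Y A" using AB(2) by blast
  then have "compactin Y A" using Y(1) closedin_compact_space by blast
  then have Acomp: "compactin T A" unfolding Y_def compactin_subtopology by blast
  obtain V0 where V0: "nb V0" "\<And>x v. x \<in> A \<Longrightarrow> v \<in> V0 \<Longrightarrow> x \<otimes> v \<in> A"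
  proof (rule nb_tube[OF Acomp continuous_mult Aopen])
    fix x assume "x \<in> A"
    then show "(case (x, \<one>) of (x, y) \<Rightarrow> x \<otimes> y) \<in> A" using compact_carrier[OF Acomp] by auto
  qed auto
  have Ac: "x \<in> carrier G" if "x \<in> A" for x using that compact_carrier[OF Acomp] by blast
  \<comment> \<open>Asking both \<open>h\<close> and \<open>inv h\<close> to map \<open>A\<close>
    into itself builds in closure under inverses. Since the identity lies in \<open>A\<close>,
    \<open>H \<subseteq> A \<subseteq> U\<close>.\<close>
  define H where "H = {h \<in> carrier G. \<forall>x\<in>A. x \<otimes> h \<in> A \<and> x \<otimes> inv h \<in> A}"
  have "subgroup H G"
  proof (rule subgroupI)
    show "H \<subseteq> carrier G" unfolding H_def by blast
    have "\<one> \<in> H" unfolding H_def using Ac by simp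
    then show "H \<noteq> {}" by blast
    show "inv h \<in> H" if "h \<in> H" for h using that unfolding H_def by simp
    show "h \<otimes> k \<in> H" if hk: "h \<in> H" "k \<in> H" for h k
    proof -
      have "x \<otimes> (h \<otimes> k) = x \<otimes> h \<otimes> k" "x \<otimes> inv (h \<otimes> k) = x \<otimes> inv k \<otimes> inv h" if "x \<in> A" for x
        using hk Ac[OF that] unfolding H_def by (auto simp: m_assoc inv_mult_group)
      then show ?thesis using hk unfolding H_def by simp
    qed
  qed
  moreover have "nb H"
  proof (rule nb_mono)
    show "nb (V0 \<inter> {x \<in> carrier G. inv x \<in> V0})" by (rule nb_Int[OF V0(1) nb_inv[OF V0(1)]])
    show "V0 \<inter> {x \<in> carrier G. inv x \<in> V0} \<subseteq> H" unfolding H_def using V0(2) by blast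
  qed (auto simp: H_def)
  moreover have "H \<subseteq> U"
  proof
    fix h assume "h \<in> H"
    then have "\<one> \<otimes> h \<in> A" "h \<in> carrier G" unfolding H_def using oneA by blast+
    then show "h \<in> U" using AW W(3) C(3) by auto
  qed
  ultimately show thesis by (rule that)
qed

section \<open>Quasi non-archimedean groups and small open subgroups\<close>

lemma quasi_non_archimedean_imp_small_powers:
  assumes "quasi_non_archimedean G T"
  shows small_powers
  unfolding small_powers_def
proof (intro allI impI)
  fix U assume "nb U"
  then obtain V where V: "nb V" "\<And>g :: nat \<Rightarrow> 'a. \<forall>i\<in>{1..1}. g i \<in> V \<Longrightarrow> generate G (g ` {1..1}) \<subseteq> U"
    using assms unfolding quasi_non_archimedean_def by meson
  have "g [^] i \<in> U" if g: "g \<in> V" for g and i :: nat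
  proof -
    have "g \<in> carrier G" using V(1) g nb_in_carrier by blast
    have "g [^] i \<in> generate G {g}"
      by (induction i) (auto intro: generate.intros)
    then show ?thesis using V(2)[of "\<lambda>_. g"] g by auto
  qed
  then show "\<exists>V. nb V \<and> (\<forall>g\<in>V. \<forall>i::nat. g [^] i \<in> U)" using V(1) by blast
qed

lemma open_subgroups_quasi_non_archimedean:
  assumes "\<And>U. nb U \<Longrightarrow> \<exists>H. subgroup H G \<and> nb H \<and> H \<subseteq> U"
  shows "quasi_non_archimedean G T"
  unfolding quasi_non_archimedean_def
proof (intro allI impI)
  fix U and n :: nat
  assume "nb U"
  then obtain H where H: "subgroup H G" "nb H" "H \<subseteq> U" using assms by blast
  have "generate G (g ` {1..n}) \<subseteq> U" if "\<forall>i\<in>{1..n}. g i \<in> H" for g :: "nat \<Rightarrow> 'a"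
    using generate_subgroup_incl[OF _ H(1), of "g ` {1..n}"] that H(3) by blast
  then show "\<exists>V. nb V \<and> (\<forall>g :: nat \<Rightarrow> 'a. (\<forall>i\<in>{1..n}. g i \<in> V) \<longrightarrow> generate G (g ` {1..n}) \<subseteq> U)"
    using H(2) by blast
qed

lemma quasi_non_archimedean_imp_open_subgroup:
  assumes "quasi_non_archimedean G T" "nb U"
  shows "\<exists>H. subgroup H G \<and> nb H \<and> H \<subseteq> U"
proof -
  obtain I where "haar_group G T I" using haar_group_exists by blast
  then interpret haar_group G T I .
  show ?thesis
    using small_powers_open_subgroup[OF quasi_non_archimedean_imp_small_powers[OF assms(1)] assms(2)] by blast
qed

end

theorem theorem1p11:
  fixes G :: "('a, 'b) monoid_scheme" and T :: "'a topology"
  assumes "topological_group G T"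
    and "separable_space T"
    and "locally_compact_space T"
  shows "quasi_non_archimedean G T \<longleftrightarrow> totally_disconnected_space T"
proof -
  interpret lc_group G T
    using assms by (simp add: lc_group_def lc_group_axioms_def)
  show ?thesis
  proof
    assume "quasi_non_archimedean G T"
    then show "totally_disconnected_space T"
      by (intro open_subgroups_totally_disconnected quasi_non_archimedean_imp_open_subgroup)
  next
    assume "totally_disconnected_space T"
    then show "quasi_non_archimedean G T"
      using van_Dantzig by (intro open_subgroups_quasi_non_archimedean) metis
  qed
qed

end
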